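(* Fix $p\geq 1$, and let $u$ and $v$ be weights on $\mathbb R^n$ such that $u\in A_{p}^{\mathcal R}$ and $uv^p\in A_{\infty}$. Then there exists a constant $C>0$ such that for every measurable function $f$ on $\mathbb R^n$, $$\left\Vert \frac{Mf}{v}\right\Vert_{L^{p,\infty}(uv^p)} \leq C\, \Vert f\Vert_{L^{p,1}(u)}.$$
   Context: A weight is a positive, locally integrable function on $\mathbb R^n$. Cubes have sides parallel to the axes. For a weight $w$ and a measurable set $E$, $w(E)=\int_E w(x)\,dx$, and $\frac1p+\frac1{p'}=1$. The Hardy-Littlewood maximal operator is $Mf(x)=\sup_{Q\ni x}\frac1{|Q|}\int_Q|f|$, the supremum being over all cubes $Q$ containing $x$. For a weight $w$ (identified with the measure $w(x)\,dx$), put $\lambda_f^w(y)=w(\{x:|f(x)|>y\})$. For $p>0$: $\Vert f\Vert_{L^{p,1}(w)}=p\int_0^\infty \lambda_f^w(y)^{1/p}\,dy$ and $\Vert f\Vert_{L^{p,\infty}(w)}=\sup_{y>0} y\,\lambda_f^w(y)^{1/p}$; $L^{\infty,\infty}(w)$ means $L^\infty(w)$. For $1\le p<\infty$, $w\in A_p^{\mathcal R}$ means $[w]_{A_p^{\mathcal R}}=\sup_Q w(Q)^{1/p}\,\frac{\Vert \chi_Q w^{-1}\Vert_{L^{p',\infty}(w)}}{|Q|}<\infty$ (supremum over all cubes), so $A_1^{\mathcal R}=A_1$. $A_\infty=\bigcup_{q\ge1}A_q=\bigcup_{q\geq 1}A_q^{\mathcal R}$, where $A_q$ denotes the Muckenhoupt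 classes. *)

theory Defs
  imports "HOL-Analysis.Analysis" "HOL-Probability.Essential_Supremum"
begin

text \<open>Real power on \<open>[0,\<infinity>]\<close>. It is only used with exponents \<open>a > 0\<close>, for which
  \<open>\<infinity>\<close> to the power \<open>a\<close> is \<open>\<infinity>\<close> and \<open>0\<close> to the power \<open>a\<close> is \<open>0\<close>.\<close>

definition ennreal_powr :: "ennreal \<Rightarrow> real \<Rightarrow> ennreal" (infixr \<open>epowr\<close> 80)
  where "x epowr a = (if x = top then top else ennreal (enn2real x powr a))"

definition cubes :: "(real ^ 'n) set set"
  where "cubes = {cbox a (a + (\<chi> i. l)) | a l. l > 0}"

definition weight :: "(real ^ 'n \<Rightarrow> real) \<Rightarrow> bool"
  where "weight w \<longleftrightarrow>
    (\<forall>x. w x > 0) \<and> (\<forall>K. compact K \<longrightarrow> w absolutely_integrable_on K)"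

definition weight_measure :: "(real ^ 'n \<Rightarrow> real) \<Rightarrow> (real ^ 'n) measure"
  where "weight_measure w = density lebesgue (\<lambda>x. ennreal (w x))"

definition average :: "(real ^ 'n) set \<Rightarrow> (real ^ 'n \<Rightarrow> real) \<Rightarrow> ennreal"
  where "average Q f = (\<integral>\<^sup>+x\<in>Q. ennreal \<bar>f x\<bar> \<partial>lebesgue) / emeasure lebesgue Q"

definition maximal_function :: "(real ^ 'n \<Rightarrow> real) \<Rightarrow> real ^ 'n \<Rightarrow> ennreal"
  where "maximal_function f x = (SUP Q\<in>{Q \<in> cubes. x \<in> Q}. average Q f)"

text \<open>The distribution function and the Lorentz (quasi-)norms take as argument the absolute
  value \<open>g = \<bar>f\<bar>\<close>, with values in \<open>[0,\<infinity>]\<close>, since maximal functions may be infinite.\<close>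

definition distribution_fun :: "'a measure \<Rightarrow> ('a \<Rightarrow> ennreal) \<Rightarrow> real \<Rightarrow> ennreal"
  where "distribution_fun M g y = emeasure M {x \<in> space M. g x > ennreal y}"

definition lorentz_1 :: "'a measure \<Rightarrow> real \<Rightarrow> ('a \<Rightarrow> ennreal) \<Rightarrow> ennreal"
  where "lorentz_1 M p g =
    ennreal p * (\<integral>\<^sup>+y\<in>{0<..}. distribution_fun M g y epowr (1 / p) \<partial>lborel)"

definition lorentz_weak :: "'a measure \<Rightarrow> ennreal \<Rightarrow> ('a \<Rightarrow> ennreal) \<Rightarrow> ennreal"
  where "lorentz_weak M p g =
    (if p = top then esssup M g
     else (SUP y\<in>{0<..}. ennreal y * distribution_fun M g y epowr (1 / enn2real p)))"

definition conjugate_exponent :: "real \<Rightarrow> ennreal"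
  where "conjugate_exponent p = (if p = 1 then top else ennreal (p / (p - 1)))"

definition restricted_constant :: "real \<Rightarrow> (real ^ 'n \<Rightarrow> real) \<Rightarrow> ennreal"
  where "restricted_constant p w =
    (SUP Q\<in>cubes. emeasure (weight_measure w) Q epowr (1 / p) *
       lorentz_weak (weight_measure w) (conjugate_exponent p)
         (\<lambda>x. indicator Q x * ennreal (inverse (w x))) / emeasure lebesgue Q)"

definition A_restricted :: "real \<Rightarrow> (real ^ 'n \<Rightarrow> real) set"
  where "A_restricted p = {w. weight w \<and> restricted_constant p w < top}"

text \<open>In the exponent below, \<open>1 - q' = - 1 / (q - 1)\<close>.\<close>

definition Muckenhoupt :: "real \<Rightarrow> (real ^ 'n \<Rightarrow> real) set"
  where "Muckenhoupt q = {w. weight w \<and>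
    (if q = 1
     then \<exists>C::real. AE x in lebesgue. maximal_function w x \<le> ennreal (C * w x)
     else (SUP Q\<in>cubes. average Q w *
             average Q (\<lambda>x. w x powr (- 1 / (q - 1))) epowr (q - 1)) < top)}"

definition A_infinity :: "(real ^ 'n \<Rightarrow> real) set"
  where "A_infinity = (\<Union>q\<in>{1..}. Muckenhoupt q)"

end

theory Submission
  imports Defs
begin

text \<open>
  Write \<open>U = u dx\<close> and \<open>W = u v\<^sup>p dx\<close>. The proof is a dyadic stopping-time argument in which Lebesgue
  measure serves only to compare \<open>U\<close> with \<open>W\<close>.

  \<^bold>\<open>Comparison of the two measures.\<close> Both hypotheses give, with \<open>r = p\<close> for \<open>u\<close> and some \<open>r\<close> for
  \<open>u v\<^sup>p\<close>, the bound \<open>(|E|/|Q|)\<^sup>r \<le> C \<mu>(E)/\<mu>(Q)\<close> for all measurable subsets \<open>E\<close> of cubes \<open>Q\<close>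
  (\<open>A_restricted_imp_comparable\<close>, \<open>A_infinity_imp_comparable\<close>). A Calderon-Zygmund iteration converts
  such a bound into the opposite one, \<open>\<mu>(E)/\<mu>(Q) \<le> K (|E|/|Q|)\<^sup>\<delta>\<close>
  (\<open>comparable_imp_power_decay\<close>). Composing the two, each of \<open>U(E)/U(Q)\<close> and \<open>W(E)/W(Q)\<close> is at most
  a constant times a positive power of the other (\<open>two_weight_decay\<close>), and both measures are doubling.

  \<^bold>\<open>Dyadic weak type bound.\<close> If \<open>Mf(x) > t\<close>, then \<open>x\<close> lies in the triple of a dyadic cube whose
  average of \<open>|f|\<close> exceeds a fixed multiple of \<open>t\<close> (\<open>maximal_function_dyadic\<close>). So it suffices to
  bound the \<open>W\<close>-measure of the points \<open>x\<close> lying in the triple of some \<open>Q\<close> with \<open>g(Q) > v(x)\<close>, where \<open>g(Q)\<close> is a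
  multiple of the average. Sort the points by the integer \<open>k\<close> with \<open>2\<^sup>k \<le> v(x) < 2\<^bsup>k+1\<^esup>\<close>, take the
  maximal cubes \<open>Q\<close> with \<open>g(Q) > 2\<^sup>k\<close>, and sort these by the integer \<open>l\<close> for which \<open>W(Q)/U(Q)\<close>, the
  \<open>U\<close>-mean of \<open>v\<^sup>p\<close>, is about \<open>2\<^bsup>p(k+l)\<^esup>\<close>. Two facts make the sum over all \<open>k\<close>, \<open>l\<close> and \<open>Q\<close> converge:
  \<^item> the part of the triple of \<open>Q\<close> on which \<open>v\<close> is about \<open>2\<^sup>k\<close> has \<open>W\<close>-measure at most
    \<open>C \<theta>\<^bsup>|l|\<^esup> 2\<^bsup>kp\<^esup> U(Q)\<close> with \<open>\<theta> < 1\<close>, because there \<open>v\<^sup>p\<close> differs from its mean over \<open>Q\<close> by a factor of about \<open>2\<^bsup>pl\<^esup>\<close>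
    (\<open>piece_bound\<close>);
  \<^item> for fixed \<open>l\<close> the cubes are \<open>W\<close>-Carleson: inside such a cube, those belonging to a level \<open>m\<close> steps higher occupy
    a set on which the mean of \<open>v\<^sup>p\<close> has grown by \<open>2\<^bsup>pm\<^esup>\<close>, hence a geometrically small proportion
    (\<open>descendants_bound\<close>). So only the maximal, pairwise disjoint, cubes count (\<open>offset_class_bound\<close>).

  \<^bold>\<open>Disjoint cubes.\<close> For one cube, the bound \<open>(|E|/|Q|)\<^sup>p \<le> C U(E)/U(Q)\<close> for the sets \<open>E = Q \<inter> {|f| > y}\<close>
  and the layer cake formula bound the average of \<open>|f|\<close> times \<open>U(Q)\<^bsup>1/p\<^esup>\<close> by the \<open>L\<^bsup>p,1\<^esup>(u)\<close> norm of \<open>f\<close> on \<open>Q\<close>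
  (\<open>cell_average_bound\<close>); Minkowski's inequality adds up these estimates over disjoint cubes
  (\<open>disjoint_averages_bound\<close>).
\<close>

section \<open>The measure of a weight\<close>

text \<open>A weight is only assumed integrable on compact sets; it is the pointwise limit of its truncations
  to balls.\<close>

lemma weight_borel: "weight w \<Longrightarrow> w \<in> borel_measurable lebesgue"
proof -
  assume w: "weight w"
  have 1: "(\<lambda>x. indicat_real (cball 0 (real k)) x *\<^sub>R w x) \<in> borel_measurable lebesgue" for k
    using w unfolding weight_def set_integrable_def by (auto dest!: spec[of _ "cball 0 (real k)"] simp: set_integrable_def)
  have 2: "(\<lambda>k. indicat_real (cball 0 (real k)) x *\<^sub>R w x) \<longlonglongrightarrow> w x" for x
  proof (rule tendsto_eventually)
    show "\<forall>\<^sub>F k in sequentially. indicat_real (cball 0 (real k)) x *\<^sub>R w x = w x"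
      using eventually_ge_at_top[of "nat \<lceil>norm x\<rceil>"]
      by eventually_elim (auto simp: indicator_def dist_norm)
  qed
  show ?thesis using 1 2 by (rule borel_measurable_LIMSEQ_metric)
qed

lemma sets_weight [simp]: "sets (weight_measure w) = sets lebesgue"
  by (simp add: weight_measure_def)

lemma space_weight [simp]: "space (weight_measure w) = UNIV"
  by (simp add: weight_measure_def)

lemma weight_pos: "weight w \<Longrightarrow> w x > 0"
  by (simp add: weight_def)

lemma weight_emeasure:
  assumes "weight w" "E \<in> sets lebesgue"
  shows "emeasure (weight_measure w) E = (\<integral>\<^sup>+x\<in>E. ennreal (w x) \<partial>lebesgue)"
  unfolding weight_measure_def using weight_borel[OF assms(1)] assms(2) by (subst emeasure_density) auto

lemma weight_compact_finite:
  assumes "weight w" "compact K"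
  shows "emeasure (weight_measure w) K < \<infinity>"
proof -
  have K: "K \<in> sets lebesgue" using assms(2) by (simp add: compact_imp_closed)
  have "integrable lebesgue (\<lambda>x. indicat_real K x *\<^sub>R w x)"
    using assms unfolding weight_def set_integrable_def by auto
  then have "(\<integral>\<^sup>+x. ennreal (norm (indicat_real K x *\<^sub>R w x)) \<partial>lebesgue) < \<infinity>"
    by (simp add: integrable_iff_bounded)
  moreover have "(\<integral>\<^sup>+x. ennreal (norm (indicat_real K x *\<^sub>R w x)) \<partial>lebesgue) = (\<integral>\<^sup>+x\<in>K. ennreal (w x) \<partial>lebesgue)"
    by (rule nn_integral_cong) (auto simp: indicator_def less_imp_le[OF weight_pos[OF assms(1)]])
  ultimately show ?thesis using weight_emeasure[OF assms(1) K] by simp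
qed

lemma weight_fmeasurable:
  assumes "weight w" "compact K" "E \<subseteq> K" "E \<in> sets lebesgue"
  shows "E \<in> fmeasurable (weight_measure w)"
proof -
  have K: "K \<in> sets lebesgue" using assms(2) by (simp add: compact_imp_closed)
  have "emeasure (weight_measure w) E \<le> emeasure (weight_measure w) K"
    using assms K by (intro emeasure_mono) auto
  also have "\<dots> < \<infinity>" by (rule weight_compact_finite[OF assms(1,2)])
  finally show ?thesis using assms(4) by (intro fmeasurableI) auto
qed

lemma weight_null:
  assumes "weight w" "E \<in> null_sets lebesgue"
  shows "E \<in> null_sets (weight_measure w)"
  using absolutely_continuousI_density[of "\<lambda>x. ennreal (w x)" lebesgue] weight_borel[OF assms(1)] assms(2)
  unfolding weight_measure_def absolutely_continuous_def by auto

text \<open>The measure of a weight has the same null sets as Lebesgue measure because the density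
  vanishes nowhere. This makes boundaries of cubes irrelevant and gives every cube positive measure.\<close>

lemma weight_null_iff:
  assumes "weight w" 
  shows "E \<in> null_sets (weight_measure w) \<longleftrightarrow> E \<in> null_sets lebesgue"
proof
  assume "E \<in> null_sets (weight_measure w)"
  then have "E \<in> sets lebesgue" "(\<integral>\<^sup>+x\<in>E. ennreal (w x) \<partial>lebesgue) = 0"
    using weight_emeasure[OF assms, of E] by (auto simp: null_sets_def)
  then have "AE x in lebesgue. ennreal (w x) * indicator E x = 0"
    using weight_borel[OF assms] by (subst (asm) nn_integral_0_iff_AE) auto
  then have "AE x in lebesgue. x \<notin> E"
  proof eventually_elim
    case (elim x)
    then show ?case using weight_pos[OF assms, of x] by (auto simp: indicator_def split: if_splits)
  qed
  then show "E \<in> null_sets lebesgue"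
    using \<open>E \<in> sets lebesgue\<close> by (simp add: AE_iff_null_sets)
qed (rule weight_null[OF assms])

lemma weight_density_le:
  assumes "weight u" "weight w" "E \<in> sets lebesgue" "\<And>x. x \<in> E \<Longrightarrow> w x \<le> c * u x" "c \<ge> 0"
    and "E \<in> fmeasurable (weight_measure u)"
  shows "measure (weight_measure w) E \<le> c * measure (weight_measure u) E"
proof -
  have "emeasure (weight_measure w) E \<le> (\<integral>\<^sup>+x. ennreal c * (ennreal (u x) * indicator E x) \<partial>lebesgue)"
    unfolding weight_emeasure[OF assms(2,3)]
    using assms(4,5) weight_pos[OF assms(1)]
    by (intro nn_integral_mono) (auto simp: indicator_def ennreal_mult''[symmetric] less_imp_le)
  also have "\<dots> = ennreal c * emeasure (weight_measure u) E"
    using weight_borel[OF assms(1)] assms(3) unfolding weight_emeasure[OF assms(1,3)]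
    by (subst nn_integral_cmult) auto
  finally have *: "emeasure (weight_measure w) E \<le> ennreal c * emeasure (weight_measure u) E" .
  have "emeasure (weight_measure u) E = ennreal (measure (weight_measure u) E)"
    using assms(6) by (simp add: emeasure_eq_measure2 fmeasurableD2 emeasure_eq_ennreal_measure)
  then have "emeasure (weight_measure w) E \<le> ennreal (c * measure (weight_measure u) E)"
    using * assms(5) by (simp add: ennreal_mult')
  then show ?thesis unfolding measure_def[of "weight_measure w"]
    by (metis assms(5) enn2real_leI measure_nonneg mult_nonneg_nonneg)
qed

section \<open>Grids of half-open cubes\<close>

text \<open>Cells are encoded through the floor function, so that the index of the cell of side \<open>2\<^sup>j s\<close> containing a
  point is the quotient by \<open>2\<^sup>j\<close> of its index for side \<open>s\<close>; nestedness becomes integer division. The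
  corner \<open>c\<close> and the side \<open>s\<close> are free, so any cube is, up to a null set, a cell of the grid based at its own corner.\<close>

definition grid_cell :: "real ^ 'n \<Rightarrow> real \<Rightarrow> int ^ 'n \<Rightarrow> (real ^ 'n) set"
  where "grid_cell c s m = {x. \<forall>i. \<lfloor>(x $ i - c $ i) / s\<rfloor> = m $ i}"

definition grid_corner :: "real ^ 'n \<Rightarrow> real \<Rightarrow> int ^ 'n \<Rightarrow> real ^ 'n"
  where "grid_corner c s m = (\<chi> i. c $ i + s * of_int (m $ i))"

lemma grid_cell_iff:
  assumes "s > 0"
  shows "x \<in> grid_cell c s m \<longleftrightarrow>
    (\<forall>i. grid_corner c s m $ i \<le> x $ i \<and> x $ i < grid_corner c s m $ i + s)"
  using assms by (simp add: grid_cell_def grid_corner_def floor_eq_iff field_simps)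

lemma grid_cell_between:
  fixes c :: "real ^ 'n" and m :: "int ^ 'n"
  assumes "s > 0"
  defines "a \<equiv> grid_corner c s m"
  shows "box a (a + (\<chi> i. s)) \<subseteq> grid_cell c s m" "grid_cell c s m \<subseteq> cbox a (a + (\<chi> i. s))"
  using assms by (auto simp: grid_cell_iff mem_box_cart less_imp_le)

lemma cube_borel [simp]: "Q \<in> cubes \<Longrightarrow> Q \<in> sets lebesgue"
  by (auto simp: cubes_def)

lemma cube_compact: "Q \<in> cubes \<Longrightarrow> compact Q"
  by (auto simp: cubes_def compact_cbox)

lemma grid_closure_cube: "s > 0 \<Longrightarrow> cbox (grid_corner c s m) (grid_corner c s m + (\<chi> i. s)) \<in> cubes"
  unfolding cubes_def by blast

lemma measure_cube:
  fixes a :: "real ^ 'n"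
  assumes "s \<ge> 0"
  shows "measure lborel (cbox a (a + (\<chi> i. s))) = s ^ CARD('n)"
proof -
  have "a \<in> cbox a (a + (\<chi> i. s))" using assms by (auto simp: mem_box_cart)
  then have "cbox a (a + (\<chi> i. s)) \<noteq> {}" by blast
  then show ?thesis using assms by (simp add: content_cbox_cart)
qed

lemma grid_cell_null:
  assumes "s > 0"
  shows "cbox (grid_corner c s m) (grid_corner c s m + (\<chi> i. s)) - grid_cell c s m \<in> null_sets lebesgue"
    (is "?Q - ?R \<in> _")
proof -
  have "negligible (?Q - box (grid_corner c s m) (grid_corner c s m + (\<chi> i. s)))"
    by (rule negligible_frontier_interval)
  then have "negligible (?Q - ?R)"
    by (rule negligible_subset) (use grid_cell_between(1)[OF assms] in blast)
  then show ?thesis by (simp add: negligible_iff_null_sets)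
qed

lemma grid_cell_sets [simp]:
  assumes "s > 0"
  shows "grid_cell c s m \<in> sets lebesgue"
proof -
  let ?Q = "cbox (grid_corner c s m) (grid_corner c s m + (\<chi> i. s))"
  have "grid_cell c s m = ?Q - (?Q - grid_cell c s m)"
    using grid_cell_between(2)[OF assms] by blast
  moreover have "?Q - (?Q - grid_cell c s m) \<in> sets lebesgue"
    by (rule sets.Diff[OF _ null_setsD2[OF grid_cell_null[OF assms]]]) auto
  ultimately show ?thesis by metis
qed

text \<open>A cell and its closed cube have the same measure for every measure that ignores Lebesgue null sets.\<close>

lemma grid_cell_measure:
  fixes c :: "real ^ 'n"
  assumes "s > 0" "sets M = sets lebesgue" "\<And>N. N \<in> null_sets lebesgue \<Longrightarrow> N \<in> null_sets M"
  shows "emeasure M (grid_cell c s m) = emeasure M (cbox (grid_corner c s m) (grid_corner c s m + (\<chi> i. s)))"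
    "measure M (grid_cell c s m) = measure M (cbox (grid_corner c s m) (grid_corner c s m + (\<chi> i. s)))"
proof -
  let ?Q = "cbox (grid_corner c s m) (grid_corner c s m + (\<chi> i. s))"
  have "grid_cell c s m = ?Q - (?Q - grid_cell c s m)"
    using grid_cell_between(2)[OF assms(1)] by blast
  then show "emeasure M (grid_cell c s m) = emeasure M ?Q"
    using emeasure_Diff_null_set[OF assms(3)[OF grid_cell_null[OF assms(1), of c m]], of ?Q] assms(2)
    by simp
  then show "measure M (grid_cell c s m) = measure M ?Q" by (simp add: measure_def)
qed

lemma lebesgue_grid_cell:
  fixes c :: "real ^ 'n"
  assumes "s > 0"
  shows "measure lebesgue (grid_cell c s m) = s ^ CARD('n)"
  using grid_cell_measure(2)[OF assms, of lebesgue c m] assms by (simp add: measure_cube)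

lemma grid_cell_lmeasurable:
  assumes "s > 0"
  shows "grid_cell c s m \<in> lmeasurable"
  using grid_cell_between(2)[OF assms, of c m] grid_cell_sets[OF assms, of c m]
  by (meson bounded_cbox bounded_set_imp_lmeasurable bounded_subset)

lemma weight_grid_cell:
  assumes "weight w" "s > 0"
  shows "measure (weight_measure w) (grid_cell c s m) =
    measure (weight_measure w) (cbox (grid_corner c s m) (grid_corner c s m + (\<chi> i. s)))"
  using grid_cell_measure(2)[OF assms(2), of "weight_measure w" c m] weight_null[OF assms(1)] by simp

lemma grid_cell_fmeasurable:
  assumes "weight w" "s > 0" "E \<subseteq> grid_cell c s m" "E \<in> sets lebesgue"
  shows "E \<in> fmeasurable (weight_measure w)"
  using assms grid_cell_between(2)[OF assms(2), of c m] by (intro weight_fmeasurable[OF assms(1) compact_cbox]) auto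

lemma weight_cube_pos:
  assumes "weight w" "Q \<in> cubes"
  shows "measure (weight_measure w) Q > 0" "measure lebesgue Q > 0"
proof -
  obtain a s where Q: "Q = cbox a (a + (\<chi> i. s))" "s > 0" using assms(2) by (auto simp: cubes_def)
  then show *: "measure lebesgue Q > 0" by (simp add: measure_cube)
  show "measure (weight_measure w) Q > 0"
  proof (rule ccontr)
    assume "\<not> ?thesis"
    then have "measure (weight_measure w) Q = 0" by (simp add: not_less measure_nonneg order_antisym)
    moreover have "Q \<in> fmeasurable (weight_measure w)"
      using assms by (intro weight_fmeasurable[OF _ cube_compact]) auto
    ultimately have "Q \<in> null_sets (weight_measure w)"
      using emeasure_eq_measure2[of Q "weight_measure w"] by (metis ennreal_0 fmeasurableD null_setsI)
    then have "Q \<in> null_sets lebesgue" using weight_null_iff[OF assms(1)] by blast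
    then show False using * by (simp add: null_sets_def measure_def)
  qed
qed

lemma grid_cell_nested:
  assumes s: "s > 0" and ne: "x \<in> grid_cell c s m" "x \<in> grid_cell c (s * 2 ^ j) m'"
  shows "grid_cell c s m \<subseteq> grid_cell c (s * 2 ^ j) m'"
proof
  have *: "\<lfloor>t / (s * 2 ^ j)\<rfloor> = \<lfloor>t / s\<rfloor> div 2 ^ j" for t
    using floor_divide_real_eq_div[of "2 ^ j" "t / s"] by simp
  fix y assume "y \<in> grid_cell c s m"
  then show "y \<in> grid_cell c (s * 2 ^ j) m'"
    using ne unfolding grid_cell_def by (simp add: *)
qed

lemma grid_cell_nonempty: "s > 0 \<Longrightarrow> grid_corner c s m \<in> grid_cell c s m"
  by (simp add: grid_cell_iff)

lemma grid_cell_index: "x \<in> grid_cell c s (\<chi> i. \<lfloor>(x $ i - c $ i) / s\<rfloor>)"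
  by (simp add: grid_cell_def)

lemma finite_int_vec: "finite A \<Longrightarrow> finite {m :: int ^ 'n. \<forall>i. m $ i \<in> A}"
proof -
  assume A: "finite A"
  have "{m :: int ^ 'n. \<forall>i. m $ i \<in> A} \<subseteq> vec_lambda ` (PiE UNIV (\<lambda>_. A))"
  proof
    fix m :: "int ^ 'n" assume m: "m \<in> {m. \<forall>i. m $ i \<in> A}"
    show "m \<in> vec_lambda ` (PiE UNIV (\<lambda>_. A))"
      by (rule image_eqI[of _ _ "\<lambda>i. m $ i"]) (use m in auto)
  qed
  then show ?thesis using A by (meson finite_PiE finite_code finite_imageI finite_subset finite)
qed

section \<open>Finite laminar families\<close>

definition maximal_members :: "'a set set \<Rightarrow> 'a set set"
  where "maximal_members F = {Q \<in> F. \<forall>R \<in> F. Q \<subseteq> R \<longrightarrow> Q = R}"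

lemma maximal_members_subset: "maximal_members F \<subseteq> F"
  by (auto simp: maximal_members_def)

lemma maximal_member_above:
  assumes "finite F" "Q \<in> F"
  obtains R where "R \<in> maximal_members F" "Q \<subseteq> R"
  using finite_has_maximal2[OF assms] unfolding maximal_members_def by blast

lemma Union_maximal_members: "finite F \<Longrightarrow> \<Union>(maximal_members F) = \<Union>F"
  using maximal_member_above maximal_members_subset by (metis Union_mono Union_subsetI subset_antisym)

definition laminar :: "'a set set \<Rightarrow> bool"
  where "laminar F \<longleftrightarrow> (\<forall>Q \<in> F. \<forall>R \<in> F. Q \<inter> R = {} \<or> Q \<subseteq> R \<or> R \<subseteq> Q)"

lemma disjoint_maximal_members:
  assumes "laminar F"
  shows "disjoint (maximal_members F)"
proof (rule disjointI)
  fix Q R assume QR: "Q \<in> maximal_members F" "R \<in> maximal_members F" "Q \<noteq> R"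
  then have "Q \<inter> R = {} \<or> Q \<subseteq> R \<or> R \<subseteq> Q"
    using assms maximal_members_subset unfolding laminar_def by blast
  then show "Q \<inter> R = {}" using QR unfolding maximal_members_def by blast
qed

lemma laminar_subset: "laminar F \<Longrightarrow> G \<subseteq> F \<Longrightarrow> laminar G"
  unfolding laminar_def by blast

lemma measure_disjoint_Union:
  assumes "finite F" "disjoint F" "\<And>Q. Q \<in> F \<Longrightarrow> A Q \<in> fmeasurable M" "\<And>Q. Q \<in> F \<Longrightarrow> A Q \<subseteq> Q"
  shows "measure M (\<Union>Q\<in>F. A Q) = (\<Sum>Q\<in>F. measure M (A Q))"
proof (rule measure_finite_Union)
  show "disjoint_family_on A F"
    using assms(2,4) unfolding disjoint_family_on_def disjoint_def by blast
  show "A ` F \<subseteq> sets M" using fmeasurableD[OF assms(3)] by blast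
  show "emeasure M (A Q) \<noteq> \<infinity>" if "Q \<in> F" for Q
    using fmeasurableD2[OF assms(3)[OF that]] by simp
qed (rule assms(1))

section \<open>From comparability with Lebesgue measure to power decay\<close>

text \<open>This is the form of the \<open>A\<^sub>\<infinity>\<close> condition from which everything else is derived: a set that fills
  a large proportion of a cube carries a substantial part of its weight.\<close>

definition comparable_to_lebesgue :: "real \<Rightarrow> real \<Rightarrow> (real ^ 'n \<Rightarrow> real) \<Rightarrow> bool"
  where "comparable_to_lebesgue r C w \<longleftrightarrow> (\<forall>Q\<in>cubes. \<forall>E\<in>sets lebesgue. E \<subseteq> Q \<longrightarrow>
    (measure lebesgue E / measure lebesgue Q) powr r * measure (weight_measure w) Q
      \<le> C * measure (weight_measure w) E)"

lemma comparable_cell: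
  assumes w: "weight w" and cmp: "comparable_to_lebesgue r C w" and s: "s > 0"
    and E: "E \<in> sets lebesgue" "E \<subseteq> grid_cell c s m"
  shows "(measure lebesgue E / measure lebesgue (grid_cell c s m)) powr r * measure (weight_measure w) (grid_cell c s m)
      \<le> C * measure (weight_measure w) E"
  using cmp[unfolded comparable_to_lebesgue_def, rule_format, OF grid_closure_cube[OF s] E(1)]
    order_trans[OF E(2) grid_cell_between(2)[OF s]]
    grid_cell_measure(2)[OF s, of lebesgue c m] weight_grid_cell[OF w s, of c m] by simp

lemma weight_cell_pos:
  assumes "weight w" "s > 0"
  shows "measure (weight_measure w) (grid_cell c s m) > 0" "measure lebesgue (grid_cell c s m) > 0"
  using weight_cube_pos[OF assms(1) grid_closure_cube[OF assms(2)]] assms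
  by (auto simp: weight_grid_cell lebesgue_grid_cell)

lemma comparable_constant_ge_1:
  assumes "weight w" "comparable_to_lebesgue r C w"
  shows "C \<ge> 1"
proof -
  have s: "(1::real) > 0" by simp
  note pos = weight_cell_pos[OF assms(1) s, of 0 0]
  show ?thesis
    using comparable_cell[OF assms s grid_cell_sets[OF s] order_refl, of 0 0] pos by simp
qed

text \<open>Comparability is applied to the complement of \<open>E\<close>, which fills at least half of the cell.\<close>

lemma half_complement:
  assumes w: "weight w" and cmp: "comparable_to_lebesgue r C w" and s: "s > 0" and r: "r \<ge> 0"
    and E: "E \<in> sets lebesgue" "E \<subseteq> grid_cell c s m"
    and half: "measure lebesgue E \<le> measure lebesgue (grid_cell c s m) / 2"
  shows "measure (weight_measure w) E \<le> (1 - (1 / 2) powr r / C) * measure (weight_measure w) (grid_cell c s m)"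
proof -
  let ?R = "grid_cell c s m"
  let ?\<mu> = "weight_measure w"
  have C: "C \<ge> 1" by (rule comparable_constant_ge_1[OF w cmp])
  note pos = weight_cell_pos[OF w s, of c m]
  have R: "?R \<in> sets lebesgue" "?R \<in> fmeasurable ?\<mu>" "?R \<in> lmeasurable"
    using s grid_cell_fmeasurable[OF w s order_refl] by (auto simp: grid_cell_lmeasurable)
  have Efm: "E \<in> fmeasurable ?\<mu>" "E \<in> lmeasurable"
    using grid_cell_fmeasurable[OF w s E(2,1)] fmeasurableI2[OF R(3) E(2,1)] by auto
  have 1: "measure lebesgue (?R - E) = measure lebesgue ?R - measure lebesgue E"
    "measure ?\<mu> (?R - E) = measure ?\<mu> ?R - measure ?\<mu> E"
    using R Efm E by (auto intro!: measurable_measure_Diff)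
  have "1 / 2 \<le> measure lebesgue (?R - E) / measure lebesgue ?R"
    using half pos(2) 1 by (simp add: field_simps)
  then have "(1 / 2) powr r * measure ?\<mu> ?R \<le> (measure lebesgue (?R - E) / measure lebesgue ?R) powr r * measure ?\<mu> ?R"
    using r by (intro mult_right_mono powr_mono2) auto
  also have "\<dots> \<le> C * measure ?\<mu> (?R - E)"
    using comparable_cell[OF w cmp s, of "?R - E"] E R by auto
  finally show ?thesis using 1 C by (simp add: field_simps)
qed

text \<open>The dyadic subcells of a cube down to a fixed generation form a finite family, so that stopping cubes
  can be chosen as maximal elements.\<close>

definition subcells :: "real ^ 'n \<Rightarrow> real \<Rightarrow> nat \<Rightarrow> (real ^ 'n) set set"
  where "subcells c l N = {R. R \<subseteq> grid_cell c l 0 \<and>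
    (\<exists>k\<le>N. \<exists>m. R = grid_cell c (l / 2 ^ k) m)}"

lemma subcell_split:
  assumes "x \<in> grid_cell c (l / 2 ^ k) m" "x \<in> grid_cell c (l / 2 ^ k') m'" "k' \<le> k" "l > 0"
  shows "grid_cell c (l / 2 ^ k) m \<subseteq> grid_cell c (l / 2 ^ k') m'"
proof -
  have "l / 2 ^ k' = l / 2 ^ k * 2 ^ (k - k')" using assms(3) by (simp add: power_diff)
  then show ?thesis using grid_cell_nested[of "l / 2 ^ k" x c m "k - k'" m'] assms by simp
qed

lemma subcells_laminar: "l > 0 \<Longrightarrow> laminar (subcells c l N)"
  unfolding laminar_def
proof (intro ballI)
  fix Q R assume l: "l > 0" and QR: "Q \<in> subcells c l N" "R \<in> subcells c l N"
  then obtain k m k' m' where *: "Q = grid_cell c (l / 2 ^ k) m" "R = grid_cell c (l / 2 ^ k') m'"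
    unfolding subcells_def by blast
  show "Q \<inter> R = {} \<or> Q \<subseteq> R \<or> R \<subseteq> Q"
  proof (cases "Q \<inter> R = {}")
    case False
    then obtain x where x: "x \<in> Q" "x \<in> R" by blast
    show ?thesis
      using subcell_split[of x c l k m k' m'] subcell_split[of x c l k' m' k m] x l
      unfolding * by (meson nle_le)
  qed simp
qed

lemma finite_subcells:
  fixes c :: "real ^ 'n"
  assumes l: "l > 0"
  shows "finite (subcells c l N)"
proof -
  define M where "M = {m :: int ^ 'n. \<forall>i. m $ i \<in> {0..<2 ^ N}}"
  have "subcells c l N \<subseteq> (\<lambda>(k, m). grid_cell c (l / 2 ^ k) m) ` ({..N} \<times> M)"
  proof
    fix R assume "R \<in> subcells c l N"
    then obtain k m where R: "R = grid_cell c (l / 2 ^ k) m" "R \<subseteq> grid_cell c l 0" "k \<le> N"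
      unfolding subcells_def by blast
    define x where "x = grid_corner c (l / 2 ^ k) m"
    have "x \<in> R" unfolding R x_def using l by (intro grid_cell_nonempty) auto
    then have "x \<in> grid_cell c l 0" using R(2) by blast
    then have "0 \<le> of_int (m $ i) * (l / 2 ^ k)" "of_int (m $ i) * (l / 2 ^ k) < l" for i
      using l by (auto simp: grid_cell_iff x_def grid_corner_def mult.commute)
    then have "0 \<le> m $ i" "real_of_int (m $ i) < 2 ^ k" for i
      using l by (auto simp: field_simps zero_le_mult_iff)
    moreover have "(2::real) ^ k \<le> 2 ^ N" using R(3) by simp
    ultimately have "0 \<le> m $ i" "real_of_int (m $ i) < 2 ^ N" for i by (force, meson less_le_trans)
    then have "m \<in> M" unfolding M_def by (auto simp: of_int_less_numeral_power_cancel_iff)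
    then show "R \<in> (\<lambda>(k, m). grid_cell c (l / 2 ^ k) m) ` ({..N} \<times> M)" using R by force
  qed
  moreover have "finite M" unfolding M_def by (rule finite_int_vec) simp
  ultimately show ?thesis using finite_subset by blast
qed

lemma subcell_of_point:
  assumes "l > 0" "x \<in> grid_cell c l 0" "k \<le> N"
  obtains m where "grid_cell c (l / 2 ^ k) m \<in> subcells c l N" "x \<in> grid_cell c (l / 2 ^ k) m"
proof -
  define m where "m = (\<chi> i. \<lfloor>(x $ i - c $ i) / (l / 2 ^ k)\<rfloor>)"
  have x: "x \<in> grid_cell c (l / 2 ^ k) m" unfolding m_def by (rule grid_cell_index)
  have "grid_cell c (l / 2 ^ k) m \<subseteq> grid_cell c l 0"
    using subcell_split[of x c l k m 0 0] x assms by simp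
  then show ?thesis using that x assms(3) unfolding subcells_def by blast
qed

text \<open>The stopping cells are the maximal subcells in which \<open>\<Union>G\<close> has density greater than
  \<open>1 / (2 \<cdot> 2\<^sup>n)\<close>. The parent of a stopping cell fails this, so the density in the cell itself is at
  most \<open>1/2\<close> and \<open>half_complement\<close> gains a fixed factor there; the lower bound on the density
  limits the total volume of the stopping cells.\<close>

lemma calderon_zygmund_step:
  fixes c :: "real ^ 'n"
  assumes w: "weight w" and cmp: "comparable_to_lebesgue r C w" and r: "r \<ge> 0" and l: "l > 0"
    and G: "G \<subseteq> subcells c l N" "measure lebesgue (\<Union>G) \<le> measure lebesgue (grid_cell c l 0) / 2"
  obtains G' where "G' \<subseteq> subcells c l N"
    "measure (weight_measure w) (\<Union>G) \<le> (1 - (1 / 2) powr r / C) * measure (weight_measure w) (\<Union>G')"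
    "measure lebesgue (\<Union>G') \<le> 2 * 2 ^ CARD('n) * measure lebesgue (\<Union>G)"
proof -
  let ?S = "subcells c l N" and ?\<mu> = "weight_measure w"
  define E where "E = \<Union>G"
  define F where "F = {R \<in> ?S. measure lebesgue R < 2 * 2 ^ CARD('n) * measure lebesgue (E \<inter> R)}"
  define M where "M = maximal_members F"
  have finS: "finite ?S" by (rule finite_subcells[OF l])
  have finF: "finite F" unfolding F_def using finS by simp
  have MS: "M \<subseteq> F" "M \<subseteq> ?S" unfolding M_def using maximal_members_subset[of F] unfolding F_def by auto
  have finM: "finite M" using MS(1) finF finite_subset by blast
  have disM: "disjoint M"
    unfolding M_def by (intro disjoint_maximal_members laminar_subset[OF subcells_laminar[OF l]]) (auto simp: F_def)
  have cell: "R \<in> lmeasurable" "R \<in> fmeasurable ?\<mu>" "measure lebesgue R > 0" if R: "R \<in> ?S" for R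
  proof -
    obtain k m where R': "R = grid_cell c (l / 2 ^ k) m" using R unfolding subcells_def by blast
    have s: "l / 2 ^ k > 0" using l by simp
    show "R \<in> lmeasurable" "R \<in> fmeasurable ?\<mu>" "measure lebesgue R > 0"
      using grid_cell_lmeasurable[OF s] grid_cell_fmeasurable[OF w s order_refl grid_cell_sets[OF s]]
        weight_cell_pos(2)[OF w s] unfolding R' by auto
  qed
  have finG: "finite G" using G(1) finS finite_subset by blast
  have Em: "E \<in> sets lebesgue" unfolding E_def using finG G(1) cell by (auto intro!: sets.finite_Union)
  have "G \<subseteq> F"
  proof
    fix R assume R: "R \<in> G"
    then have "E \<inter> R = R" "R \<in> ?S" unfolding E_def using G(1) by auto
    moreover have "1 * measure lebesgue R < 2 * 2 ^ CARD('n) * measure lebesgue R"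
      using cell(3)[OF \<open>R \<in> ?S\<close>] one_le_power[of "2::real" "CARD('n)"] by (intro mult_strict_right_mono) linarith+
    ultimately show "R \<in> F" unfolding F_def by simp
  qed
  then have EM: "E \<subseteq> \<Union>M" unfolding E_def M_def Union_maximal_members[OF finF] by blast
  \<comment> \<open>A stopping cell other than the whole cube has a parent that is not a stopping cell.\<close>
  have half: "measure lebesgue (E \<inter> R) \<le> measure lebesgue R / 2" if R: "R \<in> M" for R
  proof -
    have RS: "R \<in> ?S" using R MS by blast
    obtain k m where R': "R = grid_cell c (l / 2 ^ k) m" "k \<le> N" "R \<subseteq> grid_cell c l 0"
      using RS unfolding subcells_def by blast
    have s: "l / 2 ^ k > 0" using l by simp
    have x: "grid_corner c (l / 2 ^ k) m \<in> R" unfolding R' by (rule grid_cell_nonempty[OF s])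
    show ?thesis
    proof (cases k)
      case 0
      then have "grid_cell c l 0 \<subseteq> R"
        using subcell_split[of "grid_corner c l m" c l 0 0 0 m] x R'(3) l unfolding R' by auto
      then have "R = grid_cell c l 0" using R'(3) by blast
      moreover have "E \<inter> R \<subseteq> E" by blast
      moreover have "E \<subseteq> grid_cell c l 0" using G(1) unfolding E_def subcells_def by blast
      ultimately show ?thesis using G(2) unfolding E_def by (simp add: Int_absorb2)
    next
      case (Suc j)
      obtain m' where P: "grid_cell c (l / 2 ^ j) m' \<in> ?S" "grid_corner c (l / 2 ^ k) m \<in> grid_cell c (l / 2 ^ j) m'"
        using subcell_of_point[of l "grid_corner c (l / 2 ^ k) m" c j N] x R' Suc l by auto
      define P where "P = grid_cell c (l / 2 ^ j) m'"
      have RP: "R \<subseteq> P" unfolding R' P_def using subcell_split[OF _ P(2), of k m] x R' Suc l by auto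
      have mR: "measure lebesgue R = (l / 2 ^ k) ^ CARD('n)" and mP: "measure lebesgue P = (l / 2 ^ j) ^ CARD('n)"
        unfolding R' P_def using l by (simp_all add: lebesgue_grid_cell)
      have "l / 2 ^ j = 2 * (l / 2 ^ k)" using Suc by simp
      then have PR: "measure lebesgue P = 2 ^ CARD('n) * measure lebesgue R"
        unfolding mR mP by (simp only: power_mult_distrib)
      have "measure lebesgue R < measure lebesgue P"
      proof -
        have "1 * measure lebesgue R < 2 ^ CARD('n) * measure lebesgue R"
          using cell(3)[OF RS] by (intro mult_strict_right_mono one_less_power) auto
        then show ?thesis unfolding PR by simp
      qed
      then have "P \<notin> F" using R RP unfolding M_def maximal_members_def by blast
      then have "2 * 2 ^ CARD('n) * measure lebesgue (E \<inter> P) \<le> 2 ^ CARD('n) * measure lebesgue R"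
        using P(1) PR unfolding F_def P_def by auto
      then have "2 * measure lebesgue (E \<inter> P) \<le> measure lebesgue R" by simp
      moreover have "measure lebesgue (E \<inter> R) \<le> measure lebesgue (E \<inter> P)"
        using RP Em cell(1)[OF RS] cell(1)[OF P(1)] unfolding P_def[symmetric]
        by (intro measure_mono_fmeasurable) (auto intro: fmeasurableI2)
      ultimately show ?thesis by simp
    qed
  qed
  have \<mu>: "measure ?\<mu> E \<le> (1 - (1 / 2) powr r / C) * measure ?\<mu> (\<Union>M)"
  proof -
    have "measure ?\<mu> E = measure ?\<mu> (\<Union>R\<in>M. E \<inter> R)" using EM by (intro arg_cong[where f="measure ?\<mu>"]) blast
    also have "\<dots> = (\<Sum>R\<in>M. measure ?\<mu> (E \<inter> R))"
      using MS cell Em by (intro measure_disjoint_Union[OF finM disM]) (auto intro!: fmeasurableI2[OF cell(2)])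
    also have "\<dots> \<le> (\<Sum>R\<in>M. (1 - (1 / 2) powr r / C) * measure ?\<mu> R)"
    proof (rule sum_mono)
      fix R assume R: "R \<in> M"
      then obtain k m where R': "R = grid_cell c (l / 2 ^ k) m" using MS unfolding subcells_def by blast
      have s: "l / 2 ^ k > 0" using l by simp
      show "measure ?\<mu> (E \<inter> R) \<le> (1 - (1 / 2) powr r / C) * measure ?\<mu> R"
        unfolding R' by (rule half_complement[OF w cmp s r]) (use half[OF R] Em s in \<open>auto simp: R'\<close>)
    qed
    also have "\<dots> = (1 - (1 / 2) powr r / C) * measure ?\<mu> (\<Union>M)"
      using measure_disjoint_Union[OF finM disM, of "\<lambda>R. R" ?\<mu>] MS(2) cell(2)
      by (simp add: subset_iff sum_distrib_left)
    finally show ?thesis .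
  qed
  have "measure lebesgue (\<Union>M) = (\<Sum>R\<in>M. measure lebesgue R)"
    using measure_disjoint_Union[OF finM disM, of "\<lambda>R. R" lebesgue] MS(2) cell(1) by auto
  also have "\<dots> \<le> (\<Sum>R\<in>M. 2 * 2 ^ CARD('n) * measure lebesgue (E \<inter> R))"
    using MS(1) by (intro sum_mono) (auto simp: F_def less_imp_le)
  also have "\<dots> = 2 * 2 ^ CARD('n) * (\<Sum>R\<in>M. measure lebesgue (E \<inter> R))"
    by (simp add: sum_distrib_left)
  also have "(\<Sum>R\<in>M. measure lebesgue (E \<inter> R)) = measure lebesgue (\<Union>R\<in>M. E \<inter> R)"
    using MS cell Em by (intro measure_disjoint_Union[OF finM disM, symmetric]) (auto intro!: fmeasurableI2[OF cell(1)])
  also have "(\<Union>R\<in>M. E \<inter> R) = E" using EM by blast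
  finally show ?thesis using that[OF MS(2)] \<mu> unfolding E_def by blast
qed

lemma one_less_2n: "1 < 2 * (2::real) ^ CARD('n::finite)"
  using one_le_power[of "2::real" "CARD('n)"] by linarith

text \<open>Iteration of the previous step: each time the volume grows by at most \<open>2 \<cdot> 2\<^sup>n\<close>, a further factor is gained.\<close>

lemma subcell_union_decay:
  fixes c :: "real ^ 'n"
  assumes w: "weight w" and cmp: "comparable_to_lebesgue r C w" and r: "r \<ge> 0" and l: "l > 0"
  shows "G \<subseteq> subcells c l N \<Longrightarrow>
    measure lebesgue (\<Union>G) \<le> (1 / (2 * 2 ^ CARD('n))) ^ j / 2 * measure lebesgue (grid_cell c l 0) \<Longrightarrow>
    measure (weight_measure w) (\<Union>G) \<le> (1 - (1 / 2) powr r / C) ^ Suc j * measure (weight_measure w) (grid_cell c l 0)"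
proof (induction j arbitrary: G)
  case 0
  have "finite G" using 0(1) finite_subcells[OF l] finite_subset by blast
  moreover have "R \<in> sets lebesgue" if "R \<in> G" for R
    using that 0(1) l unfolding subcells_def by auto
  moreover have "\<Union>G \<subseteq> grid_cell c l 0" using 0(1) unfolding subcells_def by blast
  ultimately show ?case using half_complement[OF w cmp l r, of "\<Union>G" c 0] 0(2) by (auto intro!: sets.finite_Union)
next
  case (Suc j)
  let ?\<gamma> = "1 / (2 * 2 ^ CARD('n)) :: real"
  have \<gamma>: "0 < ?\<gamma>" "?\<gamma> \<le> 1" using one_less_2n[where 'n='n] by (auto simp: divide_le_eq)
  have "?\<gamma> ^ Suc j \<le> 1" using \<gamma> by (intro power_le_one) auto
  then have "?\<gamma> ^ Suc j / 2 * measure lebesgue (grid_cell c l 0) \<le> 1 / 2 * measure lebesgue (grid_cell c l 0)"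
    by (intro mult_right_mono) auto
  then have half: "measure lebesgue (\<Union>G) \<le> measure lebesgue (grid_cell c l 0) / 2"
    using Suc.prems(2) by linarith
  obtain G' where G': "G' \<subseteq> subcells c l N"
    "measure (weight_measure w) (\<Union>G) \<le> (1 - (1 / 2) powr r / C) * measure (weight_measure w) (\<Union>G')"
    "measure lebesgue (\<Union>G') \<le> 2 * 2 ^ CARD('n) * measure lebesgue (\<Union>G)"
    using calderon_zygmund_step[OF w cmp r l Suc.prems(1) half] by blast
  have C: "C \<ge> 1" by (rule comparable_constant_ge_1[OF w cmp])
  have "(1 / 2) powr r \<le> (1::real)" using powr_mono2[of r "1/2" 1] r by simp
  then have \<beta>: "0 \<le> 1 - (1 / 2) powr r / C" using C by (simp add: divide_le_eq)
  have "measure lebesgue (\<Union>G') \<le> 2 * 2 ^ CARD('n) * (?\<gamma> ^ Suc j / 2 * measure lebesgue (grid_cell c l 0))"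
    using Suc.prems(2) by (intro order_trans[OF G'(3)] mult_left_mono) auto
  also have "\<dots> = ?\<gamma> ^ j / 2 * measure lebesgue (grid_cell c l 0)" by simp
  finally have "measure (weight_measure w) (\<Union>G') \<le> (1 - (1 / 2) powr r / C) ^ Suc j * measure (weight_measure w) (grid_cell c l 0)"
    by (rule Suc.IH[OF G'(1)])
  then show ?case using order_trans[OF G'(2) mult_left_mono[OF _ \<beta>]] by (simp add: mult.assoc)
qed

text \<open>An open set is, as \<open>N\<close> grows, the increasing union of the subcells of generation at most \<open>N\<close> that it
  contains, so the bound for finite unions passes to the limit.\<close>

lemma open_decay:
  fixes c :: "real ^ 'n"
  assumes w: "weight w" and cmp: "comparable_to_lebesgue r C w" and r: "r \<ge> 0" and l: "l > 0"
    and V: "open V"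
      "measure lebesgue (V \<inter> grid_cell c l 0) \<le> (1 / (2 * 2 ^ CARD('n))) ^ j / 2 * measure lebesgue (grid_cell c l 0)"
  shows "measure (weight_measure w) (V \<inter> grid_cell c l 0)
    \<le> (1 - (1 / 2) powr r / C) ^ Suc j * measure (weight_measure w) (grid_cell c l 0)"
proof -
  let ?Q = "grid_cell c l 0" and ?\<mu> = "weight_measure w"
  define G where "G N = {R \<in> subcells c l N. R \<subseteq> V}" for N
  have G: "G N \<subseteq> subcells c l N" "\<Union>(G N) \<subseteq> V \<inter> ?Q" for N
    unfolding G_def subcells_def by auto
  have meas: "\<Union>(G N) \<in> sets lebesgue" for N
  proof -
    have "finite (G N)" using G(1) finite_subcells[OF l] finite_subset by blast
    then show ?thesis using l unfolding G_def subcells_def by (intro sets.finite_Union) auto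
  qed
  have VQ: "V \<inter> ?Q \<in> sets lebesgue" using V(1) l by auto
  have fm: "V \<inter> ?Q \<in> lmeasurable" "V \<inter> ?Q \<in> fmeasurable ?\<mu>"
    using fmeasurableI2[OF grid_cell_lmeasurable[OF l] _ VQ] grid_cell_fmeasurable[OF w l _ VQ] by auto
  have inc: "incseq (\<lambda>N. \<Union>(G N))"
  proof (rule incseq_SucI)
    show "\<Union>(G N) \<subseteq> \<Union>(G (Suc N))" for N
      unfolding G_def subcells_def using le_SucI by (intro Union_mono) blast
  qed
  have union: "(\<Union>N. \<Union>(G N)) = V \<inter> ?Q"
  proof
    show "V \<inter> ?Q \<subseteq> (\<Union>N. \<Union>(G N))"
    proof
      fix x assume x: "x \<in> V \<inter> ?Q"
      obtain e where e: "e > 0" "ball x e \<subseteq> V" using V(1) x by (auto simp: open_contains_ball)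
      have "(\<lambda>N. real CARD('n) * l * (1 / 2) ^ N) \<longlonglongrightarrow> real CARD('n) * l * 0"
        by (intro tendsto_intros LIMSEQ_realpow_zero) auto
      then have "\<forall>\<^sub>F N in sequentially. real CARD('n) * l * (1 / 2) ^ N < e"
        using e by (intro order_tendstoD(2)[where a=e]) auto
      then obtain N where N: "real CARD('n) * l * (1 / 2) ^ N < e" by (auto simp: eventually_sequentially)
      obtain m where m: "grid_cell c (l / 2 ^ N) m \<in> subcells c l N" "x \<in> grid_cell c (l / 2 ^ N) m"
        using subcell_of_point[OF l, of x c N N] x by auto
      have "grid_cell c (l / 2 ^ N) m \<subseteq> ball x e"
      proof
        fix y assume y: "y \<in> grid_cell c (l / 2 ^ N) m"
        have s: "l / 2 ^ N > 0" using l by simp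
        have "\<bar>(x - y) $ i\<bar> \<le> l / 2 ^ N" for i
          using y m(2) s unfolding grid_cell_iff[OF s] by (simp add: abs_le_iff) (smt (verit))
        then have "(\<Sum>i\<in>UNIV. \<bar>(x - y) $ i\<bar>) \<le> (\<Sum>i\<in>(UNIV::'n set). l / 2 ^ N)"
          by (intro sum_mono) auto
        then have "norm (x - y) \<le> real CARD('n) * l * (1 / 2) ^ N"
          using norm_le_l1_cart[of "x - y"] by (simp add: power_divide)
        then show "y \<in> ball x e" using N by (simp add: dist_norm)
      qed
      then show "x \<in> (\<Union>N. \<Union>(G N))" using m e(2) unfolding G_def by blast
    qed
  qed (use G(2) in blast)
  have "(\<lambda>N. measure ?\<mu> (\<Union>(G N))) \<longlonglongrightarrow> measure ?\<mu> (\<Union>N. \<Union>(G N))"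
    using meas fmeasurableD2[OF fm(2)] inc union by (intro Lim_measure_incseq) auto
  then show ?thesis
    unfolding union
  proof (rule LIMSEQ_le_const2, intro exI[of _ 0] allI impI)
    fix N
    have "measure lebesgue (\<Union>(G N)) \<le> measure lebesgue (V \<inter> ?Q)"
      using G(2) meas fm(1) by (intro measure_mono_fmeasurable) auto
    then show "measure ?\<mu> (\<Union>(G N)) \<le> (1 - (1 / 2) powr r / C) ^ Suc j * measure ?\<mu> ?Q"
      using subcell_union_decay[OF w cmp r l G(1)] V(2) by (meson order_trans)
  qed
qed

lemma measurable_decay:
  fixes c :: "real ^ 'n"
  assumes w: "weight w" and cmp: "comparable_to_lebesgue r C w" and r: "r \<ge> 0" and l: "l > 0"
    and E: "E \<in> sets lebesgue" "E \<subseteq> grid_cell c l 0"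
      "measure lebesgue E < (1 / (2 * 2 ^ CARD('n))) ^ j / 2 * measure lebesgue (grid_cell c l 0)"
  shows "measure (weight_measure w) E
    \<le> (1 - (1 / 2) powr r / C) ^ Suc j * measure (weight_measure w) (grid_cell c l 0)"
proof -
  let ?Q = "grid_cell c l 0"
  define t where "t = (1 / (2 * 2 ^ CARD('n))) ^ j / 2 * measure lebesgue ?Q"
  have Efm: "E \<in> lmeasurable" by (rule fmeasurableI2[OF grid_cell_lmeasurable[OF l] E(2,1)])
  have "t - measure lebesgue E > 0" using E(3) unfolding t_def by linarith
  then obtain V where V: "open V" "E \<subseteq> V" "V - E \<in> lmeasurable" "emeasure lebesgue (V - E) < ennreal (t - measure lebesgue E)"
    using sets_lebesgue_outer_open[OF E(1)] by metis
  have VE: "measure lebesgue (V - E) < t - measure lebesgue E"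
    using V(3,4) \<open>t - _ > 0\<close> by (simp add: emeasure_eq_measure2 ennreal_less_iff)
  have Vfm: "V = E \<union> (V - E)" using V(2) by blast
  then have "V \<in> lmeasurable" using Efm V(3) by (metis fmeasurable.Un)
  have VQ: "V \<inter> ?Q \<in> sets lebesgue" using V(1) l by auto
  have "measure lebesgue (V \<inter> ?Q) \<le> measure lebesgue V"
    using VQ \<open>V \<in> lmeasurable\<close> by (intro measure_mono_fmeasurable) auto
  also have "\<dots> \<le> measure lebesgue E + measure lebesgue (V - E)"
    using Vfm E(1) V(3) measure_Un_le[of E lebesgue "V - E"] by auto
  also have "\<dots> \<le> t" using VE by linarith
  finally have "measure (weight_measure w) (V \<inter> ?Q) \<le> (1 - (1 / 2) powr r / C) ^ Suc j * measure (weight_measure w) ?Q"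
    unfolding t_def by (rule open_decay[OF w cmp r l V(1)])
  moreover have "measure (weight_measure w) E \<le> measure (weight_measure w) (V \<inter> ?Q)"
    using E(1,2) V(2) VQ grid_cell_fmeasurable[OF w l _ VQ] by (intro measure_mono_fmeasurable) auto
  ultimately show ?thesis by linarith
qed

text \<open>The geometric decay in the number \<open>j\<close> of iterations is a power of the volume
  ratio, with exponent the quotient of the two logarithmic rates.\<close>

theorem comparable_imp_power_decay:
  fixes w :: "real ^ 'n \<Rightarrow> real"
  assumes w: "weight w" and cmp: "comparable_to_lebesgue r C w" and r: "r > 0"
  obtains K \<delta> where "K > 0" "\<delta> > 0"
    "\<And>Q E. \<lbrakk>Q \<in> cubes; E \<in> sets lebesgue; E \<subseteq> Q\<rbrakk> \<Longrightarrow>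
      measure (weight_measure w) E \<le> K * (measure lebesgue E / measure lebesgue Q) powr \<delta> * measure (weight_measure w) Q"
proof -
  let ?\<mu> = "weight_measure w"
  define \<gamma> where "\<gamma> = (1 / (2 * 2 ^ CARD('n)) :: real)"
  define \<beta> where "\<beta> = 1 - (1 / 2) powr r / C"
  have C: "C \<ge> 1" by (rule comparable_constant_ge_1[OF w cmp])
  have \<gamma>: "0 < \<gamma>" "\<gamma> < 1"
    unfolding \<gamma>_def using one_less_2n by (auto simp: divide_less_eq)
  have "(1 / 2) powr r < (1::real)" using r powr_less_mono2[of r "1/2" 1] by simp
  then have \<beta>: "0 < \<beta>" "\<beta> < 1" unfolding \<beta>_def using C by (auto simp: divide_less_eq)
  define \<delta> where "\<delta> = ln \<beta> / ln \<gamma>"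
  have \<delta>: "\<delta> > 0" unfolding \<delta>_def using \<beta> \<gamma> by (simp add: divide_neg_neg)
  have \<beta>\<gamma>: "\<beta> = \<gamma> powr \<delta>" unfolding \<delta>_def powr_def using \<beta> \<gamma> by simp
  have main: "measure ?\<mu> E \<le> 2 powr \<delta> * (measure lebesgue E / measure lebesgue (grid_cell c l 0)) powr \<delta> * measure ?\<mu> (grid_cell c l 0)"
    if l: "l > 0" and E: "E \<in> sets lebesgue" "E \<subseteq> grid_cell c l 0" for c l E
  proof -
    let ?Q = "grid_cell c l 0"
    define t where "t = measure lebesgue E / measure lebesgue ?Q"
    note pos = weight_cell_pos[OF w l, of c 0]
    have Et: "measure lebesgue E = t * measure lebesgue ?Q" unfolding t_def using pos by simp
    have t0: "t \<ge> 0" unfolding t_def by simp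
    have Efm: "E \<in> lmeasurable" "E \<in> fmeasurable ?\<mu>"
      using fmeasurableI2[OF grid_cell_lmeasurable[OF l] E(2,1)] grid_cell_fmeasurable[OF w l E(2,1)] by auto
    have mono: "measure ?\<mu> E \<le> measure ?\<mu> ?Q"
      using E l grid_cell_fmeasurable[OF w l order_refl] by (intro measure_mono_fmeasurable) auto
    consider "t = 0" | "t \<ge> 1 / 2" | "0 < t" "t < 1 / 2" using t0 by linarith
    then have "measure ?\<mu> E \<le> (2 * t) powr \<delta> * measure ?\<mu> ?Q"
    proof cases
      case 1
      then have "emeasure lebesgue E = 0" using Et Efm(1) by (simp add: emeasure_eq_measure2)
      then have "E \<in> null_sets ?\<mu>" using weight_null[OF w, of E] E(1) by (auto simp: null_sets_def)
      then have "measure ?\<mu> E = 0" by (simp add: null_sets_def measure_def)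
      then show ?thesis by simp
    next
      case 2
      then have "1 powr \<delta> \<le> (2 * t) powr \<delta>" using \<delta> by (intro powr_mono2) auto
      then have "1 * measure ?\<mu> ?Q \<le> (2 * t) powr \<delta> * measure ?\<mu> ?Q" by (intro mult_right_mono) auto
      then show ?thesis using mono by linarith
    next
      case 3
      obtain n where n: "\<gamma> ^ n < 2 * t" using real_arch_pow_inv[of "2 * t" \<gamma>] 3 \<gamma> by auto
      \<comment> \<open>The predecessor of \<open>k\<close> is the largest \<open>j\<close> for which \<open>measurable_decay\<close> applies to \<open>E\<close>.\<close>
      define k where "k = (LEAST n. \<gamma> ^ n \<le> 2 * t)"
      have k: "\<gamma> ^ k \<le> 2 * t" unfolding k_def using LeastI[of "\<lambda>n. \<gamma> ^ n \<le> 2 * t" n] n by simp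
      have "k \<noteq> 0" using k 3 by (intro notI) auto
      then obtain j where j: "k = Suc j" using not0_implies_Suc by blast
      have "\<not> \<gamma> ^ j \<le> 2 * t" using not_less_Least[of j "\<lambda>n. \<gamma> ^ n \<le> 2 * t"] j unfolding k_def by simp
      then have "t * measure lebesgue ?Q < \<gamma> ^ j / 2 * measure lebesgue ?Q" using pos(2) by (intro mult_strict_right_mono) auto
      then have "measure ?\<mu> E \<le> \<beta> ^ Suc j * measure ?\<mu> ?Q"
        unfolding \<beta>_def using measurable_decay[OF w cmp _ l E, of j] r Et unfolding \<gamma>_def by simp
      also have "\<beta> ^ Suc j = (\<gamma> ^ k) powr \<delta>"
        unfolding \<beta>\<gamma> j using \<gamma> by (simp add: powr_realpow[symmetric] powr_powr mult.commute del: power_Suc)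
      also have "\<dots> * measure ?\<mu> ?Q \<le> (2 * t) powr \<delta> * measure ?\<mu> ?Q"
        using k \<gamma> \<delta> by (intro mult_right_mono powr_mono2) auto
      finally show ?thesis .
    qed
    then show ?thesis unfolding t_def[symmetric] using t0 by (simp add: powr_mult)
  qed
  show ?thesis
  proof (rule that[of "2 powr \<delta>" \<delta>])
    fix Q E :: "(real ^ 'n) set"
    assume Q: "Q \<in> cubes" and E: "E \<in> sets lebesgue" "E \<subseteq> Q"
    obtain a l where al: "Q = cbox a (a + (\<chi> i. l))" "l > 0" using Q unfolding cubes_def by blast
    have corner: "grid_corner a l 0 = a" by (simp add: grid_corner_def vec_eq_iff)
    define R where "R = grid_cell a l 0"
    have N: "Q - R \<in> null_sets lebesgue" using grid_cell_null[OF al(2), of a 0] unfolding corner al R_def .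
    have RQ: "measure lebesgue R = measure lebesgue Q" "measure ?\<mu> R = measure ?\<mu> Q"
      using grid_cell_measure(2)[OF al(2), of lebesgue a 0] weight_grid_cell[OF w al(2), of a 0] unfolding corner al R_def by auto
    have Rs: "R \<in> sets lebesgue" unfolding R_def using al by simp
    have ER: "E - R \<in> null_sets lebesgue" using null_sets_subset[OF N] E Rs by blast
    have E': "E \<inter> R = E - (E - R)" by blast
    have "measure lebesgue (E \<inter> R) = measure lebesgue E" "measure ?\<mu> (E \<inter> R) = measure ?\<mu> E"
      unfolding E' using ER weight_null[OF w ER] E by (auto intro!: measure_Diff_null_set)
    then show "measure ?\<mu> E \<le> 2 powr \<delta> * (measure lebesgue E / measure lebesgue Q) powr \<delta> * measure ?\<mu> Q"
      using main[OF al(2), of "E \<inter> R" a] E Rs RQ unfolding R_def by auto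
  qed (use \<delta> in auto)
qed

section \<open>Muckenhoupt and restricted weights are comparable with Lebesgue measure\<close>

lemma measure_le_density:
  assumes w: "weight w" and E: "E \<in> lmeasurable" "E \<in> fmeasurable (weight_measure w)"
    and c: "a \<ge> 0" "C \<ge> 0" and le: "AE x in lebesgue. x \<in> E \<longrightarrow> a \<le> C * w x"
  shows "a * measure lebesgue E \<le> C * measure (weight_measure w) E"
proof -
  have Es: "E \<in> sets lebesgue" using E(1) by auto
  have "ennreal a * emeasure lebesgue E = (\<integral>\<^sup>+x. ennreal a * indicator E x \<partial>lebesgue)"
    using Es by (simp add: nn_integral_cmult)
  also have "\<dots> \<le> (\<integral>\<^sup>+x. ennreal C * (ennreal (w x) * indicator E x) \<partial>lebesgue)"
  proof (rule nn_integral_mono_AE)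
    show "AE x in lebesgue. ennreal a * indicator E x \<le> ennreal C * (ennreal (w x) * indicator E x)"
      using le
    proof eventually_elim
      case (elim x)
      then show ?case using c weight_pos[OF w, of x]
        by (auto simp: indicator_def ennreal_mult''[symmetric] less_imp_le intro!: ennreal_leI)
    qed
  qed
  also have "\<dots> = ennreal C * emeasure (weight_measure w) E"
    using weight_borel[OF w] Es unfolding weight_emeasure[OF w Es] by (subst nn_integral_cmult) auto
  finally have "ennreal (a * measure lebesgue E) \<le> ennreal (C * measure (weight_measure w) E)"
    using c emeasure_eq_measure2[OF E(1)] emeasure_eq_measure2[OF E(2)] by (simp add: ennreal_mult)
  then show ?thesis using c by (simp add: ennreal_le_iff)
qed

lemma subset_cube_fmeasurable:
  assumes "weight w" "Q \<in> cubes" "E \<subseteq> Q" "E \<in> sets lebesgue"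
  shows "E \<in> fmeasurable (weight_measure w)" "E \<in> lmeasurable"
proof -
  show "E \<in> fmeasurable (weight_measure w)"
    by (rule weight_fmeasurable[OF assms(1) cube_compact[OF assms(2)] assms(3,4)])
  have "Q \<in> lmeasurable" using assms(2) by (auto simp: cubes_def)
  then show "E \<in> lmeasurable" using assms(3,4) by (rule fmeasurableI2)
qed

text \<open>Common part of the Muckenhoupt and the restricted condition for exponents greater than 1: both say that
  \<open>w\<close> is small only on small parts of \<open>Q\<close>. Choosing the threshold \<open>\<tau>\<close> so that \<open>{w < \<tau>}\<close> covers at
  most half of \<open>E\<close>, the weight of \<open>E\<close> is at least \<open>\<tau> |E| / 2\<close>.\<close>

lemma sublevel_bound_imp_comparable:
  fixes w :: "real ^ 'n \<Rightarrow> real"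
  assumes w: "weight w" and r: "r > 1" and A: "A > 0"
    and sub: "\<And>Q \<tau>. \<lbrakk>Q \<in> cubes; \<tau> > 0\<rbrakk> \<Longrightarrow> measure lebesgue {x \<in> Q. w x < \<tau>}
      \<le> A * measure lebesgue Q * (\<tau> * measure lebesgue Q / measure (weight_measure w) Q) powr (1 / (r - 1))"
  shows "comparable_to_lebesgue r (2 * (2 * A) powr (r - 1)) w"
  unfolding comparable_to_lebesgue_def
proof (intro ballI impI)
  fix Q E :: "(real ^ 'n) set" assume Q: "Q \<in> cubes" and E: "E \<in> sets lebesgue" "E \<subseteq> Q"
  let ?\<mu> = "weight_measure w"
  note pos = weight_cube_pos[OF w Q]
  note fm = subset_cube_fmeasurable[OF w Q]
  define t where "t = measure lebesgue E / measure lebesgue Q"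
  have Et: "measure lebesgue E = t * measure lebesgue Q" unfolding t_def using pos by simp
  have wm: "{x \<in> Q. w x < \<tau>} \<in> sets lebesgue" for \<tau>
  proof -
    have "{x \<in> space lebesgue. w x < \<tau>} \<in> sets lebesgue" using weight_borel[OF w] by measurable
    then have "Q \<inter> {x. w x < \<tau>} \<in> sets lebesgue" using Q by (intro sets.Int) auto
    then show ?thesis by (simp add: Int_def)
  qed
  show "(measure lebesgue E / measure lebesgue Q) powr r * measure ?\<mu> Q \<le> 2 * (2 * A) powr (r - 1) * measure ?\<mu> E"
  proof (cases "t = 0")
    case True
    then show ?thesis unfolding t_def[symmetric] using A by simp
  next
    case False
    then have t: "t > 0" unfolding t_def by (simp add: zero_less_measure_iff less_le)
    \<comment> \<open>With this \<open>\<tau>\<close> the hypothesis bounds \<open>{w < \<tau>}\<close> by exactly half the measure of \<open>E\<close>.\<close>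
    define \<tau> where "\<tau> = measure ?\<mu> Q / measure lebesgue Q * (t / (2 * A)) powr (r - 1)"
    have \<tau>: "\<tau> > 0" unfolding \<tau>_def using pos t A by simp
    define L where "L = {x \<in> Q. w x < \<tau>}"
    have "\<tau> * measure lebesgue Q / measure ?\<mu> Q = (t / (2 * A)) powr (r - 1)"
      unfolding \<tau>_def using pos by simp
    then have "(\<tau> * measure lebesgue Q / measure ?\<mu> Q) powr (1 / (r - 1)) = t / (2 * A)"
      using r t A by (simp add: powr_powr)
    then have "measure lebesgue L \<le> A * measure lebesgue Q * (t / (2 * A))"
      using sub[OF Q \<tau>] unfolding L_def by simp
    then have "measure lebesgue L \<le> measure lebesgue E / 2"
      using A unfolding Et by (simp add: mult.commute)
    moreover have "measure lebesgue E \<le> measure lebesgue (E - L) + measure lebesgue L"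
    proof -
      have "measure lebesgue E \<le> measure lebesgue ((E - L) \<union> L)"
        using E wm[of \<tau>] fm(2)[of "(E - L) \<union> L"] unfolding L_def by (intro measure_mono_fmeasurable) auto
      also have "\<dots> \<le> measure lebesgue (E - L) + measure lebesgue L"
        using E(1) wm[of \<tau>] unfolding L_def by (intro measure_Un_le) auto
      finally show ?thesis .
    qed
    ultimately have half: "measure lebesgue E / 2 \<le> measure lebesgue (E - L)" by linarith
    have EL: "E - L \<in> sets lebesgue" "E - L \<subseteq> Q" using E wm[of \<tau>] unfolding L_def by auto
    have "\<tau> * (measure lebesgue E / 2) \<le> \<tau> * measure lebesgue (E - L)"
      using half \<tau> by (intro mult_left_mono) auto
    also have "\<dots> \<le> 1 * measure ?\<mu> (E - L)"
      using \<tau> E(2) by (intro measure_le_density[OF w fm(2)[OF EL(2,1)] fm(1)[OF EL(2,1)]]) (auto simp: L_def)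
    also have "\<dots> \<le> measure ?\<mu> E"
      using EL fm(1)[OF E(2,1)] by (simp, intro measure_mono_fmeasurable) auto
    finally have "measure ?\<mu> Q * (t / (2 * A)) powr (r - 1) * t / 2 \<le> measure ?\<mu> E"
      unfolding \<tau>_def Et using pos by simp
    moreover have "(t / (2 * A)) powr (r - 1) * t = t powr r / (2 * A) powr (r - 1)"
      using t A by (simp add: powr_divide powr_diff)
    ultimately have "measure ?\<mu> Q * (t powr r / (2 * A) powr (r - 1)) / 2 \<le> measure ?\<mu> E"
      by (simp add: mult.assoc)
    then show ?thesis using A unfolding t_def[symmetric] by (simp add: field_simps)
  qed
qed

lemma ennreal_quotient_bound:
  assumes "a > 0" "d > 0" "k \<ge> 0" "ennreal a * N / ennreal d \<le> ennreal k"
  shows "N \<le> ennreal (k * d / a)"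
proof (cases N)
  case (real n)
  have "ennreal (a * n / d) \<le> ennreal k"
    using assms real by (simp add: ennreal_mult'' divide_ennreal[symmetric])
  then have "a * n / d \<le> k" using assms(3) by simp
  then show ?thesis using real assms by (auto simp: field_simps intro!: ennreal_leI)
next
  case top
  then show ?thesis using assms by (simp add: ennreal_mult_top ennreal_top_divide top_unique)
qed

lemma average_weight:
  assumes "weight w" "Q \<in> cubes"
  shows "average Q w = emeasure (weight_measure w) Q / emeasure lebesgue Q"
  using weight_emeasure[OF assms(1), of Q] assms weight_pos[OF assms(1)]
  by (simp add: average_def less_imp_le abs_of_pos)

lemma cube_emeasure:
  assumes "weight w" "Q \<in> cubes"
  shows "emeasure (weight_measure w) Q = ennreal (measure (weight_measure w) Q)"
    "emeasure lebesgue Q = ennreal (measure lebesgue Q)"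
  by (rule emeasure_eq_measure2, rule subset_cube_fmeasurable[OF assms order_refl cube_borel[OF assms(2)]])+

lemma pointwise_A1_imp_comparable:
  fixes w :: "real ^ 'n \<Rightarrow> real"
  assumes w: "weight w" and C: "C \<ge> 0"
    and A1: "\<And>Q. Q \<in> cubes \<Longrightarrow> AE x in lebesgue. x \<in> Q \<longrightarrow>
      measure (weight_measure w) Q / measure lebesgue Q \<le> C * w x"
  shows "comparable_to_lebesgue 1 C w"
  unfolding comparable_to_lebesgue_def
proof (intro ballI impI)
  fix Q E :: "(real ^ 'n) set" assume Q: "Q \<in> cubes" and E: "E \<in> sets lebesgue" "E \<subseteq> Q"
  have "measure (weight_measure w) Q / measure lebesgue Q * measure lebesgue E \<le> C * measure (weight_measure w) E"
  proof (rule measure_le_density[OF w subset_cube_fmeasurable(2,1)[OF w Q E(2,1)]])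
    show "AE x in lebesgue. x \<in> E \<longrightarrow> measure (weight_measure w) Q / measure lebesgue Q \<le> C * w x"
      using A1[OF Q] by eventually_elim (use E in auto)
  qed (use C in auto)
  then show "(measure lebesgue E / measure lebesgue Q) powr 1 * measure (weight_measure w) Q
    \<le> C * measure (weight_measure w) E"
    by (simp add: mult.commute)
qed

text \<open>For \<open>q > 1\<close> the sublevel sets of \<open>w\<close> are controlled by Chebyshev's inequality for the
  dual weight \<open>\<sigma> = w\<^bsup>-1/(q-1)\<^esup>\<close>.\<close>

theorem A_infinity_imp_comparable:
  fixes w :: "real ^ 'n \<Rightarrow> real"
  assumes "w \<in> A_infinity"
  obtains r C where "r \<ge> 1" "comparable_to_lebesgue r C w"
proof -
  obtain q where q: "q \<ge> 1" "w \<in> Muckenhoupt q" using assms unfolding A_infinity_def by auto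
  have w: "weight w" using q(2) unfolding Muckenhoupt_def by simp
  show ?thesis
  proof (cases "q = 1")
    case True
    then obtain C where C: "AE x in lebesgue. maximal_function w x \<le> ennreal (C * w x)"
      using q(2) unfolding Muckenhoupt_def by auto
    have "comparable_to_lebesgue 1 (max C 0) w"
    proof (rule pointwise_A1_imp_comparable[OF w])
      fix Q :: "(real ^ 'n) set" assume Q: "Q \<in> cubes"
      note pos = weight_cube_pos[OF w Q]
      have avg: "average Q w = ennreal (measure (weight_measure w) Q / measure lebesgue Q)"
        unfolding average_weight[OF w Q] cube_emeasure[OF w Q] using pos by (subst divide_ennreal) auto
      show "AE x in lebesgue. x \<in> Q \<longrightarrow> measure (weight_measure w) Q / measure lebesgue Q \<le> max C 0 * w x"
        using C
      proof eventually_elim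
        case (elim x)
        show ?case
        proof
          assume "x \<in> Q"
          then have "average Q w \<le> maximal_function w x"
            unfolding maximal_function_def using Q by (intro SUP_upper) auto
          also have "\<dots> \<le> ennreal (C * w x)" by (rule elim)
          also have "\<dots> \<le> ennreal (max C 0 * w x)"
            using weight_pos[OF w, of x] by (intro ennreal_leI mult_right_mono) auto
          finally show "measure (weight_measure w) Q / measure lebesgue Q \<le> max C 0 * w x"
            unfolding avg using weight_pos[OF w, of x] by (subst (asm) ennreal_le_iff) auto
        qed
      qed
    qed auto
    then show ?thesis using that[of 1] by blast
  next
    case False
    then have q1: "q > 1" using q by simp
    define s where "s = 1 / (q - 1)"
    have s: "s > 0" unfolding s_def using q1 by simp
    define \<sigma> where "\<sigma> x = w x powr - s" for x
    have bnd: "(SUP Q\<in>cubes. average Q w * average Q \<sigma> epowr (q - 1)) < top"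
      using q(2) False unfolding Muckenhoupt_def \<sigma>_def s_def by simp
    then obtain k0 where k0: "k0 \<ge> 0" "(SUP Q\<in>cubes. average Q w * average Q \<sigma> epowr (q - 1)) = ennreal k0"
      by (cases "SUP Q\<in>cubes. average Q w * average Q \<sigma> epowr (q - 1)") auto
    define k where "k = k0 + 1"
    have k: "k > 0" using k0 unfolding k_def by simp
    have avg_le: "average Q w * average Q \<sigma> epowr (q - 1) \<le> ennreal k" if "Q \<in> cubes" for Q
    proof -
      have "average Q w * average Q \<sigma> epowr (q - 1) \<le> ennreal k0"
        unfolding k0(2)[symmetric] using that by (rule SUP_upper)
      also have "\<dots> \<le> ennreal k" unfolding k_def by (intro ennreal_leI) simp
      finally show ?thesis .
    qed
    have "comparable_to_lebesgue q (2 * (2 * k powr s) powr (q - 1)) w"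
    proof (rule sublevel_bound_imp_comparable[OF w q1])
      fix Q :: "(real ^ 'n) set" and \<tau> :: real assume Q: "Q \<in> cubes" and \<tau>: "\<tau> > 0"
      note pos = weight_cube_pos[OF w Q]
      let ?m = "measure (weight_measure w) Q" and ?d = "measure lebesgue Q"
      let ?L = "{x \<in> Q. w x < \<tau>}"
      have L: "?L \<in> sets lebesgue"
      proof -
        have "{x \<in> space lebesgue. w x < \<tau>} \<in> sets lebesgue" using weight_borel[OF w] by measurable
        then have "Q \<inter> {x. w x < \<tau>} \<in> sets lebesgue" using Q by (intro sets.Int) auto
        then show ?thesis by (simp add: Int_def)
      qed
      have avg: "average Q w = ennreal (?m / ?d)"
        unfolding average_weight[OF w Q] cube_emeasure[OF w Q] using pos by (subst divide_ennreal) auto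
      have "ennreal (?m / ?d) * average Q \<sigma> epowr (q - 1) / ennreal 1 \<le> ennreal k"
        using avg_le[OF Q] unfolding avg by (simp add: divide_ennreal_def)
      then have "average Q \<sigma> epowr (q - 1) \<le> ennreal (k * 1 / (?m / ?d))"
        using pos k by (intro ennreal_quotient_bound) auto
      then have e: "average Q \<sigma> epowr (q - 1) \<le> ennreal (k * ?d / ?m)" by simp
      define y where "y = enn2real (average Q \<sigma>)"
      have fin: "average Q \<sigma> \<noteq> top" using e unfolding ennreal_powr_def by (auto simp: top_unique)
      then have y: "average Q \<sigma> = ennreal y" "y \<ge> 0" unfolding y_def by (auto simp: less_top)
      have "ennreal (y powr (q - 1)) \<le> ennreal (k * ?d / ?m)" using e y fin unfolding ennreal_powr_def by simp
      then have "y powr (q - 1) \<le> k * ?d / ?m" using k pos by simp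
      then have "(y powr (q - 1)) powr s \<le> (k * ?d / ?m) powr s" using s by (intro powr_mono2) auto
      then have yle: "y \<le> (k * ?d / ?m) powr s" using y q1 by (simp add: powr_powr s_def)
      have "ennreal (1 / \<tau> powr s) * emeasure lebesgue ?L = (\<integral>\<^sup>+x. ennreal (1 / \<tau> powr s) * indicator ?L x \<partial>lebesgue)"
        using L by (simp add: nn_integral_cmult)
      also have "\<dots> \<le> (\<integral>\<^sup>+x\<in>Q. ennreal \<bar>\<sigma> x\<bar> \<partial>lebesgue)"
      proof (intro nn_integral_mono)
        fix x
        have "1 / \<tau> powr s \<le> \<sigma> x" if "w x < \<tau>"
          unfolding \<sigma>_def powr_minus_divide using that weight_pos[OF w, of x] s
          by (intro divide_left_mono powr_mono2) auto
        then show "ennreal (1 / \<tau> powr s) * indicator ?L x \<le> ennreal \<bar>\<sigma> x\<bar> * indicator Q x"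
          by (auto simp: indicator_def intro!: ennreal_leI)
      qed
      also have "\<dots> = average Q \<sigma> * emeasure lebesgue Q"
        unfolding average_def cube_emeasure(2)[OF w Q] using pos
        by (subst ennreal_divide_times) (simp add: ennreal_mult_divide_eq)
      also have "\<dots> = ennreal (y * ?d)"
        unfolding y(1) cube_emeasure(2)[OF w Q] using y by (simp add: ennreal_mult)
      also have "emeasure lebesgue ?L = ennreal (measure lebesgue ?L)"
        by (rule emeasure_eq_measure2[OF subset_cube_fmeasurable(2)[OF w Q _ L]]) auto
      also have "ennreal (1 / \<tau> powr s) * \<dots> = ennreal (1 / \<tau> powr s * measure lebesgue ?L)"
        by (rule ennreal_mult[symmetric]) auto
      finally have "ennreal (1 / \<tau> powr s * measure lebesgue ?L) \<le> ennreal (y * ?d)" .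
      then have "1 / \<tau> powr s * measure lebesgue ?L \<le> y * ?d" using y by (subst (asm) ennreal_le_iff) auto
      then have "measure lebesgue ?L \<le> \<tau> powr s * y * ?d" using \<tau> by (simp add: field_simps)
      also have "\<dots> \<le> \<tau> powr s * (k * ?d / ?m) powr s * ?d"
        using yle by (intro mult_right_mono mult_left_mono) auto
      also have "\<dots> = k powr s * ?d * (\<tau> * ?d / ?m) powr (1 / (q - 1))"
        using \<tau> k pos unfolding s_def[symmetric] by (simp add: powr_mult powr_divide)
      finally show "measure lebesgue ?L \<le> k powr s * ?d * (\<tau> * ?d / ?m) powr (1 / (q - 1))" .
    qed (use k in auto)
    then show ?thesis using that[of q] q by blast
  qed
qed

text \<open>A weak type bound with respect to \<open>w dx\<close> is turned into one for Lebesgue measure: on the shell where \<open>1/w\<close> is about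
  \<open>2\<^sup>j Y\<close>, Lebesgue measure is about \<open>2\<^sup>j Y\<close> times \<open>w dx\<close>, and since \<open>a > 1\<close> the resulting series is
  geometric with ratio \<open>2\<^bsup>1-a\<^esup>\<close>.\<close>

lemma weighted_superlevel_sum:
  fixes w :: "real ^ 'n \<Rightarrow> real"
  assumes w: "weight w" and Q: "Q \<in> cubes" and a: "a > 1" and N: "N \<ge> 0" and Y: "Y > 0"
    and weak: "\<And>y. y > 0 \<Longrightarrow> measure (weight_measure w) {x \<in> Q. 1 / w x > y} \<le> (N / y) powr a"
  shows "measure lebesgue {x \<in> Q. 1 / w x > Y} \<le> 2 / (1 - 2 powr (1 - a)) * N powr a * Y powr (1 - a)"
proof -
  define \<rho> where "\<rho> = 2 powr (1 - a)"
  have \<rho>: "0 < \<rho>" "\<rho> < 1" unfolding \<rho>_def using a powr_less_one[of 2 "1 - a"] by auto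
  define c where "c = 2 * N powr a * Y powr (1 - a)"
  have c: "c \<ge> 0" unfolding c_def by simp
  define B where "B j = {x \<in> Q. 2 ^ j * Y < 1 / w x \<and> 1 / w x \<le> 2 ^ Suc j * Y}" for j :: nat
  have sup: "{x \<in> Q. y < 1 / w x} \<in> sets lebesgue" for y
  proof -
    have "{x \<in> space lebesgue. y < 1 / w x} \<in> sets lebesgue" using weight_borel[OF w] by measurable
    then have "Q \<inter> {x. y < 1 / w x} \<in> sets lebesgue" using Q by (intro sets.Int) auto
    then show ?thesis by (simp add: Int_def)
  qed
  have B: "B j \<in> sets lebesgue" "B j \<subseteq> Q" for j
  proof -
    have "B j = {x \<in> Q. 2 ^ j * Y < 1 / w x} - {x \<in> Q. 2 ^ Suc j * Y < 1 / w x}"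
      unfolding B_def by (auto simp del: power_Suc)
    then show "B j \<in> sets lebesgue" by (simp only: sets.Diff[OF sup sup])
    show "B j \<subseteq> Q" unfolding B_def by blast
  qed
  have Bj: "emeasure lebesgue (B j) \<le> ennreal (c * \<rho> ^ j)" for j
  proof -
    have y: "2 ^ j * Y > 0" using Y by simp
    have "1 * measure lebesgue (B j) \<le> (2 ^ Suc j * Y) * measure (weight_measure w) (B j)"
    proof (rule measure_le_density[OF w subset_cube_fmeasurable(2,1)[OF w Q B(2,1)]])
      show "AE x in lebesgue. x \<in> B j \<longrightarrow> 1 \<le> 2 ^ Suc j * Y * w x"
        using weight_pos[OF w] by (auto simp: B_def divide_le_eq)
    qed (use Y in auto)
    also have "\<dots> \<le> (2 ^ Suc j * Y) * measure (weight_measure w) {x \<in> Q. 2 ^ j * Y < 1 / w x}"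
      using Y B sup by (intro mult_left_mono measure_mono_fmeasurable subset_cube_fmeasurable(1)[OF w Q]) (auto simp: B_def)
    also have "\<dots> \<le> (2 ^ Suc j * Y) * (N / (2 ^ j * Y)) powr a"
      using Y by (intro mult_left_mono weak[OF y]) auto
    also have "\<dots> = 2 * N powr a * ((2 ^ j * Y) * ((2 ^ j * Y) powr a) powr - 1)"
      using y N by (simp add: powr_divide powr_minus_divide)
    also have "(2 ^ j * Y) * ((2 ^ j * Y) powr a) powr - 1 = (2 ^ j * Y) powr (1 - a)"
      using y by (simp add: powr_diff powr_minus_divide)
    also have "\<dots> = \<rho> ^ j * Y powr (1 - a)"
      unfolding \<rho>_def using Y by (simp add: powr_mult powr_realpow[symmetric] powr_powr mult.commute)
    finally have "measure lebesgue (B j) \<le> c * \<rho> ^ j" unfolding c_def by (simp add: mult_ac)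
    then show ?thesis
      unfolding emeasure_eq_measure2[OF subset_cube_fmeasurable(2)[OF w Q B(2,1)]] by (rule ennreal_leI)
  qed
  have "{x \<in> Q. 1 / w x > Y} \<subseteq> (\<Union>j. B j)"
  proof
    fix x assume x: "x \<in> {x \<in> Q. 1 / w x > Y}"
    obtain n where n: "1 / w x / Y < 2 ^ n" using real_arch_pow[of 2 "1 / w x / Y"] by auto
    define k where "k = (LEAST n. 1 / w x \<le> 2 ^ n * Y)"
    have "1 / w x \<le> 2 ^ n * Y" using n[unfolded pos_divide_less_eq[OF Y]] by simp
    then have k: "1 / w x \<le> 2 ^ k * Y" unfolding k_def by (rule LeastI[of "\<lambda>n. 1 / w x \<le> 2 ^ n * Y"])
    have "k \<noteq> 0" using k x by (intro notI) auto
    then obtain j where j: "k = Suc j" using not0_implies_Suc by blast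
    have "\<not> 1 / w x \<le> 2 ^ j * Y" using not_less_Least[of j "\<lambda>n. 1 / w x \<le> 2 ^ n * Y"] j unfolding k_def by simp
    then show "x \<in> (\<Union>j. B j)" using k x unfolding B_def j by force
  qed
  then have "emeasure lebesgue {x \<in> Q. 1 / w x > Y} \<le> emeasure lebesgue (\<Union>j. B j)"
    using B by (intro emeasure_mono) auto
  also have "\<dots> \<le> (\<Sum>j. emeasure lebesgue (B j))"
    using B by (intro emeasure_subadditive_countably) auto
  also have "\<dots> \<le> (\<Sum>j. ennreal (c * \<rho> ^ j))"
    by (intro suminf_le Bj) auto
  also have "\<dots> = ennreal (c * (1 / (1 - \<rho>)))"
    using \<rho> c by (intro suminf_ennreal_eq sums_mult geometric_sums) auto
  finally have "ennreal (measure lebesgue {x \<in> Q. 1 / w x > Y}) \<le> ennreal (c * (1 / (1 - \<rho>)))"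
    using emeasure_eq_measure2[OF subset_cube_fmeasurable(2)[OF w Q _ sup[of Y]]] by auto
  then have "measure lebesgue {x \<in> Q. 1 / w x > Y} \<le> c * (1 / (1 - \<rho>))"
    using c \<rho> by (subst (asm) ennreal_le_iff) auto
  then show ?thesis unfolding c_def \<rho>_def by simp
qed

text \<open>The exponent obtained is exactly \<open>p\<close>; this sharpness is what produces the space \<open>L\<^bsup>p,1\<^esup>(u)\<close> on the right-hand side of the
  final estimate. For \<open>p = 1\<close> the condition is a pointwise lower bound for the weight, for \<open>p > 1\<close> it is a
  weak type bound for \<open>1/w\<close>.\<close>

theorem A_restricted_imp_comparable:
  fixes w :: "real ^ 'n \<Rightarrow> real"
  assumes p: "p \<ge> 1" and A: "w \<in> A_restricted p"
  obtains C where "comparable_to_lebesgue p C w"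
proof -
  have w: "weight w" and fin: "restricted_constant p w < top" using A unfolding A_restricted_def by auto
  obtain k0 where k0: "k0 \<ge> 0" "restricted_constant p w = ennreal k0"
    using fin by (cases "restricted_constant p w") auto
  \<comment> \<open>Adding 1 makes the constant strictly positive.\<close>
  define k where "k = k0 + 1"
  have k: "k > 0" using k0 unfolding k_def by simp
  define h where "h Q = (\<lambda>x. indicator Q x * ennreal (inverse (w x)))" for Q :: "(real ^ 'n) set"
  have N: "lorentz_weak (weight_measure w) (conjugate_exponent p) (h Q)
      \<le> ennreal (k * measure lebesgue Q / measure (weight_measure w) Q powr (1 / p))" if Q: "Q \<in> cubes" for Q
  proof (rule ennreal_quotient_bound)
    note pos = weight_cube_pos[OF w Q]
    show "measure (weight_measure w) Q powr (1 / p) > 0" "measure lebesgue Q > 0" "k \<ge> 0" using pos k by auto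
    have "emeasure (weight_measure w) Q epowr (1 / p) = ennreal (measure (weight_measure w) Q powr (1 / p))"
      unfolding cube_emeasure[OF w Q] ennreal_powr_def by simp
    then have "ennreal (measure (weight_measure w) Q powr (1 / p)) * lorentz_weak (weight_measure w) (conjugate_exponent p) (h Q)
        / ennreal (measure lebesgue Q) \<le> restricted_constant p w"
      unfolding restricted_constant_def h_def cube_emeasure(2)[OF w Q, symmetric] using Q by (intro SUP_upper2[of Q]) auto
    also have "\<dots> \<le> ennreal k" unfolding k0 k_def by (intro ennreal_leI) simp
    finally show "ennreal (measure (weight_measure w) Q powr (1 / p)) * lorentz_weak (weight_measure w) (conjugate_exponent p) (h Q)
        / ennreal (measure lebesgue Q) \<le> ennreal k" .
  qed
  show ?thesis
  proof (cases "p = 1")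
    case True
    have "comparable_to_lebesgue 1 k w"
    proof (rule pointwise_A1_imp_comparable[OF w])
      fix Q :: "(real ^ 'n) set" assume Q: "Q \<in> cubes"
      note pos = weight_cube_pos[OF w Q]
      let ?c = "k * measure lebesgue Q / measure (weight_measure w) Q"
      have le: "esssup (weight_measure w) (h Q) \<le> ennreal ?c"
        using N[OF Q] pos unfolding True lorentz_weak_def conjugate_exponent_def by simp
      have "AE x in weight_measure w. h Q x \<le> ennreal ?c"
        using esssup_AE[where M = "weight_measure w" and f = "h Q"]
      proof eventually_elim
        case (elim x)
        then show ?case using le by (rule order_trans)
      qed
      then have "AE x in lebesgue. h Q x \<le> ennreal ?c"
        unfolding weight_measure_def using weight_borel[OF w] weight_pos[OF w] by (subst (asm) AE_density) auto
      then show "AE x in lebesgue. x \<in> Q \<longrightarrow> measure (weight_measure w) Q / measure lebesgue Q \<le> k * w x"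
      proof eventually_elim
        case (elim x)
        show ?case
        proof
          assume "x \<in> Q"
          then have "ennreal (inverse (w x)) \<le> ennreal ?c" using elim by (simp add: h_def)
          then have "inverse (w x) \<le> ?c" using k pos by (subst (asm) ennreal_le_iff) auto
          then show "measure (weight_measure w) Q / measure lebesgue Q \<le> k * w x"
            using weight_pos[OF w, of x] pos by (simp add: field_simps)
        qed
      qed
    qed (use k in auto)
    then show ?thesis using that True by blast
  next
    case False
    then have p1: "p > 1" using p by simp
    define a where "a = p / (p - 1)"
    define s where "s = 1 / (p - 1)"
    have a: "a > 1" "a = 1 + s" "a / p = s" unfolding a_def s_def using p1 by (auto simp: field_simps)
    have s: "s > 0" unfolding s_def using p1 by simp
    define A where "A = 2 / (1 - 2 powr (1 - a)) * k powr a"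
    have "2 powr (1 - a) < 1" using a powr_less_one[of 2 "1 - a"] by auto
    then have A0: "A > 0" unfolding A_def using k by simp
    have "comparable_to_lebesgue p (2 * (2 * A) powr (p - 1)) w"
    proof (rule sublevel_bound_imp_comparable[OF w p1 A0])
      fix Q :: "(real ^ 'n) set" and \<tau> :: real assume Q: "Q \<in> cubes" and \<tau>: "\<tau> > 0"
      note pos = weight_cube_pos[OF w Q]
      let ?m = "measure (weight_measure w) Q" and ?d = "measure lebesgue Q"
      define n where "n = k * ?d / ?m powr (1 / p)"
      have n: "n > 0" unfolding n_def using k pos by simp
      have weak: "measure (weight_measure w) {x \<in> Q. 1 / w x > y} \<le> (n / y) powr a" if y: "y > 0" for y
      proof -
        let ?X = "{x \<in> Q. 1 / w x > y}"
        have X: "?X \<in> sets lebesgue"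
        proof -
          have "{x \<in> space lebesgue. 1 / w x > y} \<in> sets lebesgue" using weight_borel[OF w] by measurable
          then have "Q \<inter> {x. 1 / w x > y} \<in> sets lebesgue" using Q by (intro sets.Int) auto
          then show ?thesis by (simp add: Int_def)
        qed
        have eX: "emeasure (weight_measure w) ?X = ennreal (measure (weight_measure w) ?X)"
          by (rule emeasure_eq_measure2[OF subset_cube_fmeasurable(1)[OF w Q _ X]]) auto
        have "?X = {x \<in> space (weight_measure w). h Q x > ennreal y}"
          using y by (auto simp: h_def indicator_def ennreal_less_iff inverse_eq_divide)
        then have dist: "distribution_fun (weight_measure w) (h Q) y = ennreal (measure (weight_measure w) ?X)"
          unfolding distribution_fun_def eX[symmetric] by simp
        have "ennreal y * distribution_fun (weight_measure w) (h Q) y epowr (1 / a) \<le> ennreal n"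
        proof -
          have "enn2real (conjugate_exponent p) = a" "conjugate_exponent p \<noteq> top"
            unfolding conjugate_exponent_def a_def using p1 by auto
          then have "lorentz_weak (weight_measure w) (conjugate_exponent p) (h Q)
              = (SUP y\<in>{0<..}. ennreal y * distribution_fun (weight_measure w) (h Q) y epowr (1 / a))"
            unfolding lorentz_weak_def by simp
          then show ?thesis using N[OF Q] y unfolding n_def by (auto simp: SUP_le_iff)
        qed
        then have "ennreal (y * measure (weight_measure w) ?X powr (1 / a)) \<le> ennreal n"
          unfolding dist ennreal_powr_def using y by (simp add: ennreal_mult)
        then have "measure (weight_measure w) ?X powr (1 / a) \<le> n / y"
          using n y by (simp add: field_simps)
        then have "(measure (weight_measure w) ?X powr (1 / a)) powr a \<le> (n / y) powr a"
          using a by (intro powr_mono2) auto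
        then show ?thesis using a by (simp add: powr_powr)
      qed
      have "{x \<in> Q. w x < \<tau>} = {x \<in> Q. 1 / w x > 1 / \<tau>}"
        using weight_pos[OF w] \<tau> by (auto simp: field_simps)
      then have "measure lebesgue {x \<in> Q. w x < \<tau>} \<le> 2 / (1 - 2 powr (1 - a)) * n powr a * (1 / \<tau>) powr (1 - a)"
        using weighted_superlevel_sum[OF w Q a(1) less_imp_le[OF n] _ weak, of "1 / \<tau>"] \<tau> by simp
      also have "(1 / \<tau>) powr (1 - a) = \<tau> powr s"
        using \<tau> a by (simp add: powr_divide powr_minus field_simps)
      also have "n powr a = k powr a * ?d powr a / ?m powr s"
        unfolding n_def using k pos a(3) by (simp add: powr_mult powr_divide powr_powr)
      also have "?d powr a = ?d * ?d powr s" using pos a(2) by (simp add: powr_add)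
      also have "2 / (1 - 2 powr (1 - a)) * (k powr a * (?d * ?d powr s) / ?m powr s) * \<tau> powr s
          = A * ?d * (\<tau> * ?d / ?m) powr (1 / (p - 1))"
        unfolding A_def s_def[symmetric] using \<tau> pos by (simp add: powr_mult powr_divide mult_ac)
      finally show "measure lebesgue {x \<in> Q. w x < \<tau>} \<le> A * ?d * (\<tau> * ?d / ?m) powr (1 / (p - 1))" .
    qed
    then show ?thesis using that by blast
  qed
qed

section \<open>Mutual comparison of two weights\<close>

text \<open>Decay of \<open>u\<close> in terms of Lebesgue measure is composed with comparability of Lebesgue measure with \<open>w\<close>.\<close>

lemma two_weight_decay:
  fixes u w :: "real ^ 'n \<Rightarrow> real"
  assumes u: "weight u" "comparable_to_lebesgue p B u" "p > 0"
    and w: "weight w" "comparable_to_lebesgue r C w" "r > 0"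
  obtains K \<delta> where "K > 0" "\<delta> > 0" 
    "\<And>Q E. \<lbrakk>Q \<in> cubes; E \<in> sets lebesgue; E \<subseteq> Q\<rbrakk> \<Longrightarrow>
      measure (weight_measure u) E \<le> K * (measure (weight_measure w) E / measure (weight_measure w) Q) powr \<delta> * measure (weight_measure u) Q"
proof -
  obtain K \<delta> where K: "K > 0" "\<delta> > 0"
    "\<And>Q E. \<lbrakk>Q \<in> cubes; E \<in> sets lebesgue; E \<subseteq> Q\<rbrakk> \<Longrightarrow>
      measure (weight_measure u) E \<le> K * (measure lebesgue E / measure lebesgue Q) powr \<delta> * measure (weight_measure u) Q"
    using comparable_imp_power_decay[OF u] by blast
  have C: "C \<ge> 1" by (rule comparable_constant_ge_1[OF w(1,2)])
  show ?thesis
  proof (rule that[of "K * C powr (\<delta> / r)" "\<delta> / r"])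
    fix Q E :: "(real ^ 'n) set" assume Q: "Q \<in> cubes" and E: "E \<in> sets lebesgue" "E \<subseteq> Q"
    note pos = weight_cube_pos[OF w(1) Q]
    define t where "t = measure lebesgue E / measure lebesgue Q"
    define s where "s = measure (weight_measure w) E / measure (weight_measure w) Q"
    have t0: "t \<ge> 0" "s \<ge> 0" unfolding t_def s_def by auto
    have "t powr r * measure (weight_measure w) Q \<le> C * measure (weight_measure w) E"
      using w(2) Q E unfolding comparable_to_lebesgue_def t_def by blast
    then have "t powr r \<le> C * s" unfolding s_def using pos by (simp add: field_simps)
    then have "(t powr r) powr (\<delta> / r) \<le> (C * s) powr (\<delta> / r)" using K w(3) by (intro powr_mono2) auto
    then have "t powr \<delta> \<le> C powr (\<delta> / r) * s powr (\<delta> / r)"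
      using w(3) C t0 by (simp add: powr_powr powr_mult)
    then have "K * t powr \<delta> * measure (weight_measure u) Q \<le> K * (C powr (\<delta> / r) * s powr (\<delta> / r)) * measure (weight_measure u) Q"
      using K by (intro mult_right_mono mult_left_mono) auto
    then show "measure (weight_measure u) E \<le> K * C powr (\<delta> / r) * s powr (\<delta> / r) * measure (weight_measure u) Q"
      using K(3)[OF Q E] unfolding t_def by (simp add: mult.assoc)
  qed (use K w(3) C in auto)
qed

lemma doubling:
  fixes w :: "real ^ 'n \<Rightarrow> real"
  assumes w: "weight w" "comparable_to_lebesgue r C w" 
    and Q: "Q \<in> cubes" and E: "E \<in> sets lebesgue" "E \<subseteq> Q" "measure lebesgue Q = 3 ^ CARD('n) * measure lebesgue E"
  shows "measure (weight_measure w) Q \<le> C * (3 ^ CARD('n)) powr r * measure (weight_measure w) E"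
proof -
  have pos: "measure lebesgue Q > 0" using weight_cube_pos[OF w(1) Q] by simp
  then have "measure lebesgue E > 0" unfolding E(3) by (simp add: zero_less_mult_iff)
  then have "measure lebesgue E / measure lebesgue Q = 1 / 3 ^ CARD('n)" unfolding E(3) by simp
  then have "(1 / 3 ^ CARD('n)) powr r * measure (weight_measure w) Q \<le> C * measure (weight_measure w) E"
    using w(2) Q E unfolding comparable_to_lebesgue_def by metis
  then show ?thesis by (simp add: powr_divide field_simps)
qed

section \<open>The weak type bound on a tree of cubes\<close>

lemma geometric_sum_le:
  fixes \<theta> :: real
  assumes "finite L" "inj_on h L" "0 < \<theta>" "\<theta> < 1"
  shows "(\<Sum>l\<in>L. \<theta> ^ h l) \<le> 1 / (1 - \<theta>)"
proof -
  have "(\<Sum>l\<in>L. \<theta> ^ h l) = (\<Sum>n\<in>h ` L. \<theta> ^ n)"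
    using assms by (simp add: sum.reindex)
  also have "\<dots> \<le> (\<Sum>n. \<theta> ^ n)"
    using assms by (intro sum_le_suminf summable_geometric) auto
  also have "\<dots> = 1 / (1 - \<theta>)" using assms by (intro suminf_geometric) auto
  finally show ?thesis .
qed

lemma geometric_sum_int_le:
  fixes \<theta> :: real and L :: "int set"
  assumes "finite L" "0 < \<theta>" "\<theta> < 1"
  shows "(\<Sum>l\<in>L. \<theta> ^ nat \<bar>l\<bar>) \<le> 2 / (1 - \<theta>)"
proof -
  have "(\<Sum>l\<in>L. \<theta> ^ nat \<bar>l\<bar>) = (\<Sum>l\<in>L \<inter> {0..}. \<theta> ^ nat \<bar>l\<bar>) + (\<Sum>l\<in>L - {0..}. \<theta> ^ nat \<bar>l\<bar>)"
    using assms(1) by (subst sum.Int_Diff[of L _ "{0..}"]) auto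
  also have "\<dots> \<le> 1 / (1 - \<theta>) + 1 / (1 - \<theta>)"
    using assms by (intro add_mono geometric_sum_le) (auto simp: inj_on_def)
  finally show ?thesis by simp
qed

lemma sum_UNION_le:
  fixes f :: "'a \<Rightarrow> real"
  assumes "finite G" "\<And>I. I \<in> G \<Longrightarrow> finite (A I)" "\<And>x. f x \<ge> 0"
  shows "sum f (\<Union>I\<in>G. A I) \<le> (\<Sum>I\<in>G. sum f (A I))"
  using assms(1,2)
proof (induction G rule: finite_induct)
  case (insert I G)
  have "sum f (A I \<union> (\<Union>I\<in>G. A I)) \<le> sum f (A I) + sum f (\<Union>I\<in>G. A I)"
    using insert assms(3) by (subst sum.union_inter_neutral sum_Un) (auto intro!: sum_nonneg)
  then show ?case using insert by force
qed simp

text \<open>The combinatorial heart only sees two measures \<open>U\<close> and \<open>W\<close>, with \<open>W\<close> dominated by \<open>v\<^sup>p U\<close>, and a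
  finite laminar family \<open>D\<close> of sets on which \<open>U\<close> and \<open>W\<close> control each other by powers. The operator \<open>T\<close> stands for passing
  from a cube to its triple.\<close>

locale comparable_tree =
  fixes U W :: "'a measure" and v :: "'a \<Rightarrow> real" and p K \<delta> :: real
    and D :: "'a set set" and T :: "'a set \<Rightarrow> 'a set"
  assumes p: "p \<ge> 1" and K: "K \<ge> 1" and \<delta>: "0 < \<delta>" "\<delta> \<le> 1"
    and sets_eq: "sets W = sets U" and space_U: "space U = UNIV"
    and v: "v \<in> borel_measurable U" "\<And>x. v x > 0"
    and D: "finite D" "laminar D"
    and enlarge: "\<And>Q. Q \<in> D \<Longrightarrow> Q \<subseteq> T Q" "\<And>Q R. Q \<in> D \<Longrightarrow> R \<in> D \<Longrightarrow> Q \<subseteq> R \<Longrightarrow> T Q \<subseteq> T R"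
    and fin: "\<And>Q. Q \<in> D \<Longrightarrow> Q \<in> sets U" "\<And>Q. Q \<in> D \<Longrightarrow> T Q \<in> fmeasurable U"
      "\<And>Q. Q \<in> D \<Longrightarrow> T Q \<in> fmeasurable W"
    and pos: "\<And>Q. Q \<in> D \<Longrightarrow> measure U Q > 0" "\<And>Q. Q \<in> D \<Longrightarrow> measure W Q > 0"
    and dens: "\<And>Q E c. \<lbrakk>Q \<in> D; E \<subseteq> T Q; E \<in> sets U; c > 0; \<And>x. x \<in> E \<Longrightarrow> v x \<le> c\<rbrakk>
      \<Longrightarrow> measure W E \<le> c powr p * measure U E"
    and dbl: "\<And>Q. Q \<in> D \<Longrightarrow> measure U (T Q) \<le> K * measure U Q"
      "\<And>Q. Q \<in> D \<Longrightarrow> measure W (T Q) \<le> K * measure W Q"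
    and WU: "\<And>Q E. \<lbrakk>Q \<in> D; E \<subseteq> Q; E \<in> sets U\<rbrakk>
      \<Longrightarrow> measure W E \<le> K * (measure U E / measure U Q) powr \<delta> * measure W Q"
    and UW: "\<And>Q E. \<lbrakk>Q \<in> D; E \<subseteq> T Q; E \<in> sets U\<rbrakk>
      \<Longrightarrow> measure U E \<le> K * (measure W E / measure W (T Q)) powr \<delta> * measure U (T Q)"
begin

text \<open>Consecutive strata differ by the factor \<open>b\<close> in \<open>v\<^sup>p\<close>, and \<open>\<theta>\<close> is the resulting gain after one
  application of the power comparison.\<close>

definition b :: real where "b = 2 powr p"
definition \<theta> :: real where "\<theta> = b powr - \<delta>"
definition stratum :: "int \<Rightarrow> 'a set" where "stratum k = {x. 2 powr k \<le> v x \<and> v x < 2 powr (k + 1)}"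
definition top_cubes :: "('a set \<Rightarrow> real) \<Rightarrow> int \<Rightarrow> 'a set set"
  where "top_cubes g k = maximal_members {Q \<in> D. g Q > 2 powr k}"
text \<open>The exponent of \<open>b\<close> nearest below the \<open>U\<close>-mean of \<open>v\<^sup>p\<close> over \<open>Q\<close>, relative to the level \<open>k\<close>.\<close>

definition offset :: "int \<Rightarrow> 'a set \<Rightarrow> int"
  where "offset k Q = \<lfloor>log b (measure W Q / measure U Q)\<rfloor> - k"

lemma b: "b > 1" "b \<ge> 2" and \<theta>: "0 < \<theta>" "\<theta> < 1"
proof -
  have "2 powr 1 \<le> b" unfolding b_def using p by (intro powr_mono) auto
  then show *: "b \<ge> 2" "b > 1" by auto
  then show "0 < \<theta>" "\<theta> < 1" unfolding \<theta>_def using \<delta> by (auto simp: powr_less_one)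
qed

lemma two_powr: "(2 powr t) powr p = b powr t"
  unfolding b_def by (simp add: powr_powr mult.commute)

lemma \<theta>_power: "\<theta> ^ n = b powr (- \<delta> * real n)"
proof -
  have "\<theta> ^ n = \<theta> powr real n" using \<theta> by (simp add: powr_realpow)
  then show ?thesis unfolding \<theta>_def by (simp add: powr_powr)
qed

lemma top_cubes_D: "Q \<in> top_cubes g k \<Longrightarrow> Q \<in> D" "Q \<in> top_cubes g k \<Longrightarrow> g Q > 2 powr k"
  by (auto simp: top_cubes_def maximal_members_def)

lemma finite_top_cubes: "finite (top_cubes g k)"
  using D(1) top_cubes_D(1) by (metis finite_subset subsetI)

lemma offset:
  assumes "Q \<in> D" "offset k Q = l"
  shows "b powr (k + l) * measure U Q \<le> measure W Q" "measure W Q < b powr (k + l + 1) * measure U Q"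
proof -
  let ?r = "measure W Q / measure U Q"
  have r: "?r > 0" using pos[OF assms(1)] by simp
  have "of_int (k + l) \<le> log b ?r" "log b ?r < of_int (k + l) + 1"
    using assms(2) unfolding offset_def by linarith+
  then have "b powr (k + l) \<le> ?r" "?r < b powr (k + l + 1)"
    using b r by (auto simp: le_log_iff log_less_iff)
  then show "b powr (k + l) * measure U Q \<le> measure W Q" "measure W Q < b powr (k + l + 1) * measure U Q"
    using pos[OF assms(1)] by (auto simp: field_simps)
qed

lemma stratum_sets: "stratum k \<in> sets U"
proof -
  have "{x \<in> space U. 2 powr k \<le> v x \<and> v x < 2 powr (k + 1)} \<in> sets U" using v(1) by measurable
  then show ?thesis by (simp add: stratum_def space_U)
qed

lemma measure_le:
  assumes "Q \<in> D" "E \<subseteq> F" "F \<subseteq> T Q" "E \<in> sets U" "F \<in> sets U"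
  shows "measure U E \<le> measure U F" "measure W E \<le> measure W F"
proof -
  have "F \<in> fmeasurable U" "F \<in> fmeasurable W"
    using fmeasurableI2[OF fin(2)[OF assms(1)] assms(3)] fmeasurableI2[OF fin(3)[OF assms(1)] assms(3)] assms(5) sets_eq
    by auto
  then show "measure U E \<le> measure U F" "measure W E \<le> measure W F"
    using assms sets_eq by (auto intro!: measure_mono_fmeasurable)
qed

text \<open>On the stratum \<open>v\<^sup>p\<close> is about \<open>b\<^sup>k\<close>, whereas its mean over \<open>Q\<close> is about \<open>b\<^bsup>k+l\<^esup>\<close> with \<open>l\<close> the offset. If \<open>l < 0\<close>, the total mass
  \<open>W(Q)\<close> is already small compared with \<open>b\<^sup>k U(Q)\<close>. If \<open>l \<ge> 0\<close>, the stratum carries only a fraction of order \<open>b\<^bsup>-l\<^esup>\<close> of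
  \<open>W\<close>, hence by the comparison only a fraction of order \<open>b\<^bsup>-\<delta>l\<^esup>\<close> of \<open>U\<close>.\<close>

lemma piece_bound:
  assumes Q: "Q \<in> D"
  shows "measure W (T Q \<inter> stratum k) \<le> K ^ 3 * b ^ 2 * \<theta> ^ nat \<bar>offset k Q\<bar> * (b powr real_of_int k * measure U Q)"
proof -
  define l where "l = offset k Q"
  define X where "X = T Q \<inter> stratum k"
  note off = offset[OF Q l_def[symmetric]]
  have TU: "T Q \<in> sets U" using fin(2)[OF Q] by auto
  have X: "X \<in> sets U" "X \<subseteq> T Q" unfolding X_def using TU stratum_sets by auto
  have mX: "measure U X \<le> measure U (T Q)" "measure W X \<le> measure W (T Q)"
    using measure_le[OF Q X(2) order_refl X(1) TU] .
  have mQ: "measure W Q \<le> measure W (T Q)" "measure U Q \<le> measure U (T Q)"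
    using measure_le[OF Q enlarge(1)[OF Q] order_refl fin(1)[OF Q] TU] by auto
  note UQ = pos(1)[OF Q] and WQ = pos(2)[OF Q]
  have K3: "K \<le> K ^ 3" using K self_le_power[of K 3] by simp
  have b2: "b \<le> b ^ 2" using b self_le_power[of b 2] by simp
  show ?thesis
  proof (cases "l < 0")
    case True
    have "measure W X \<le> K * measure W Q" using mX(2) dbl(2)[OF Q] by linarith
    also have "\<dots> \<le> K * (b powr (k + l + 1) * measure U Q)"
      using off(2) K by (intro mult_left_mono) auto
    also have "b powr (k + l + 1) = b * b powr real_of_int l * b powr k"
      using b by (simp add: powr_add mult_ac)
    also have "K * (b * b powr real_of_int l * b powr real_of_int k * measure U Q) = (K * b) * b powr real_of_int l * (b powr real_of_int k * measure U Q)"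
      by (simp add: mult_ac)
    also have "\<dots> \<le> (K ^ 3 * b ^ 2) * \<theta> ^ nat \<bar>l\<bar> * (b powr real_of_int k * measure U Q)"
    proof (intro mult_mono mult_right_mono)
      have "real_of_int l = - real (nat \<bar>l\<bar>)" using True by simp
      also have "\<dots> \<le> - \<delta> * real (nat \<bar>l\<bar>)" using \<delta> mult_right_mono[of \<delta> 1 "real (nat \<bar>l\<bar>)"] by simp
      finally show "b powr real_of_int l \<le> \<theta> ^ nat \<bar>l\<bar>" unfolding \<theta>_power using b by (intro powr_mono) auto
    qed (use K3 b2 K b UQ \<theta> in auto)
    finally show ?thesis unfolding X_def l_def .
  next
    case False
    have WX: "measure W X \<le> b * b powr real_of_int k * measure U X"
    proof -
      have "measure W X \<le> (2 powr (k + 1)) powr p * measure U X"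
        by (rule dens[OF Q X(2,1)]) (auto simp: X_def stratum_def)
      then show ?thesis using b unfolding two_powr by (simp add: powr_add mult_ac)
    qed
    have "measure W X \<le> b * b powr real_of_int k * (K * measure U Q)"
      using b by (intro order_trans[OF WX mult_left_mono[OF order_trans[OF mX(1) dbl(1)[OF Q]]]]) auto
    moreover have "b powr (k + l) * measure U Q \<le> measure W (T Q)" using off(1) mQ(1) by linarith
    ultimately have "measure W X / measure W (T Q) \<le> (b * b powr real_of_int k * (K * measure U Q)) / (b powr (k + l) * measure U Q)"
      using UQ b K by (intro frac_le) auto
    also have "\<dots> = K * b * b powr - l"
      using UQ b by (simp add: powr_add powr_minus field_simps)
    finally have "(measure W X / measure W (T Q)) powr \<delta> \<le> (K * b * b powr - l) powr \<delta>"
      using \<delta> by (intro powr_mono2) auto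
    also have "\<dots> = (K * b) powr \<delta> * \<theta> ^ nat \<bar>l\<bar>"
      using K b False unfolding \<theta>_power by (simp add: powr_mult powr_powr mult.commute)
    also have "\<dots> \<le> (K * b) powr 1 * \<theta> ^ nat \<bar>l\<bar>"
    proof (intro mult_right_mono powr_mono)
      show "1 \<le> K * b" using K b mult_mono[of 1 K 1 b] by simp
    qed (use \<delta> \<theta> in auto)
    also have "\<dots> = (K * b) * \<theta> ^ nat \<bar>l\<bar>" using K b by simp
    finally have ratio: "(measure W X / measure W (T Q)) powr \<delta> \<le> (K * b) * \<theta> ^ nat \<bar>l\<bar>" .
    have "measure U X \<le> K * (measure W X / measure W (T Q)) powr \<delta> * measure U (T Q)"
      by (rule UW[OF Q X(2,1)])
    also have "\<dots> \<le> K * ((K * b) * \<theta> ^ nat \<bar>l\<bar>) * (K * measure U Q)"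
      using ratio dbl(1)[OF Q] K b \<theta> by (intro mult_mono mult_left_mono) auto
    finally have "b * b powr real_of_int k * measure U X \<le> b * b powr real_of_int k * (K * ((K * b) * \<theta> ^ nat \<bar>l\<bar>) * (K * measure U Q))"
      using b by (intro mult_left_mono) auto
    then have "measure W X \<le> b * b powr real_of_int k * (K * ((K * b) * \<theta> ^ nat \<bar>l\<bar>) * (K * measure U Q))"
      using WX by linarith
    then show ?thesis unfolding X_def l_def by (simp add: power2_eq_square power3_eq_cube mult_ac)
  qed
qed

text \<open>Carleson packing. Cubes with equal offset and level \<open>k = i + m\<close> have means about \<open>b\<^sup>m\<close> times that of
  \<open>I\<close>; they are disjoint, so their union has \<open>U\<close>-proportion of order \<open>b\<^bsup>-m\<^esup>\<close> in \<open>I\<close> and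
  \<open>W\<close>-proportion of order \<open>\<theta>\<^sup>m\<close>. These proportions are summable over \<open>m\<close>.\<close>

lemma descendants_bound:
  fixes P :: "(int \<times> 'a set) set"
  assumes fin: "finite P" and P: "\<And>k Q. (k, Q) \<in> P \<Longrightarrow> Q \<in> top_cubes g k \<and> offset k Q = l"
    and I: "(i, I) \<in> P"
  shows "(\<Sum>(k, Q)\<in>{(k, Q) \<in> P. Q \<subseteq> I}. measure W Q) \<le> K * b / (1 - \<theta>) * measure W I"
proof -
  define B where "B = {(k, Q) \<in> P. Q \<subseteq> I}"
  have finB: "finite B" using fin unfolding B_def by (rule rev_finite_subset) auto
  have I': "I \<in> top_cubes g i" "offset i I = l" using P[OF I] by auto
  note ID = top_cubes_D[OF I'(1)]
  \<comment> \<open>If a strict subset \<open>Q\<close> of \<open>I\<close> had level \<open>k < i\<close>, then \<open>g I > 2\<^sup>i > 2\<^sup>k\<close> would contradict the maximality of \<open>Q\<close> at level \<open>k\<close>.\<close>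
  have ge: "k \<ge> i" if "(k, Q) \<in> B" for k Q
  proof (cases "Q = I")
    case True
    then show ?thesis using that P[of k Q] I' unfolding B_def offset_def by auto
  next
    case False
    have Q: "Q \<in> top_cubes g k" "Q \<subseteq> I" using that P unfolding B_def by auto
    show ?thesis
    proof (rule ccontr)
      assume "\<not> k \<ge> i"
      then have "2 powr real_of_int k \<le> 2 powr real_of_int i" by (intro powr_mono) auto
      then have "g I > 2 powr k" using ID(2) by linarith
      then have "I \<in> {Q \<in> D. g Q > 2 powr k}" using ID by auto
      then have "Q = I" using Q unfolding top_cubes_def maximal_members_def by blast
      then show False using False by simp
    qed
  qed
  have level: "(\<Sum>Q\<in>{Q. (k, Q) \<in> B}. measure W Q) \<le> K * b * measure W I * \<theta> ^ nat (k - i)" for k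
  proof -
    define F where "F = {Q. (k, Q) \<in> B}"
    show ?thesis
    proof (cases "F = {}")
      case True
      then show ?thesis unfolding F_def using K b \<theta> by (simp add: measure_nonneg)
    next
      case False
      then have ki: "k \<ge> i" using ge unfolding F_def by auto
      have F: "F \<subseteq> top_cubes g k" "\<And>Q. Q \<in> F \<Longrightarrow> Q \<subseteq> I" "\<And>Q. Q \<in> F \<Longrightarrow> offset k Q = l"
        using P unfolding F_def B_def by auto
      have finF: "finite F" using F(1) finite_top_cubes finite_subset by blast
      have "disjoint (top_cubes g k)"
        unfolding top_cubes_def by (intro disjoint_maximal_members laminar_subset[OF D(2)]) auto
      then have disF: "disjoint F" using F(1) by (meson disjoint_def subsetD)
      have FD: "Q \<in> D" if "Q \<in> F" for Q using that F(1) top_cubes_D by blast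
      have FT: "Q \<subseteq> T I" if "Q \<in> F" for Q using F(2)[OF that] enlarge(1)[OF ID(1)] by blast
      have Ffm: "Q \<in> fmeasurable U" "Q \<in> fmeasurable W" if "Q \<in> F" for Q
        using fmeasurableI2[OF comparable_tree.fin(2)[OF comparable_tree_axioms ID(1)] FT[OF that]]
          fmeasurableI2[OF comparable_tree.fin(3)[OF comparable_tree_axioms ID(1)] FT[OF that]]
          comparable_tree.fin(1)[OF comparable_tree_axioms FD[OF that]] sets_eq by auto
      define E where "E = \<Union>F"
      have E: "E \<subseteq> I" "E \<in> sets U" using F(2) Ffm finF unfolding E_def by auto
      have sumU: "measure U E = (\<Sum>Q\<in>F. measure U Q)"
        unfolding E_def using measure_disjoint_Union[OF finF disF, of "\<lambda>Q. Q" U] Ffm by simp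
      have sumW: "measure W E = (\<Sum>Q\<in>F. measure W Q)"
        unfolding E_def using measure_disjoint_Union[OF finF disF, of "\<lambda>Q. Q" W] Ffm by simp
      have WE: "measure W E \<le> measure W I"
        using measure_le(2)[OF ID(1) E(1) enlarge(1)[OF ID(1)] E(2)] comparable_tree.fin(1)[OF comparable_tree_axioms ID(1)] by auto
      have "b powr (k + l) * measure U E = (\<Sum>Q\<in>F. b powr (k + l) * measure U Q)"
        unfolding sumU by (simp add: sum_distrib_left)
      also have "\<dots> \<le> (\<Sum>Q\<in>F. measure W Q)"
        using offset(1)[OF FD F(3)] by (intro sum_mono) auto
      also have "\<dots> \<le> b powr (i + l + 1) * measure U I" 
        using WE offset(2)[OF ID(1) I'(2)] unfolding sumW by linarith
      finally have "measure U E / measure U I \<le> b powr (i + l + 1) / b powr (k + l)"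
        using pos(1)[OF ID(1)] b by (simp add: field_simps)
      also have "\<dots> = b * b powr - real (nat (k - i))"
        using b ki by (simp add: powr_add powr_minus powr_diff field_simps)
      finally have "(measure U E / measure U I) powr \<delta> \<le> (b * b powr - real (nat (k - i))) powr \<delta>"
        using \<delta> by (intro powr_mono2) auto
      also have "\<dots> = b powr \<delta> * \<theta> ^ nat (k - i)"
        using b unfolding \<theta>_power by (simp add: powr_mult powr_powr mult.commute)
      also have "\<dots> \<le> b powr 1 * \<theta> ^ nat (k - i)"
        using \<delta> \<theta> b by (intro mult_right_mono powr_mono) auto
      finally have ratio: "(measure U E / measure U I) powr \<delta> \<le> b * \<theta> ^ nat (k - i)" using b by simp
      have "measure W E \<le> K * (measure U E / measure U I) powr \<delta> * measure W I"
        by (rule WU[OF ID(1) E])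
      also have "\<dots> \<le> K * (b * \<theta> ^ nat (k - i)) * measure W I"
        using ratio K by (intro mult_right_mono mult_left_mono) auto
      finally show ?thesis unfolding sumW F_def by (simp add: mult_ac)
    qed
  qed
  have "(\<Sum>(k, Q)\<in>B. measure W Q) = (\<Sum>k\<in>fst ` B. \<Sum>Q\<in>{Q. (k, Q) \<in> B}. measure W Q)"
  proof -
    have fs: "finite {Q. (k, Q) \<in> B}" for k
      by (rule finite_subset[OF _ finite_imageI[OF finB, of snd]]) force
    have "B = Sigma (fst ` B) (\<lambda>k. {Q. (k, Q) \<in> B})" by force
    then have "(\<Sum>(k, Q)\<in>B. measure W Q) = (\<Sum>(k, Q)\<in>Sigma (fst ` B) (\<lambda>k. {Q. (k, Q) \<in> B}). measure W Q)" by simp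
    also have "\<dots> = (\<Sum>k\<in>fst ` B. \<Sum>Q\<in>{Q. (k, Q) \<in> B}. measure W Q)"
      using finB fs by (subst sum.Sigma) auto
    finally show ?thesis .
  qed
  also have "\<dots> \<le> (\<Sum>k\<in>fst ` B. K * b * measure W I * \<theta> ^ nat (k - i))"
    by (intro sum_mono level)
  also have "\<dots> = K * b * measure W I * (\<Sum>k\<in>fst ` B. \<theta> ^ nat (k - i))"
    by (simp add: sum_distrib_left)
  also have "\<dots> \<le> K * b * measure W I * (1 / (1 - \<theta>))"
  proof (intro mult_left_mono geometric_sum_le)
    have "k \<ge> i" if "k \<in> fst ` B" for k using that ge by auto
    then show "inj_on (\<lambda>k. nat (k - i)) (fst ` B)"
      by (intro inj_onI) (metis diff_ge_0_iff_ge eq_nat_nat_iff diff_add_cancel)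
  qed (use finB \<theta> K b in auto)
  finally show ?thesis unfolding B_def by (simp add: mult_ac)
qed

text \<open>For fixed offset \<open>l\<close> the terms are about \<open>b\<^bsup>-l\<^esup> W(Q)\<close>. By the packing property the
  sum is dominated by the cubes that are maximal in the class, and those are disjoint.\<close>

lemma offset_class_bound:
  fixes P :: "(int \<times> 'a set) set"
  assumes fin: "finite P" and P: "\<And>k Q. (k, Q) \<in> P \<Longrightarrow> Q \<in> top_cubes g k \<and> offset k Q = l"
    and S: "\<And>F. \<lbrakk>F \<subseteq> D; disjoint F; \<And>Q. Q \<in> F \<Longrightarrow> g Q > 0\<rbrakk> \<Longrightarrow> (\<Sum>Q\<in>F. g Q powr p * measure U Q) \<le> S"
  shows "(\<Sum>(k, Q)\<in>P. b powr real_of_int k * measure U Q) \<le> K * b ^ 2 / (1 - \<theta>) * S"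
proof -
  define G where "G = maximal_members (snd ` P)"
  have finG: "finite G" using fin maximal_members_subset unfolding G_def by (metis finite_imageI finite_subset)
  have PD: "Q \<in> D" if "(k, Q) \<in> P" for k Q using P[OF that] top_cubes_D by blast
  have snd_D: "snd ` P \<subseteq> D" using PD by auto
  have GP: "\<exists>k. (k, Q) \<in> P" if "Q \<in> G" for Q
    using that maximal_members_subset unfolding G_def by force
  \<comment> \<open>The offset determines the level, so each cube of the class occurs with one level only.\<close>
  define lev where "lev Q = (SOME k. (k, Q) \<in> P)" for Q
  have lev: "(lev Q, Q) \<in> P" if "Q \<in> G" for Q
    unfolding lev_def using GP[OF that] by (rule someI_ex)
  have GD: "G \<subseteq> D" using lev PD by blast
  have disG: "disjoint G"
    unfolding G_def by (intro disjoint_maximal_members laminar_subset[OF D(2) snd_D])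
  have gG: "g Q > 2 powr lev Q" if "Q \<in> G" for Q
    using P[OF lev[OF that]] top_cubes_D(2) by blast
  have c: "b powr - l \<ge> 0" "K * b / (1 - \<theta>) \<ge> 0" using K b \<theta> by auto
  have "(\<Sum>(k, Q)\<in>P. b powr real_of_int k * measure U Q) \<le> (\<Sum>(k, Q)\<in>P. b powr - l * measure W Q)"
  proof (rule sum_mono, clarify)
    fix k Q assume kQ: "(k, Q) \<in> P"
    have "b powr - l * (b powr (k + l) * measure U Q) \<le> b powr - l * measure W Q"
      using offset(1)[OF PD[OF kQ]] P[OF kQ] by (intro mult_left_mono) auto
    then show "b powr real_of_int k * measure U Q \<le> b powr - l * measure W Q"
      using b by (simp add: powr_add powr_minus field_simps)
  qed
  also have "\<dots> = b powr - l * (\<Sum>(k, Q)\<in>P. measure W Q)"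
    by (simp add: sum_distrib_left case_prod_beta)
  also have "\<dots> \<le> b powr - l * (\<Sum>I\<in>G. \<Sum>(k, Q)\<in>{(k, Q) \<in> P. Q \<subseteq> I}. measure W Q)"
  proof (intro mult_left_mono c)
    have cover: "P \<subseteq> (\<Union>I\<in>G. {(k, Q) \<in> P. Q \<subseteq> I})"
    proof
      fix x assume x: "x \<in> P"
      obtain I where "I \<in> maximal_members (snd ` P)" "snd x \<subseteq> I"
        using maximal_member_above[of "snd ` P" "snd x"] fin x by (metis finite_imageI imageI)
      then show "x \<in> (\<Union>I\<in>G. {(k, Q) \<in> P. Q \<subseteq> I})" using x unfolding G_def by (cases x) auto
    qed
    have fP: "finite {(k, Q) \<in> P. Q \<subseteq> I}" for I using fin by (rule rev_finite_subset) auto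
    have "(\<Sum>(k, Q)\<in>P. measure W Q) \<le> (\<Sum>(k, Q)\<in>(\<Union>I\<in>G. {(k, Q) \<in> P. Q \<subseteq> I}). measure W Q)"
      using cover finG fP by (intro sum_mono2) auto
    also have "\<dots> \<le> (\<Sum>I\<in>G. \<Sum>(k, Q)\<in>{(k, Q) \<in> P. Q \<subseteq> I}. measure W Q)"
      using finG fP by (intro sum_UNION_le) auto
    finally show "(\<Sum>(k, Q)\<in>P. measure W Q) \<le> (\<Sum>I\<in>G. \<Sum>(k, Q)\<in>{(k, Q) \<in> P. Q \<subseteq> I}. measure W Q)" .
  qed
  also have "\<dots> \<le> b powr - l * (\<Sum>I\<in>G. K * b / (1 - \<theta>) * measure W I)"
    using descendants_bound[OF fin P lev] by (intro mult_left_mono c sum_mono) auto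
  also have "\<dots> = K * b / (1 - \<theta>) * (\<Sum>I\<in>G. b powr - l * measure W I)"
    by (simp add: sum_distrib_left mult_ac)
  also have "\<dots> \<le> K * b / (1 - \<theta>) * (\<Sum>I\<in>G. b * (g I powr p * measure U I))"
  proof (intro mult_left_mono sum_mono c)
    fix I assume I: "I \<in> G"
    have ID: "I \<in> D" and off: "offset (lev I) I = l" using PD[OF lev[OF I]] P[OF lev[OF I]] by auto
    have "b powr - l * measure W I \<le> b powr - l * (b powr (lev I + l + 1) * measure U I)"
      using offset(2)[OF ID off] by (intro mult_left_mono) auto
    also have "\<dots> = b * ((2 powr lev I) powr p * measure U I)"
      using b by (simp add: powr_add powr_minus field_simps two_powr)
    also have "\<dots> \<le> b * (g I powr p * measure U I)"
      using gG[OF I] p b by (intro mult_left_mono mult_right_mono powr_mono2) auto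
    finally show "b powr - l * measure W I \<le> b * (g I powr p * measure U I)" .
  qed
  also have "\<dots> = K * b ^ 2 / (1 - \<theta>) * (\<Sum>I\<in>G. g I powr p * measure U I)"
    by (simp add: sum_distrib_left[symmetric] power2_eq_square)
  also have "\<dots> \<le> K * b ^ 2 / (1 - \<theta>) * S"
  proof (intro mult_left_mono S GD disG)
    show "g Q > 0" if "Q \<in> G" for Q
      using gG[OF that] powr_ge_zero[of 2 "real_of_int (lev Q)"] by linarith
  qed (use K b \<theta> in auto)
  finally show ?thesis .
qed

definition weak_const :: real
  where "weak_const = (K ^ 3 * b ^ 2) * (K * b ^ 2 / (1 - \<theta>)) * (2 / (1 - \<theta>))"

text \<open>The lower bound \<open>2\<^sup>N\<close> for \<open>v\<close> leaves finitely many levels; the estimate does not depend on it.\<close>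

theorem truncated_weak_bound:
  fixes N :: int
  assumes S: "\<And>F. \<lbrakk>F \<subseteq> D; disjoint F; \<And>Q. Q \<in> F \<Longrightarrow> g Q > 0\<rbrakk> \<Longrightarrow> (\<Sum>Q\<in>F. g Q powr p * measure U Q) \<le> S"
  shows "emeasure W {x. \<exists>Q\<in>D. x \<in> T Q \<and> v x < g Q \<and> 2 powr N \<le> v x} \<le> ennreal (weak_const * S)"
proof -
  \<comment> \<open>Any level occurring in the set is at most \<open>M\<close>, because there \<open>v x < g Q\<close>.\<close>
  define M where "M = \<lceil>log 2 (1 + (\<Sum>Q\<in>D. \<bar>g Q\<bar>))\<rceil>"
  define P where "P = Sigma {N..M} (top_cubes g)"
  define L where "L = (\<lambda>(k, Q). offset k Q) ` P"
  have finP: "finite P" unfolding P_def using finite_top_cubes by auto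
  have finL: "finite L" unfolding L_def using finP by auto
  have PD: "Q \<in> D" if "(k, Q) \<in> P" for k Q using that top_cubes_D unfolding P_def by auto
  have c: "K ^ 3 * b ^ 2 \<ge> 0" "K * b ^ 2 / (1 - \<theta>) \<ge> 0" using K b \<theta> by auto
  have S0: "S \<ge> 0" using S[of "{}"] by simp
  have cover: "{x. \<exists>Q\<in>D. x \<in> T Q \<and> v x < g Q \<and> 2 powr N \<le> v x} \<subseteq> (\<Union>(k, Q)\<in>P. T Q \<inter> stratum k)"
  proof
    fix x assume "x \<in> {x. \<exists>Q\<in>D. x \<in> T Q \<and> v x < g Q \<and> 2 powr N \<le> v x}"
    then obtain Q where Q: "Q \<in> D" "x \<in> T Q" "v x < g Q" "2 powr N \<le> v x" by auto
    define k where "k = \<lfloor>log 2 (v x)\<rfloor>"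
    have lk: "of_int k \<le> log 2 (v x)" "log 2 (v x) < of_int k + 1" unfolding k_def by linarith+
    then have xk: "x \<in> stratum k" using v(2)[of x] by (simp add: stratum_def le_log_iff log_less_iff)
    have "of_int N \<le> log 2 (v x)" using Q(4) v(2)[of x] by (simp add: le_log_iff)
    then have kN: "k \<ge> N" unfolding k_def by linarith
    have "g Q \<le> \<bar>g Q\<bar>" by simp
    also have "\<dots> \<le> (\<Sum>Q\<in>D. \<bar>g Q\<bar>)" using Q(1) D(1) by (intro member_le_sum) auto
    finally have "log 2 (v x) \<le> log 2 (1 + (\<Sum>Q\<in>D. \<bar>g Q\<bar>))"
      using Q(3) v(2)[of x] by (subst log_le_cancel_iff) auto
    then have kM: "k \<le> M" using lk unfolding M_def by linarith
    have "Q \<in> {Q \<in> D. g Q > 2 powr k}" using Q xk unfolding stratum_def by auto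
    then obtain I where I: "I \<in> top_cubes g k" "Q \<subseteq> I"
      unfolding top_cubes_def using D(1) maximal_member_above[of "{Q \<in> D. g Q > 2 powr k}" Q] by auto
    then have "x \<in> T I" using enlarge(2)[OF Q(1) top_cubes_D(1)[OF I(1)] I(2)] Q(2) by blast
    then show "x \<in> (\<Union>(k, Q)\<in>P. T Q \<inter> stratum k)" using xk kN kM I(1) unfolding P_def by auto
  qed
  have sets: "T Q \<inter> stratum k \<in> fmeasurable W" if "(k, Q) \<in> P" for k Q
    using fin(3)[OF PD[OF that]] stratum_sets[of k] sets_eq by (auto intro: fmeasurable_Int_fmeasurable)
  have "emeasure W {x. \<exists>Q\<in>D. x \<in> T Q \<and> v x < g Q \<and> 2 powr N \<le> v x} \<le> emeasure W (\<Union>(k, Q)\<in>P. T Q \<inter> stratum k)"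
    using cover finP sets by (intro emeasure_mono sets.finite_UN) auto
  also have "\<dots> \<le> (\<Sum>x\<in>P. emeasure W (case x of (k, Q) \<Rightarrow> T Q \<inter> stratum k))"
    using finP sets by (intro emeasure_subadditive_finite) auto
  also have "\<dots> = (\<Sum>x\<in>P. ennreal (measure W (case x of (k, Q) \<Rightarrow> T Q \<inter> stratum k)))"
    using sets by (intro sum.cong refl emeasure_eq_measure2) (auto simp: fmeasurable_def)
  also have "\<dots> = ennreal (\<Sum>(k, Q)\<in>P. measure W (T Q \<inter> stratum k))"
    by (subst sum_ennreal) (auto simp: case_prod_beta)
  also have "(\<Sum>(k, Q)\<in>P. measure W (T Q \<inter> stratum k))
      \<le> (\<Sum>(k, Q)\<in>P. K ^ 3 * b ^ 2 * \<theta> ^ nat \<bar>offset k Q\<bar> * (b powr real_of_int k * measure U Q))"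
    using piece_bound PD by (intro sum_mono) auto
  also have "\<dots> = (\<Sum>l\<in>L. \<Sum>(k, Q)\<in>{x \<in> P. (\<lambda>(k, Q). offset k Q) x = l}. K ^ 3 * b ^ 2 * \<theta> ^ nat \<bar>offset k Q\<bar> * (b powr real_of_int k * measure U Q))"
    unfolding L_def using finP by (rule sum.image_gen)
  also have "\<dots> = (\<Sum>l\<in>L. K ^ 3 * b ^ 2 * \<theta> ^ nat \<bar>l\<bar> * (\<Sum>(k, Q)\<in>{x \<in> P. (\<lambda>(k, Q). offset k Q) x = l}. b powr real_of_int k * measure U Q))"
    by (intro sum.cong refl, subst sum_distrib_left, intro sum.cong refl) auto
  also have "\<dots> \<le> (\<Sum>l\<in>L. K ^ 3 * b ^ 2 * \<theta> ^ nat \<bar>l\<bar> * (K * b ^ 2 / (1 - \<theta>) * S))"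
  proof (intro sum_mono mult_left_mono)
    fix l
    show "(\<Sum>(k, Q)\<in>{x \<in> P. (\<lambda>(k, Q). offset k Q) x = l}. b powr real_of_int k * measure U Q) \<le> K * b ^ 2 / (1 - \<theta>) * S"
      by (rule offset_class_bound[OF _ _ S]) (use finP in \<open>auto simp: P_def\<close>)
  qed (use c \<theta> in auto)
  also have "\<dots> = (K ^ 3 * b ^ 2) * (K * b ^ 2 / (1 - \<theta>) * S) * (\<Sum>l\<in>L. \<theta> ^ nat \<bar>l\<bar>)"
    by (subst sum_distrib_left, intro sum.cong refl) (simp only: mult_ac)
  also have "\<dots> \<le> (K ^ 3 * b ^ 2) * (K * b ^ 2 / (1 - \<theta>) * S) * (2 / (1 - \<theta>))"
    by (intro mult_left_mono geometric_sum_int_le[OF finL] \<theta> mult_nonneg_nonneg c S0)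
  also have "\<dots> = weak_const * S" unfolding weak_const_def by (simp add: mult_ac)
  finally show ?thesis by (simp add: ennreal_leI)
qed

end

section \<open>Averages over disjoint cubes and the Lorentz norm\<close>

text \<open>Tonelli's theorem for the region under the graph of \<open>g\<close>.\<close>

lemma layer_cake:
  fixes g :: "'a \<Rightarrow> real"
  assumes M: "sigma_finite_measure M" and g: "g \<in> borel_measurable M" and nn: "\<And>x. g x \<ge> 0"
  shows "(\<integral>\<^sup>+x. ennreal (g x) \<partial>M) = (\<integral>\<^sup>+y\<in>{0<..}. emeasure M {x \<in> space M. y < g x} \<partial>lborel)"
proof -
  interpret pair_sigma_finite M lborel
    using M by (simp add: pair_sigma_finite_def sigma_finite_lborel)
  define h where "h = (\<lambda>(x, y). indicator {z. 0 < snd z \<and> snd z < g (fst z)} (x, y) :: ennreal)"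
  have S: "{z \<in> space (M \<Otimes>\<^sub>M lborel). 0 < snd z \<and> snd z < g (fst z)} \<in> sets (M \<Otimes>\<^sub>M lborel)"
    using g by measurable
  have h: "h \<in> borel_measurable (M \<Otimes>\<^sub>M lborel)"
    by (rule measurable_cong[THEN iffD2, OF _ borel_measurable_indicator[OF S]])
      (auto simp: h_def indicator_def)
  have "(\<integral>\<^sup>+x. ennreal (g x) \<partial>M) = (\<integral>\<^sup>+x. (\<integral>\<^sup>+y. h (x, y) \<partial>lborel) \<partial>M)"
  proof (rule nn_integral_cong)
    fix x
    have "(\<integral>\<^sup>+y. h (x, y) \<partial>lborel) = (\<integral>\<^sup>+y. indicator {0<..<g x} y \<partial>lborel)"
      unfolding h_def by (intro nn_integral_cong) (auto simp: indicator_def)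
    then show "ennreal (g x) = (\<integral>\<^sup>+y. h (x, y) \<partial>lborel)" using nn[of x] by simp
  qed
  also have "\<dots> = (\<integral>\<^sup>+y. (\<integral>\<^sup>+x. h (x, y) \<partial>M) \<partial>lborel)" using Fubini'[of "\<lambda>x y. h (x, y)"] h by simp
  also have "\<dots> = (\<integral>\<^sup>+y\<in>{0<..}. emeasure M {x \<in> space M. y < g x} \<partial>lborel)"
  proof (rule nn_integral_cong)
    fix y :: real
    have s: "{x \<in> space M. y < g x} \<in> sets M" using g by measurable
    show "(\<integral>\<^sup>+x. h (x, y) \<partial>M) = emeasure M {x \<in> space M. y < g x} * indicator {0<..} y"
    proof (cases "y > 0")
      case True
      then have "(\<integral>\<^sup>+x. h (x, y) \<partial>M) = (\<integral>\<^sup>+x. indicator {x \<in> space M. y < g x} x \<partial>M)"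
        unfolding h_def by (intro nn_integral_cong) (auto simp: indicator_def)
      then show ?thesis using s True by simp
    qed (simp add: h_def)
  qed
  finally show ?thesis .
qed

text \<open>After normalising the right-hand side to 1, this is the sum of Young's inequalities
  \<open>a\<^bsup>p-1\<^esup> z \<le> (1 - 1/p) a\<^sup>p + (1/p) z\<^sup>p\<close>, which also covers \<open>p = 1\<close>.\<close>

lemma finite_hoelder:
  fixes \<alpha> h :: "'i \<Rightarrow> real"
  assumes p: "p \<ge> 1" and \<alpha>: "\<And>i. i \<in> F \<Longrightarrow> \<alpha> i \<ge> 0" "(\<Sum>i\<in>F. \<alpha> i powr p) \<le> 1"
    and h: "\<And>i. i \<in> F \<Longrightarrow> h i \<ge> 0" and F: "finite F"
  shows "(\<Sum>i\<in>F. \<alpha> i powr (p - 1) * h i) \<le> (\<Sum>i\<in>F. h i powr p) powr (1 / p)"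
proof -
  define G where "G = (\<Sum>i\<in>F. h i powr p) powr (1 / p)"
  have sum0: "(\<Sum>i\<in>F. h i powr p) \<ge> 0" by (intro sum_nonneg) auto
  show ?thesis
  proof (cases "G = 0")
    case True
    then have "(\<Sum>i\<in>F. h i powr p) = 0" unfolding G_def by simp
    then have "h i = 0" if "i \<in> F" for i using that F by (subst (asm) sum_nonneg_eq_0_iff) auto
    then show ?thesis by (simp add: sum0)
  next
    case False
    then have G: "G > 0" unfolding G_def by (simp add: less_le)
    have Gp: "G powr p = (\<Sum>i\<in>F. h i powr p)" unfolding G_def using p sum0 by (simp add: powr_powr)
    have young: "\<alpha> i powr (p - 1) * (h i / G) \<le> (p - 1) / p * \<alpha> i powr p + 1 / p * (h i powr p / G powr p)"
      if i: "i \<in> F" for i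
    proof (cases "\<alpha> i = 0 \<or> h i = 0")
      case True
      then show ?thesis using p G by auto
    next
      case False
      then have "\<alpha> i > 0" "h i > 0" using \<alpha>(1)[OF i] h[OF i] by auto
      then show ?thesis
        using Youngs_inequality_0[of "(p - 1) / p" "1 / p" "\<alpha> i powr p" "(h i / G) powr p"] p G
        by (simp add: powr_powr powr_divide add_divide_distrib[symmetric])
    qed
    have "(\<Sum>i\<in>F. \<alpha> i powr (p - 1) * (h i / G)) \<le> (\<Sum>i\<in>F. (p - 1) / p * \<alpha> i powr p + 1 / p * (h i powr p / G powr p))"
      by (intro sum_mono young)
    also have "\<dots> = (p - 1) / p * (\<Sum>i\<in>F. \<alpha> i powr p) + 1 / p * ((\<Sum>i\<in>F. h i powr p) / G powr p)"
      by (simp only: sum.distrib sum_distrib_left sum_divide_distrib)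
    also have "\<dots> = (p - 1) / p * (\<Sum>i\<in>F. \<alpha> i powr p) + 1 / p" using Gp G by auto
    also have "\<dots> \<le> (p - 1) / p * 1 + 1 / p" using \<alpha>(2) p by (intro add_right_mono mult_left_mono) auto
    also have "\<dots> = 1" using p by (simp add: add_divide_distrib[symmetric])
    finally have "(\<Sum>i\<in>F. \<alpha> i powr (p - 1) * h i) / G \<le> 1" by (simp add: sum_divide_distrib)
    then show ?thesis using G unfolding G_def[symmetric] by simp
  qed
qed

text \<open>By duality: with \<open>\<alpha> i = A i / \<parallel>A\<parallel>\<^sub>p\<close> the norm of \<open>A\<close> is the sum of the \<open>(\<alpha> i)\<^bsup>p-1\<^esup> A i\<close>, in
  which the integrals can be interchanged with the finite sum before Hoelder's inequality is applied
  pointwise.\<close>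

lemma minkowski_integral:
  fixes A :: "'i \<Rightarrow> real" and h :: "'i \<Rightarrow> real \<Rightarrow> real" and H :: "real \<Rightarrow> ennreal"
  assumes p: "p \<ge> 1" and F: "finite F" and A: "\<And>i. i \<in> F \<Longrightarrow> A i \<ge> 0"
    and h: "\<And>i. i \<in> F \<Longrightarrow> h i \<in> borel_measurable borel" "\<And>i y. i \<in> F \<Longrightarrow> h i y \<ge> 0"
    and le: "\<And>i. i \<in> F \<Longrightarrow> ennreal (A i) \<le> (\<integral>\<^sup>+y\<in>{0<..}. ennreal (h i y) \<partial>lborel)"
    and H: "\<And>y. y > 0 \<Longrightarrow> ennreal ((\<Sum>i\<in>F. h i y powr p) powr (1 / p)) \<le> H y"
  shows "ennreal ((\<Sum>i\<in>F. A i powr p) powr (1 / p)) \<le> (\<integral>\<^sup>+y\<in>{0<..}. H y \<partial>lborel)"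
proof (cases "(\<Sum>i\<in>F. A i powr p) = 0")
  case False
  define L where "L = (\<Sum>i\<in>F. A i powr p)"
  have L: "L > 0" using False unfolding L_def by (simp add: less_le sum_nonneg)
  define \<alpha> where "\<alpha> i = A i / L powr (1 / p)" for i
  have \<alpha>0: "\<alpha> i \<ge> 0" if "i \<in> F" for i unfolding \<alpha>_def using A[OF that] by simp
  have "(\<Sum>i\<in>F. \<alpha> i powr p) = (\<Sum>i\<in>F. A i powr p / L)"
    unfolding \<alpha>_def using p L A by (intro sum.cong refl) (simp add: powr_divide powr_powr)
  also have "\<dots> = 1" using L unfolding L_def by (simp add: sum_divide_distrib[symmetric])
  finally have \<alpha>1: "(\<Sum>i\<in>F. \<alpha> i powr p) \<le> 1" by simp
  have scaled: "\<alpha> i powr (p - 1) * A i = L powr (1 / p - 1) * A i powr p" if i: "i \<in> F" for i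
  proof (cases "A i = 0")
    case False
    then have Ai: "A i > 0" using A[OF i] by simp
    have "\<alpha> i powr (p - 1) = A i powr (p - 1) / L powr ((p - 1) / p)"
      unfolding \<alpha>_def using Ai L by (simp add: powr_divide powr_powr)
    moreover have "1 / p - 1 = - ((p - 1) / p)" using p by (simp add: field_simps)
    then have "L powr (1 / p - 1) = 1 / L powr ((p - 1) / p)" by (simp only: powr_minus_divide)
    moreover have "A i powr (p - 1) * A i = A i powr p" using Ai by (simp add: powr_diff)
    ultimately show ?thesis by simp
  qed (use p in auto)
  have "L powr (1 / p) = L powr (1 / p - 1) * L" using L by (simp add: powr_diff)
  also have "\<dots> = (\<Sum>i\<in>F. \<alpha> i powr (p - 1) * A i)"
  proof -
    have "(\<Sum>i\<in>F. \<alpha> i powr (p - 1) * A i) = (\<Sum>i\<in>F. L powr (1 / p - 1) * A i powr p)"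
      by (intro sum.cong refl scaled)
    then show ?thesis by (simp only: L_def sum_distrib_left)
  qed
  finally have L_eq: "L powr (1 / p) = (\<Sum>i\<in>F. \<alpha> i powr (p - 1) * A i)" .
  have hm: "(\<lambda>y. ennreal (h i y) * indicator {0<..} y) \<in> borel_measurable lborel" if "i \<in> F" for i
    using h(1)[OF that] by measurable
  have "ennreal (L powr (1 / p)) = (\<Sum>i\<in>F. ennreal (\<alpha> i powr (p - 1)) * ennreal (A i))"
    unfolding L_eq using A by (simp add: sum_ennreal[symmetric] ennreal_mult)
  also have "\<dots> \<le> (\<Sum>i\<in>F. ennreal (\<alpha> i powr (p - 1)) * (\<integral>\<^sup>+y\<in>{0<..}. ennreal (h i y) \<partial>lborel))"
    by (intro sum_mono mult_left_mono le) auto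
  also have "\<dots> = (\<integral>\<^sup>+y. (\<Sum>i\<in>F. ennreal (\<alpha> i powr (p - 1)) * (ennreal (h i y) * indicator {0<..} y)) \<partial>lborel)"
  proof (subst nn_integral_sum)
    show "(\<lambda>y. ennreal (\<alpha> i powr (p - 1)) * (ennreal (h i y) * indicator {0<..} y)) \<in> borel_measurable lborel"
      if "i \<in> F" for i using h(1)[OF that] by measurable
    show "(\<Sum>i\<in>F. ennreal (\<alpha> i powr (p - 1)) * (\<integral>\<^sup>+y\<in>{0<..}. ennreal (h i y) \<partial>lborel)) =
      (\<Sum>i\<in>F. \<integral>\<^sup>+y. ennreal (\<alpha> i powr (p - 1)) * (ennreal (h i y) * indicator {0<..} y) \<partial>lborel)"
      by (intro sum.cong refl nn_integral_cmult[symmetric] hm)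
  qed
  also have "\<dots> \<le> (\<integral>\<^sup>+y\<in>{0<..}. H y \<partial>lborel)"
  proof (rule nn_integral_mono)
    fix y :: real
    show "(\<Sum>i\<in>F. ennreal (\<alpha> i powr (p - 1)) * (ennreal (h i y) * indicator {0<..} y)) \<le> H y * indicator {0<..} y"
    proof (cases "y > 0")
      case True
      have "(\<Sum>i\<in>F. ennreal (\<alpha> i powr (p - 1)) * ennreal (h i y)) = ennreal (\<Sum>i\<in>F. \<alpha> i powr (p - 1) * h i y)"
        using h(2) by (simp add: sum_ennreal[symmetric] ennreal_mult)
      also have "\<dots> \<le> ennreal ((\<Sum>i\<in>F. h i y powr p) powr (1 / p))"
        by (intro ennreal_leI finite_hoelder[OF p \<alpha>0 \<alpha>1 h(2) F])
      also have "\<dots> \<le> H y" by (rule H[OF True])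
      finally show ?thesis using True by simp
    qed simp
  qed
  finally show ?thesis unfolding L_def .
qed simp

text \<open>Write the integral of \<open>|f|\<close> over \<open>Q\<close> by the layer cake formula and apply comparability to every superlevel
  set. This is Hoelder's inequality for the pair \<open>L\<^bsup>p,1\<^esup>\<close>, \<open>L\<^bsup>p',\<infinity>\<^esup>\<close> in disguise.\<close>

lemma cell_average_bound:
  fixes u f :: "real ^ 'n \<Rightarrow> real"
  assumes u: "weight u" and cmp: "comparable_to_lebesgue p C u" and p: "p \<ge> 1"
    and f: "f \<in> borel_measurable lebesgue" and s: "s > 0" and Q: "Q = grid_cell c s m"
  shows "average Q f * ennreal (measure (weight_measure u) Q powr (1 / p))
    \<le> (\<integral>\<^sup>+y\<in>{0<..}. ennreal (C powr (1 / p) * measure (weight_measure u) {x \<in> Q. y < \<bar>f x\<bar>} powr (1 / p)) \<partial>lborel)"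
proof -
  let ?\<mu> = "weight_measure u" and ?X = "\<lambda>y. {x \<in> Q. y < \<bar>f x\<bar>}"
  have Qs: "Q \<in> sets lebesgue" "Q \<in> lmeasurable" unfolding Q using s grid_cell_lmeasurable by auto
  have C: "C \<ge> 1" by (rule comparable_constant_ge_1[OF u cmp])
  have pos: "measure ?\<mu> Q > 0" "measure lebesgue Q > 0" unfolding Q by (rule weight_cell_pos[OF u s])+
  define R where "R = restrict_space lebesgue Q"
  have spR: "space R = Q" unfolding R_def by (simp add: space_restrict_space)
  have X: "?X y \<in> sets lebesgue" for y
  proof -
    have "{x \<in> space lebesgue. y < \<bar>f x\<bar>} \<in> sets lebesgue" using f by measurable
    then have "Q \<inter> {x. y < \<bar>f x\<bar>} \<in> sets lebesgue" using Qs(1) by (intro sets.Int) auto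
    then show ?thesis by (simp add: Int_def)
  qed
  have eR: "emeasure R (?X y) = ennreal (measure lebesgue (?X y))" for y
  proof -
    have "?X y \<in> lmeasurable" using fmeasurableI2[OF Qs(2) _ X[of y]] by auto
    moreover have "emeasure R (?X y) = emeasure lebesgue (?X y)"
      unfolding R_def using Qs(1) by (intro emeasure_restrict_space) auto
    ultimately show ?thesis using emeasure_eq_measure2 by metis
  qed
  have "emeasure R (space R) = emeasure lebesgue Q"
    unfolding spR unfolding R_def using Qs(1) by (intro emeasure_restrict_space) auto
  then have "finite_measure R"
    using fmeasurableD2[OF Qs(2)] unfolding infinity_ennreal_def[symmetric] by (metis finite_measureI)
  then have sf: "sigma_finite_measure R" by (simp add: finite_measure_def)
  have fR: "(\<lambda>x. \<bar>f x\<bar>) \<in> borel_measurable R" unfolding R_def using f by (intro measurable_restrict_space1) measurable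
  have "(\<integral>\<^sup>+x\<in>Q. ennreal \<bar>f x\<bar> \<partial>lebesgue) = (\<integral>\<^sup>+x. ennreal \<bar>f x\<bar> \<partial>R)"
    unfolding R_def using Qs(1) by (subst nn_integral_restrict_space) auto
  also have "\<dots> = (\<integral>\<^sup>+y\<in>{0<..}. ennreal (measure lebesgue (?X y)) \<partial>lborel)"
    unfolding layer_cake[OF sf fR abs_ge_zero] spR eR ..
  finally have int: "(\<integral>\<^sup>+x\<in>Q. ennreal \<bar>f x\<bar> \<partial>lebesgue) = (\<integral>\<^sup>+y\<in>{0<..}. ennreal (measure lebesgue (?X y)) \<partial>lborel)" .
  have eQ: "emeasure lebesgue Q = ennreal (measure lebesgue Q)" by (rule emeasure_eq_measure2[OF Qs(2)])
  define k where "k = measure ?\<mu> Q powr (1 / p) / measure lebesgue Q"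
  have k: "k > 0" unfolding k_def using pos by simp
  have anti: "antimono (\<lambda>y. measure lebesgue (?X y))"
    by (intro antimonoI measure_mono_fmeasurable X fmeasurableI2[OF Qs(2) _ X]) auto
  have "average Q f * ennreal (measure ?\<mu> Q powr (1 / p)) = (\<integral>\<^sup>+x\<in>Q. ennreal \<bar>f x\<bar> \<partial>lebesgue) * ennreal k"
    unfolding average_def k_def eQ using pos
    by (simp add: divide_ennreal[symmetric] ennreal_times_divide ennreal_divide_times mult.commute)
  also have "\<dots> = (\<integral>\<^sup>+y\<in>{0<..}. ennreal (k * measure lebesgue (?X y)) \<partial>lborel)"
  proof -
    have "(\<lambda>y. - measure lebesgue (?X y)) \<in> borel_measurable borel"
      using anti by (intro borel_measurable_mono) (auto simp: mono_def antimono_def)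
    then have m: "(\<lambda>y. measure lebesgue (?X y)) \<in> borel_measurable borel" by simp
    have "(\<integral>\<^sup>+y\<in>{0<..}. ennreal (k * measure lebesgue (?X y)) \<partial>lborel)
        = (\<integral>\<^sup>+y. ennreal k * (ennreal (measure lebesgue (?X y)) * indicator {0<..} y) \<partial>lborel)"
      using k by (intro nn_integral_cong) (auto simp: ennreal_mult' mult.assoc)
    also have "\<dots> = ennreal k * (\<integral>\<^sup>+y\<in>{0<..}. ennreal (measure lebesgue (?X y)) \<partial>lborel)"
    proof (rule nn_integral_cmult)
      show "(\<lambda>y. ennreal (measure lebesgue (?X y)) * indicator {0<..} y) \<in> borel_measurable lborel"
        using m by measurable
    qed
    finally show ?thesis unfolding int by (simp add: mult.commute)
  qed
  also have "\<dots> \<le> (\<integral>\<^sup>+y\<in>{0<..}. ennreal (C powr (1 / p) * measure ?\<mu> (?X y) powr (1 / p)) \<partial>lborel)"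
  proof (intro nn_integral_mono mult_right_mono ennreal_leI)
    fix y
    have "(measure lebesgue (?X y) / measure lebesgue Q) powr p * measure ?\<mu> Q \<le> C * measure ?\<mu> (?X y)"
      using comparable_cell[OF u cmp s X[of y, unfolded Q]] unfolding Q by auto
    then have "((measure lebesgue (?X y) / measure lebesgue Q) powr p * measure ?\<mu> Q) powr (1 / p) \<le> (C * measure ?\<mu> (?X y)) powr (1 / p)"
      using p by (intro powr_mono2) auto
    then show "k * measure lebesgue (?X y) \<le> C powr (1 / p) * measure ?\<mu> (?X y) powr (1 / p)"
      unfolding k_def using p C pos by (simp add: powr_mult powr_powr mult.commute)
  qed auto
  finally show ?thesis .
qed

text \<open>The \<open>L\<^bsup>p,1\<^esup>\<close> quasi-norms of the restrictions of \<open>f\<close> to disjoint sets satisfy a \<open>p\<close>-superadditivity, which is Minkowski's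
  inequality for the functions \<open>U(Q \<inter> {|f| > y})\<^bsup>1/p\<^esup>\<close> of \<open>y\<close>.\<close>

lemma disjoint_averages_bound:
  fixes u f :: "real ^ 'n \<Rightarrow> real"
  assumes u: "weight u" and cmp: "comparable_to_lebesgue p C u" and p: "p \<ge> 1"
    and f: "f \<in> borel_measurable lebesgue" 
    and F: "finite F" "disjoint F" "\<And>Q. Q \<in> F \<Longrightarrow> \<exists>c s m. s > 0 \<and> Q = grid_cell c s m"
    and I: "(\<integral>\<^sup>+y\<in>{0<..}. distribution_fun (weight_measure u) (\<lambda>x. ennreal \<bar>f x\<bar>) y epowr (1 / p) \<partial>lborel) = ennreal I" "I \<ge> 0"
  shows "(\<Sum>Q\<in>F. enn2real (average Q f) powr p * measure (weight_measure u) Q) \<le> C * I powr p"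
    and "\<And>Q. Q \<in> F \<Longrightarrow> average Q f < top"
proof -
  let ?\<mu> = "weight_measure u" and ?X = "\<lambda>Q y. {x \<in> Q. y < \<bar>f x\<bar>}"
  have C: "C \<ge> 1" by (rule comparable_constant_ge_1[OF u cmp])
  have cell: "Q \<in> sets lebesgue" "Q \<in> fmeasurable ?\<mu>" "measure ?\<mu> Q > 0" if "Q \<in> F" for Q
    using F(3)[OF that] grid_cell_fmeasurable[OF u _ order_refl grid_cell_sets] weight_cell_pos(1)[OF u] by auto
  define B where "B y = {x. y < \<bar>f x\<bar>}" for y
  have B: "B y \<in> sets lebesgue" for y
  proof -
    have "{x \<in> space lebesgue. y < \<bar>f x\<bar>} \<in> sets lebesgue" using f by measurable
    then show ?thesis by (simp add: B_def)
  qed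
  have XB: "?X Q y = Q \<inter> B y" for Q y unfolding B_def by auto
  have X: "?X Q y \<in> sets lebesgue" "?X Q y \<in> fmeasurable ?\<mu>" if "Q \<in> F" for Q y
  proof -
    show "?X Q y \<in> sets lebesgue" unfolding XB using cell(1)[OF that] B by (rule sets.Int)
    then show "?X Q y \<in> fmeasurable ?\<mu>" by (intro fmeasurableI2[OF cell(2)[OF that]]) auto
  qed
  have dist: "distribution_fun ?\<mu> (\<lambda>x. ennreal \<bar>f x\<bar>) y = emeasure ?\<mu> (B y)" if "y > 0" for y
    unfolding distribution_fun_def B_def using that by (intro arg_cong[where f = "emeasure ?\<mu>"]) (auto simp: ennreal_less_iff)
  define h where "h Q y = C powr (1 / p) * measure ?\<mu> (?X Q y) powr (1 / p)" for Q y
  have h0: "h Q y \<ge> 0" for Q y unfolding h_def using C by simp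
  have hm: "h Q \<in> borel_measurable borel" if Q: "Q \<in> F" for Q
  proof -
    have "antimono (\<lambda>y. measure ?\<mu> (?X Q y))"
      by (intro antimonoI measure_mono_fmeasurable) (use X[OF Q] in auto)
    then have "(\<lambda>y. - measure ?\<mu> (?X Q y)) \<in> borel_measurable borel"
      by (intro borel_measurable_mono) (auto simp: mono_def antimono_def)
    then have "(\<lambda>y. measure ?\<mu> (?X Q y)) \<in> borel_measurable borel" by simp
    then show ?thesis unfolding h_def by measurable
  qed
  have sum_le: "ennreal (\<Sum>Q\<in>F. measure ?\<mu> (?X Q y)) \<le> emeasure ?\<mu> (B y)" for y
  proof -
    have fU: "(\<Union>Q\<in>F. ?X Q y) \<in> fmeasurable ?\<mu>" using X(2) F(1) by (intro fmeasurable.finite_UN) auto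
    have "(\<Sum>Q\<in>F. measure ?\<mu> (?X Q y)) = measure ?\<mu> (\<Union>Q\<in>F. ?X Q y)"
      using measure_disjoint_Union[OF F(1,2), of "\<lambda>Q. ?X Q y" ?\<mu>] X(2) by auto
    then have "ennreal (\<Sum>Q\<in>F. measure ?\<mu> (?X Q y)) = emeasure ?\<mu> (\<Union>Q\<in>F. ?X Q y)"
      using emeasure_eq_measure2[OF fU] by simp
    also have "\<dots> \<le> emeasure ?\<mu> (B y)" using B by (intro emeasure_mono) (auto simp: B_def)
    finally show ?thesis .
  qed
  have H: "ennreal ((\<Sum>Q\<in>F. h Q y powr p) powr (1 / p))
      \<le> ennreal (C powr (1 / p)) * distribution_fun ?\<mu> (\<lambda>x. ennreal \<bar>f x\<bar>) y epowr (1 / p)" if "y > 0" for y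
  proof (cases "emeasure ?\<mu> (B y)")
    case (real e)
    have "(\<Sum>Q\<in>F. h Q y powr p) = C * (\<Sum>Q\<in>F. measure ?\<mu> (?X Q y))"
      unfolding h_def using p C by (simp add: powr_mult powr_powr sum_distrib_left)
    also have "\<dots> \<le> C * e" using sum_le[of y] real C by (intro mult_left_mono) auto
    finally have "(\<Sum>Q\<in>F. h Q y powr p) powr (1 / p) \<le> (C * e) powr (1 / p)"
      using p by (intro powr_mono2 sum_nonneg) auto
    then show ?thesis unfolding dist[OF that] real(2) ennreal_powr_def
      using C real(1) by (simp add: powr_mult ennreal_mult[symmetric] ennreal_leI)
  next
    case top
    then show ?thesis unfolding dist[OF that] top ennreal_powr_def using C by (simp add: ennreal_mult_top)
  qed
  have Im: "(\<integral>\<^sup>+y\<in>{0<..}. ennreal (C powr (1 / p)) * distribution_fun ?\<mu> (\<lambda>x. ennreal \<bar>f x\<bar>) y epowr (1 / p) \<partial>lborel)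
     \<le> ennreal (C powr (1 / p) * I)"
    (is "?lhs \<le> _")
  proof -
    have dm: "(\<lambda>y. distribution_fun ?\<mu> (\<lambda>x. ennreal \<bar>f x\<bar>) y epowr (1 / p) * indicator {0<..} y) \<in> borel_measurable lborel"
    proof -
      have "ennreal_powr a (1 / p) \<le> ennreal_powr b (1 / p)" if "a \<le> b" for a b
        using that p unfolding ennreal_powr_def
        by (auto simp: top_unique intro!: ennreal_leI powr_mono2 enn2real_mono simp: less_top)
      moreover have "distribution_fun ?\<mu> (\<lambda>x. ennreal \<bar>f x\<bar>) y \<le> distribution_fun ?\<mu> (\<lambda>x. ennreal \<bar>f x\<bar>) y'"
        if "0 < y'" "y' \<le> y" for y y'
        using that B unfolding dist[OF that(1)] dist[OF less_le_trans[OF that]]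
        by (intro emeasure_mono) (auto simp: B_def)
      ultimately have anti: "distribution_fun ?\<mu> (\<lambda>x. ennreal \<bar>f x\<bar>) y epowr (1 / p) \<le> distribution_fun ?\<mu> (\<lambda>x. ennreal \<bar>f x\<bar>) y' epowr (1 / p)"
        if "0 < y'" "y' \<le> y" for y y' using that by blast
      have "{y. a < distribution_fun ?\<mu> (\<lambda>x. ennreal \<bar>f x\<bar>) y epowr (1 / p) * indicator {0<..} y} \<in> sets borel" for a
      proof -
        have "is_interval {y. a < distribution_fun ?\<mu> (\<lambda>x. ennreal \<bar>f x\<bar>) y epowr (1 / p) * indicator {0<..} y}"
          unfolding is_interval_1 using anti
          by (auto simp: indicator_def split: if_splits intro: less_le_trans)
        then show ?thesis by (rule real_interval_borel_measurable)
      qed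
      then show ?thesis by (intro borel_measurableI_greater) simp
    qed
    have "?lhs = ennreal (C powr (1 / p)) * ennreal I"
      unfolding I(1)[symmetric] mult.assoc by (rule nn_integral_cmult[OF dm])
    then show ?thesis using I(2) by (simp add: ennreal_mult)
  qed
  have avg: "average Q f * ennreal (measure ?\<mu> Q powr (1 / p)) \<le> (\<integral>\<^sup>+y\<in>{0<..}. ennreal (h Q y) \<partial>lborel)"
    if Q: "Q \<in> F" for Q
    using F(3)[OF Q] cell_average_bound[OF u cmp p f] unfolding h_def by blast
  have hI: "(\<integral>\<^sup>+y\<in>{0<..}. ennreal (h Q y) \<partial>lborel) \<le> ennreal (C powr (1 / p) * I)" if Q: "Q \<in> F" for Q
  proof -
    have "(\<integral>\<^sup>+y\<in>{0<..}. ennreal (h Q y) \<partial>lborel) \<le> ?lhs"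
    proof (rule nn_integral_mono)
      fix y :: real
      have "h Q y \<le> (\<Sum>Q\<in>F. h Q y powr p) powr (1 / p)" 
      proof -
        have "h Q y powr p \<le> (\<Sum>Q\<in>F. h Q y powr p)" using Q F(1) by (intro member_le_sum) auto
        then have "(h Q y powr p) powr (1 / p) \<le> (\<Sum>Q\<in>F. h Q y powr p) powr (1 / p)" using p by (intro powr_mono2) auto
        then show ?thesis using p h0[of Q y] by (simp add: powr_powr)
      qed
      then show "ennreal (h Q y) * indicator {0<..} y
        \<le> ennreal (C powr (1 / p)) * distribution_fun ?\<mu> (\<lambda>x. ennreal \<bar>f x\<bar>) y epowr (1 / p) * indicator {0<..} y"
        using H[of y] by (auto simp: indicator_def intro: order_trans[OF ennreal_leI])
    qed
    then show ?thesis using Im by (rule order_trans)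
  qed
  show fin: "average Q f < top" if Q: "Q \<in> F" for Q
  proof (rule ccontr)
    assume "\<not> ?thesis"
    then have "average Q f = top" using top.not_eq_extremum by blast
    then show False using order_trans[OF avg[OF Q] hI[OF Q]] cell(3)[OF Q]
      by (simp add: ennreal_top_mult top_unique)
  qed
  define A where "A Q = enn2real (average Q f) * measure ?\<mu> Q powr (1 / p)" for Q
  have eA: "ennreal (A Q) = average Q f * ennreal (measure ?\<mu> Q powr (1 / p))" if "Q \<in> F" for Q
    unfolding A_def using fin[OF that] by (simp add: ennreal_mult)
  have "ennreal ((\<Sum>Q\<in>F. A Q powr p) powr (1 / p)) \<le> ?lhs"
    by (rule minkowski_integral[OF p F(1), where h = h]) (use h0 hm avg eA H in \<open>auto simp: A_def\<close>)
  also note Im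
  finally have "(\<Sum>Q\<in>F. A Q powr p) powr (1 / p) \<le> C powr (1 / p) * I"
    using I(2) by (subst (asm) ennreal_le_iff) auto
  then have "((\<Sum>Q\<in>F. A Q powr p) powr (1 / p)) powr p \<le> (C powr (1 / p) * I) powr p"
    using p by (intro powr_mono2) auto
  then have "(\<Sum>Q\<in>F. A Q powr p) \<le> C * I powr p"
    using p C I(2) by (simp add: powr_powr powr_mult sum_nonneg)
  moreover have "A Q powr p = enn2real (average Q f) powr p * measure ?\<mu> Q" if "Q \<in> F" for Q
    unfolding A_def using p by (simp add: powr_mult powr_powr)
  ultimately show "(\<Sum>Q\<in>F. enn2real (average Q f) powr p * measure ?\<mu> Q) \<le> C * I powr p" by simp
qed

section \<open>Triples and the dyadic grid\<close>

text \<open>For a cell of side \<open>s\<close> this is the concentric closed cube of side \<open>3 s\<close>. Describing it without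
  reference to a centre makes monotonicity in \<open>R\<close> immediate.\<close>

definition tripled :: "(real ^ 'n) set \<Rightarrow> (real ^ 'n) set"
  where "tripled R = {x + y - z | x y z. x \<in> closure R \<and> y \<in> closure R \<and> z \<in> closure R}"

lemma tripled_mono: "Q \<subseteq> R \<Longrightarrow> tripled Q \<subseteq> tripled R"
  unfolding tripled_def using closure_mono by blast

lemma subset_tripled: "Q \<subseteq> tripled Q"
proof
  fix x assume "x \<in> Q"
  then have "x \<in> closure Q" using closure_subset by blast
  then have "x + x - x \<in> tripled Q" unfolding tripled_def by blast
  then show "x \<in> tripled Q" by simp
qed

lemma closure_grid_cell:
  assumes s: "s > 0"
  shows "closure (grid_cell c s m) = cbox (grid_corner c s m) (grid_corner c s m + (\<chi> i. s))"
proof (rule antisym)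
  let ?a = "grid_corner c s m"
  show "closure (grid_cell c s m) \<subseteq> cbox ?a (?a + (\<chi> i. s))"
    by (rule closure_minimal[OF grid_cell_between(2)[OF s] closed_cbox])
  have "box ?a (?a + (\<chi> i. s)) \<noteq> {}" using s by (simp add: interval_ne_empty_cart)
  then show "cbox ?a (?a + (\<chi> i. s)) \<subseteq> closure (grid_cell c s m)"
    using closure_mono[OF grid_cell_between(1)[OF s]] closure_box by metis
qed

lemma tripled_cell:
  fixes c :: "real ^ 'n" and m :: "int ^ 'n"
  assumes s: "s > 0"
  defines "a \<equiv> grid_corner c s m"
  shows "tripled (grid_cell c s m) = cbox (a - (\<chi> i. s)) (a + (\<chi> i. 2 * s))"
proof (intro subset_antisym subsetI)
  fix x assume "x \<in> tripled (grid_cell c s m)"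
  then obtain y z z' where *: "x = y + z - z'" "y \<in> cbox a (a + (\<chi> i. s))" "z \<in> cbox a (a + (\<chi> i. s))" "z' \<in> cbox a (a + (\<chi> i. s))"
    unfolding tripled_def closure_grid_cell[OF s] a_def by blast
  have "a $ i - s \<le> x $ i \<and> x $ i \<le> a $ i + 2 * s" for i
    using *(2-4) unfolding *(1) mem_box_cart by (auto dest!: spec[of _ i])
  then show "x \<in> cbox (a - (\<chi> i. s)) (a + (\<chi> i. 2 * s))" by (simp add: mem_box_cart)
next
  fix x assume x: "x \<in> cbox (a - (\<chi> i. s)) (a + (\<chi> i. 2 * s))"
  define t where "t i = x $ i - a $ i" for i
  have t: "- s \<le> t i" "t i \<le> 2 * s" for i using x unfolding t_def by (auto simp: mem_box_cart algebra_simps)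
  define y where "y = (\<chi> i. a $ i + (if t i < 0 then 0 else t i / 2))"
  define z where "z = (\<chi> i. a $ i + (if t i < 0 then - t i else 0))"
  have "y \<in> cbox a (a + (\<chi> i. s))" "z \<in> cbox a (a + (\<chi> i. s))"
    using t s unfolding mem_box_cart y_def z_def by (auto simp: not_less) (smt (verit))+
  moreover have "x = y + y - z" by (auto simp: vec_eq_iff y_def z_def t_def field_simps)
  ultimately show "x \<in> tripled (grid_cell c s m)"
    unfolding tripled_def closure_grid_cell[OF s] a_def by blast
qed

lemma tripled_cell_cube:
  fixes c :: "real ^ 'n" and m :: "int ^ 'n"
  assumes s: "s > 0"
  shows "tripled (grid_cell c s m) \<in> cubes"
    "measure lebesgue (tripled (grid_cell c s m)) = 3 ^ CARD('n) * measure lebesgue (grid_cell c s m)"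
proof -
  define a where "a = grid_corner c s m - (\<chi> i. s)"
  have b: "grid_corner c s m + (\<chi> i. 2 * s) = a + (\<chi> i. 3 * s)" unfolding a_def by (simp add: vec_eq_iff)
  have T: "tripled (grid_cell c s m) = cbox a (a + (\<chi> i. 3 * s))" unfolding tripled_cell[OF s] b by (simp add: a_def)
  then show "tripled (grid_cell c s m) \<in> cubes"
    unfolding cubes_def using s by (intro CollectI exI[of _ a] exI[of _ "3 * s"]) auto
  have "measure lebesgue (tripled (grid_cell c s m)) = (3 * s) ^ CARD('n)"
    unfolding T using measure_cube[of "3 * s" a] s by simp
  then show "measure lebesgue (tripled (grid_cell c s m)) = 3 ^ CARD('n) * measure lebesgue (grid_cell c s m)"
    unfolding lebesgue_grid_cell[OF s] by (simp add: power_mult_distrib)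
qed

definition dyadic_cell :: "int \<Rightarrow> int ^ 'n \<Rightarrow> (real ^ 'n) set"
  where "dyadic_cell k m = grid_cell 0 (2 powr k) m"

definition dyadic_family :: "nat \<Rightarrow> (real ^ 'n) set set"
  where "dyadic_family N =
    (\<lambda>(k, m). dyadic_cell k m) ` ({- int N..int N} \<times> {m. \<forall>i. m $ i \<in> {- int N..int N}})"

lemma dyadic_nested:
  assumes "x \<in> dyadic_cell k m" "x \<in> dyadic_cell k' m'" "k \<le> k'"
  shows "dyadic_cell k m \<subseteq> dyadic_cell k' m'"
proof -
  have "2 powr real_of_int k' = 2 powr k * 2 ^ nat (k' - k)"
    using assms(3) by (simp add: powr_realpow[symmetric] powr_add[symmetric])
  then show ?thesis
    using grid_cell_nested[of "2 powr k" x 0 m "nat (k' - k)" m'] assms unfolding dyadic_cell_def by simp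
qed

lemma dyadic_laminar: "laminar (dyadic_family N)"
  unfolding laminar_def
proof (intro ballI)
  fix Q R :: "(real ^ 'n) set" assume "Q \<in> dyadic_family N" "R \<in> dyadic_family N"
  then obtain k m k' m' where *: "Q = dyadic_cell k m" "R = dyadic_cell k' m'"
    unfolding dyadic_family_def by (auto elim!: imageE)
  show "Q \<inter> R = {} \<or> Q \<subseteq> R \<or> R \<subseteq> Q"
  proof (cases "Q \<inter> R = {}")
    case False
    then obtain x where "x \<in> Q" "x \<in> R" by blast
    then show ?thesis unfolding * using dyadic_nested by (meson nle_le)
  qed simp
qed

lemma finite_dyadic_family: "finite (dyadic_family N)"
  unfolding dyadic_family_def by (intro finite_imageI finite_cartesian_product finite_int_vec) auto

lemma dyadic_family_mono: "N \<le> N' \<Longrightarrow> dyadic_family N \<subseteq> dyadic_family N'"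
proof -
  assume "N \<le> N'"
  then have "{- int N..int N} \<subseteq> {- int N'..int N'}" by auto
  then show ?thesis unfolding dyadic_family_def by (intro image_mono Sigma_mono) blast+
qed

lemma dyadic_family_exhausts:
  obtains N where "dyadic_cell k m \<in> dyadic_family N"
proof -
  define N where "N = nat (\<bar>k\<bar> + (\<Sum>i\<in>UNIV. \<bar>m $ i\<bar>))"
  have m: "\<bar>m $ i\<bar> \<le> (\<Sum>i\<in>UNIV. \<bar>m $ i\<bar>)" for i by (intro member_le_sum) auto
  have "0 \<le> (\<Sum>i\<in>UNIV. \<bar>m $ i\<bar>)" by (intro sum_nonneg) auto
  then have N: "int N = \<bar>k\<bar> + (\<Sum>i\<in>UNIV. \<bar>m $ i\<bar>)" unfolding N_def by simp
  have "\<bar>k\<bar> \<le> int N" unfolding N using \<open>0 \<le> _\<close> by linarith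
  then have "k \<in> {- int N..int N}" by auto
  moreover have "m $ i \<in> {- int N..int N}" for i
  proof -
    have "\<bar>m $ i\<bar> \<le> int N" unfolding N using m[of i] by linarith
    then show ?thesis by auto
  qed
  ultimately have "(k, m) \<in> {- int N..int N} \<times> {m. \<forall>i. m $ i \<in> {- int N..int N}}" by blast
  then have "dyadic_cell k m \<in> dyadic_family N"
    unfolding dyadic_family_def by (rule image_eqI[rotated]) simp
  then show ?thesis by (rule that)
qed

section \<open>The maximal function\<close>

definition zero_one_vectors :: "(int ^ 'n) set"
  where "zero_one_vectors = {m. \<forall>i. m $ i \<in> {0, 1}}"

text \<open>A cube of side \<open>l\<close> is covered by the \<open>2\<^sup>n\<close> adjacent dyadic cells of side \<open>s \<in> [l, 2 l)\<close> around the one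
  containing its corner, and it lies in the triple of each of them. One of these cells must carry the
  corresponding share of the integral of \<open>|f|\<close>.\<close>

lemma maximal_function_dyadic:
  fixes f :: "real ^ 'n \<Rightarrow> real"
  assumes f: "f \<in> borel_measurable lebesgue" and t: "t \<ge> 0" and M: "maximal_function f x > ennreal t"
  obtains k m where "x \<in> tripled (dyadic_cell k m)"
    "average (dyadic_cell k m) f > ennreal (t / (card (zero_one_vectors :: (int ^ 'n) set) * 2 ^ CARD('n)))"
proof -
  let ?B = "zero_one_vectors :: (int ^ 'n) set"
  have finB: "finite ?B" unfolding zero_one_vectors_def by (rule finite_int_vec) simp
  have "0 \<in> ?B" unfolding zero_one_vectors_def by simp
  then have cB: "card ?B > 0" using finB by (auto simp: card_gt_0_iff)
  obtain Q where Q: "Q \<in> cubes" "x \<in> Q" "average Q f > ennreal t"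
    using M unfolding maximal_function_def less_SUP_iff by blast
  obtain a l where al: "Q = cbox a (a + (\<chi> i. l))" "l > 0" using Q(1) unfolding cubes_def by blast
  \<comment> \<open>The smallest dyadic side that is at least \<open>l\<close>.\<close>
  define k where "k = \<lceil>log 2 l\<rceil>"
  define s where "s = 2 powr real_of_int k"
  have s: "s > 0" unfolding s_def by simp
  have "log 2 l \<le> k" "k < log 2 l + 1" unfolding k_def by linarith+
  then have "2 powr (log 2 l) \<le> s" "s < 2 powr (log 2 l + 1)" unfolding s_def by (auto intro!: powr_mono powr_less_mono)
  then have ls: "l \<le> s" "s \<le> 2 * l" using al(2) by (auto simp: powr_add)
  define m where "m b = (\<chi> i. \<lfloor>a $ i / s\<rfloor> + b $ i)" for b :: "int ^ 'n"
  define R where "R b = grid_cell 0 s (m b)" for b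
  have R: "R b = dyadic_cell k (m b)" for b unfolding R_def dyadic_cell_def s_def ..
  have ai: "s * \<lfloor>a $ i / s\<rfloor> \<le> a $ i" "a $ i < s * \<lfloor>a $ i / s\<rfloor> + s" for i
    using floor_divide_lower[OF s, of "a $ i"] floor_divide_upper[OF s, of "a $ i"] by (auto simp: algebra_simps)
  have range: "s * \<lfloor>a $ i / s\<rfloor> \<le> y $ i" "y $ i < s * \<lfloor>a $ i / s\<rfloor> + 2 * s" if "y \<in> Q" for y i
    using that ai[of i] ls unfolding al by (auto simp: mem_box_cart) (smt (verit))+
  have cover: "Q \<subseteq> (\<Union>b\<in>?B. R b)"
  proof
    fix y assume y: "y \<in> Q"
    define b where "b = (\<chi> i. if y $ i < s * \<lfloor>a $ i / s\<rfloor> + s then 0 else (1 :: int))"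
    have "b \<in> ?B" unfolding b_def zero_one_vectors_def by simp
    moreover have "y \<in> R b"
      unfolding R_def grid_cell_iff[OF s] using range[OF y]
      by (auto simp: grid_corner_def m_def b_def algebra_simps)
    ultimately show "y \<in> (\<Union>b\<in>?B. R b)" by blast
  qed
  have xR: "x \<in> tripled (R b)" if "b \<in> ?B" for b
  proof -
    have b01: "b $ i = 0 \<or> b $ i = 1" for i using that unfolding zero_one_vectors_def by auto
    have "s * \<lfloor>a $ i / s\<rfloor> + s * b $ i - s \<le> x $ i \<and> x $ i \<le> s * \<lfloor>a $ i / s\<rfloor> + s * b $ i + 2 * s" for i
      using range[OF Q(2), of i] s b01[of i] by auto
    then show ?thesis
      unfolding R_def tripled_cell[OF s] by (simp add: mem_box_cart grid_corner_def m_def algebra_simps)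
  qed
  have "\<exists>b\<in>?B. average (R b) f > ennreal (t / (card ?B * 2 ^ CARD('n)))"
  proof (rule ccontr)
    assume "\<not> ?thesis"
    then have small: "average (R b) f \<le> ennreal (t / (card ?B * 2 ^ CARD('n)))" if "b \<in> ?B" for b
      using that by (auto simp: not_less)
    have mR: "emeasure lebesgue (R b) = ennreal (s ^ CARD('n))" for b
      unfolding R_def using emeasure_eq_measure2[OF grid_cell_lmeasurable[OF s]] lebesgue_grid_cell[OF s] by metis
    have intR: "(\<integral>\<^sup>+y\<in>R b. ennreal \<bar>f y\<bar> \<partial>lebesgue) \<le> ennreal (t / (card ?B * 2 ^ CARD('n)) * s ^ CARD('n))" if b: "b \<in> ?B" for b
    proof -
      have "(\<integral>\<^sup>+y\<in>R b. ennreal \<bar>f y\<bar> \<partial>lebesgue) = average (R b) f * ennreal (s ^ CARD('n))"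
        unfolding average_def mR using s by (subst ennreal_divide_times) (simp add: ennreal_mult_divide_eq)
      also have "\<dots> \<le> ennreal (t / (card ?B * 2 ^ CARD('n))) * ennreal (s ^ CARD('n))"
        by (intro mult_right_mono small b) auto
      finally show ?thesis using t s by (simp add: ennreal_mult[symmetric])
    qed
    have "(\<integral>\<^sup>+y\<in>Q. ennreal \<bar>f y\<bar> \<partial>lebesgue) \<le> (\<integral>\<^sup>+y. (\<Sum>b\<in>?B. ennreal \<bar>f y\<bar> * indicator (R b) y) \<partial>lebesgue)"
    proof (rule nn_integral_mono)
      fix y
      show "ennreal \<bar>f y\<bar> * indicator Q y \<le> (\<Sum>b\<in>?B. ennreal \<bar>f y\<bar> * indicator (R b) y)"
      proof (cases "y \<in> Q")
        case True
        then obtain b where b: "b \<in> ?B" "y \<in> R b" using cover by blast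
        have "ennreal \<bar>f y\<bar> * indicator (R b) y \<le> (\<Sum>b\<in>?B. ennreal \<bar>f y\<bar> * indicator (R b) y)"
          using b finB by (intro member_le_sum) auto
        then show ?thesis using b True by simp
      qed simp
    qed
    also have "\<dots> = (\<Sum>b\<in>?B. \<integral>\<^sup>+y\<in>R b. ennreal \<bar>f y\<bar> \<partial>lebesgue)"
    proof (rule nn_integral_sum)
      show "(\<lambda>y. ennreal \<bar>f y\<bar> * indicator (R b) y) \<in> borel_measurable lebesgue" for b
        using f grid_cell_sets[OF s, of 0 "m b"] unfolding R_def[symmetric] by measurable
    qed
    also have "\<dots> \<le> (\<Sum>b\<in>?B. ennreal (t / (card ?B * 2 ^ CARD('n)) * s ^ CARD('n)))"
      by (intro sum_mono intR)
    also have "\<dots> = ennreal (t / 2 ^ CARD('n) * s ^ CARD('n))"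
      using cB t s by (simp add: ennreal_mult[symmetric] ennreal_of_nat_eq_real_of_nat)
    also have "\<dots> \<le> ennreal (t * l ^ CARD('n))"
    proof (rule ennreal_leI)
      have "s ^ CARD('n) \<le> (2 * l) ^ CARD('n)" using ls s by (intro power_mono) auto
      then have "t / 2 ^ CARD('n) * s ^ CARD('n) \<le> t / 2 ^ CARD('n) * (2 * l) ^ CARD('n)"
        using t by (intro mult_left_mono) auto
      then show "t / 2 ^ CARD('n) * s ^ CARD('n) \<le> t * l ^ CARD('n)" by (simp add: power_mult_distrib)
    qed
    finally have I: "(\<integral>\<^sup>+y\<in>Q. ennreal \<bar>f y\<bar> \<partial>lebesgue) \<le> ennreal (t * l ^ CARD('n))" .
    have "emeasure lebesgue Q = ennreal (l ^ CARD('n))"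
      unfolding al using measure_cube[of l a] al(2) emeasure_eq_measure2[of "cbox a (a + (\<chi> i. l))" lebesgue] by simp
    then have "average Q f \<le> ennreal t"
      unfolding average_def using I al(2) t
      by (intro divide_le_posI_ennreal) (auto simp: ennreal_mult mult.commute)
    then show False using Q(3) by simp
  qed
  then obtain b where "b \<in> ?B" "average (R b) f > ennreal (t / (card ?B * 2 ^ CARD('n)))" by blast
  then show ?thesis using that xR unfolding R by blast
qed

section \<open>The mixed weak type inequality\<close>

text \<open>The constants do not depend on the size \<open>N\<close> of the family, which allows \<open>N \<rightarrow> \<infinity>\<close>. Since
  all ratios are at most 1, the two decay exponents may be replaced by their minimum.\<close>

lemma comparable_tree_dyadic:
  fixes u v w :: "real ^ 'n \<Rightarrow> real"
  assumes p: "p \<ge> 1" and u: "weight u" "comparable_to_lebesgue p B u"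
    and w: "weight w" "comparable_to_lebesgue r C w" "r > 0"
    and v: "weight v" and w_eq: "\<And>x. w x = u x * v x powr p"
  obtains K \<delta> where "\<And>N. comparable_tree (weight_measure u) (weight_measure w) v p K \<delta> (dyadic_family N) tripled"
proof -
  let ?U = "measure (weight_measure u)" and ?W = "measure (weight_measure w)"
  have p0: "p > 0" using p by simp
  obtain K1 \<delta>1 where K1: "K1 > 0" "\<delta>1 > 0"
    "\<And>Q E. \<lbrakk>Q \<in> cubes; E \<in> sets lebesgue; E \<subseteq> Q\<rbrakk> \<Longrightarrow> ?U E \<le> K1 * (?W E / ?W Q) powr \<delta>1 * ?U Q"
    using two_weight_decay[OF u p0 w] by blast
  obtain K2 \<delta>2 where K2: "K2 > 0" "\<delta>2 > 0"
    "\<And>Q E. \<lbrakk>Q \<in> cubes; E \<in> sets lebesgue; E \<subseteq> Q\<rbrakk> \<Longrightarrow> ?W E \<le> K2 * (?U E / ?U Q) powr \<delta>2 * ?W Q"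
    using two_weight_decay[OF w u p0] by blast
  define Du where "Du = B * (3 ^ CARD('n)) powr p"
  define Dw where "Dw = C * (3 ^ CARD('n)) powr r"
  define K where "K = Max {1, K1, K2, Du, Dw}"
  define \<delta> where "\<delta> = Min {1, \<delta>1, \<delta>2}"
  have K: "1 \<le> K" "K1 \<le> K" "K2 \<le> K" "Du \<le> K" "Dw \<le> K" unfolding K_def by auto
  have \<delta>: "0 < \<delta>" "\<delta> \<le> 1" "\<delta> \<le> \<delta>1" "\<delta> \<le> \<delta>2" unfolding \<delta>_def using K1 K2 by auto
  have weaken: "x \<le> K * t powr \<delta> * y"
    if "x \<le> K' * t powr \<delta>' * y" "K' \<le> K" "0 < K'" "\<delta> \<le> \<delta>'" "0 \<le> t" "t \<le> 1" "0 \<le> y" for x y t K' \<delta>'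
  proof -
    have "t powr \<delta>' \<le> t powr \<delta>" using that by (intro powr_mono') auto
    then have "K' * t powr \<delta>' * y \<le> K * t powr \<delta> * y" using that by (intro mult_right_mono mult_mono) auto
    then show ?thesis using that(1) by linarith
  qed
  have ratio: "measure M E / measure M Q \<le> 1" if "E \<subseteq> Q" "Q \<in> fmeasurable M" "E \<in> sets M" for M :: "(real ^ 'n) measure" and E Q
    using measure_mono_fmeasurable[OF that(1,3,2)] by (auto simp: divide_le_eq_1 zero_less_measure_iff)
  have cell: "\<exists>k m. R = grid_cell 0 (2 powr k) m" if "R \<in> dyadic_family N" for R :: "(real ^ 'n) set" and N
    using that unfolding dyadic_family_def dyadic_cell_def by auto
  have tree: "comparable_tree (weight_measure u) (weight_measure w) v p K \<delta> (dyadic_family N) tripled" for N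
  proof
    show "p \<ge> 1" "K \<ge> 1" "0 < \<delta>" "\<delta> \<le> 1" by (fact p K \<delta>)+
    show "sets (weight_measure w) = sets (weight_measure u)" "space (weight_measure u) = UNIV" by auto
    show "v \<in> borel_measurable (weight_measure u)"
      using weight_borel[OF v] by (simp add: measurable_def space_weight)
    show "v x > 0" for x by (rule weight_pos[OF v])
    show "finite (dyadic_family N)" "laminar (dyadic_family N)" by (rule finite_dyadic_family dyadic_laminar)+
    show "Q \<subseteq> tripled Q" for Q by (rule subset_tripled)
    show "tripled Q \<subseteq> tripled R" if "Q \<subseteq> R" for Q R using that by (rule tripled_mono)
    fix Q :: "(real ^ 'n) set" assume "Q \<in> dyadic_family N"
    then obtain k m where Q: "Q = grid_cell 0 (2 powr k) m" using cell by blast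
    have s: "2 powr k > (0::real)" by simp
    have T: "tripled Q \<in> cubes" "measure lebesgue (tripled Q) = 3 ^ CARD('n) * measure lebesgue Q"
      unfolding Q by (rule tripled_cell_cube[OF s])+
    have Qs: "Q \<in> sets lebesgue" unfolding Q using s by simp
    show "Q \<in> sets (weight_measure u)" using Qs by simp
    show fT: "tripled Q \<in> fmeasurable (weight_measure u)" "tripled Q \<in> fmeasurable (weight_measure w)"
      using subset_cube_fmeasurable(1)[OF u(1) T(1) order_refl cube_borel[OF T(1)]]
        subset_cube_fmeasurable(1)[OF w(1) T(1) order_refl cube_borel[OF T(1)]] .
    show "?U Q > 0" "?W Q > 0" unfolding Q using weight_cell_pos(1)[OF u(1) s] weight_cell_pos(1)[OF w(1) s] by blast+
    have "?U (tripled Q) \<le> Du * ?U Q"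
      unfolding Du_def by (rule doubling[OF u T(1) Qs subset_tripled T(2)])
    also have "\<dots> \<le> K * ?U Q" using K by (intro mult_right_mono) auto
    finally show "?U (tripled Q) \<le> K * ?U Q" .
    have "?W (tripled Q) \<le> Dw * ?W Q"
      unfolding Dw_def by (rule doubling[OF w(1,2) T(1) Qs subset_tripled T(2)])
    also have "\<dots> \<le> K * ?W Q" using K by (intro mult_right_mono) auto
    finally show "?W (tripled Q) \<le> K * ?W Q" .
    fix E :: "(real ^ 'n) set" assume "E \<in> sets (weight_measure u)"
    then have E: "E \<in> sets lebesgue" by simp
    show "?W E \<le> c powr p * ?U E" if "E \<subseteq> tripled Q" "c > 0" "\<And>x. x \<in> E \<Longrightarrow> v x \<le> c" for c
    proof (rule weight_density_le[OF u(1) w(1) E])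
      show "w x \<le> c powr p * u x" if "x \<in> E" for x
      proof -
        have "v x powr p \<le> c powr p" using \<open>\<And>x. x \<in> E \<Longrightarrow> v x \<le> c\<close>[OF that] weight_pos[OF v, of x] p by (intro powr_mono2) auto
        then show ?thesis unfolding w_eq using weight_pos[OF u(1), of x] by (simp add: mult.commute)
      qed
      show "E \<in> fmeasurable (weight_measure u)"
        by (rule fmeasurableI2[OF fT(1) that(1)]) (use E in simp)
    qed simp
    show "?U E \<le> K * (?W E / ?W (tripled Q)) powr \<delta> * ?U (tripled Q)" if ET: "E \<subseteq> tripled Q"
    proof (rule weaken[OF _ K(2) K1(1) \<delta>(3)])
      show "?U E \<le> K1 * (?W E / ?W (tripled Q)) powr \<delta>1 * ?U (tripled Q)"
        by (rule K1(3)[OF T(1) E ET])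
      show "?W E / ?W (tripled Q) \<le> 1" by (rule ratio[OF ET fT(2)]) (use E in simp)
    qed auto
    define Qc where "Qc = cbox (grid_corner 0 (2 powr k) m) (grid_corner 0 (2 powr k) m + (\<chi> i. 2 powr k))"
    have Qc: "Qc \<in> cubes" "Q \<subseteq> Qc" "?U Q = ?U Qc" "?W Q = ?W Qc"
      unfolding Qc_def Q using grid_closure_cube[OF s] grid_cell_between(2)[OF s] weight_grid_cell[OF u(1) s] weight_grid_cell[OF w(1) s] by blast+
    show "?W E \<le> K * (?U E / ?U Q) powr \<delta> * ?W Q" if EQ: "E \<subseteq> Q"
    proof (rule weaken[OF _ K(3) K2(1) \<delta>(4)])
      show "?W E \<le> K2 * (?U E / ?U Q) powr \<delta>2 * ?W Q"
        unfolding Qc using EQ Qc(2) by (intro K2(3) Qc(1) E) auto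
      have "Q \<in> fmeasurable (weight_measure u)" by (rule subset_cube_fmeasurable(1)[OF u(1) Qc(1,2) Qs])
      then show "?U E / ?U Q \<le> 1" by (rule ratio[OF EQ]) (use E in simp)
    qed auto
  qed
  show ?thesis by (rule that[OF tree])
qed

text \<open>For each \<open>y > 0\<close> the tree estimate is applied with \<open>g(Q)\<close> equal to \<open>\<kappa>/y\<close> times the average of \<open>|f|\<close>, on dyadic
  families exhausting all dyadic cubes.\<close>

theorem theorem3p8:
  fixes p :: real and u v :: "real ^ 'n \<Rightarrow> real"
  assumes "p \<ge> 1"
    and "weight u" and "weight v"
    and "u \<in> A_restricted p"
    and "(\<lambda>x. u x * v x powr p) \<in> A_infinity"
  shows "\<exists>C::real. C > 0 \<and>
    (\<forall>f :: real ^ 'n \<Rightarrow> real. f \<in> borel_measurable lebesgue \<longrightarrow>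
      lorentz_weak (weight_measure (\<lambda>x. u x * v x powr p)) (ennreal p)
          (\<lambda>x. maximal_function f x / ennreal (v x))
        \<le> ennreal C * lorentz_1 (weight_measure u) p (\<lambda>x. ennreal \<bar>f x\<bar>))"
proof -
  note p = assms(1) and u = assms(2) and v = assms(3)
  define w where "w = (\<lambda>x. u x * v x powr p)"
  have w: "weight w" using assms(5) unfolding w_def A_infinity_def Muckenhoupt_def by auto
  obtain B where B: "comparable_to_lebesgue p B u" using A_restricted_imp_comparable[OF p assms(4)] by blast
  obtain r C where r: "r \<ge> 1" and C: "comparable_to_lebesgue r C w"
    using A_infinity_imp_comparable assms(5) unfolding w_def by blast
  have r0: "r > 0" using r by simp
  obtain K \<delta> where tree: "\<And>N. comparable_tree (weight_measure u) (weight_measure w) v p K \<delta> (dyadic_family N) tripled"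
    using comparable_tree_dyadic[OF p u B w C r0 v, of thesis] unfolding w_def by blast
  have B1: "B \<ge> 1" by (rule comparable_constant_ge_1[OF u B])
  define V where "V = max 1 (comparable_tree.weak_const p K \<delta>)"
  define \<kappa> where "\<kappa> = real (card (zero_one_vectors :: (int ^ 'n) set) * 2 ^ CARD('n))"
  have \<kappa>: "\<kappa> > 0"
  proof -
    have "finite (zero_one_vectors :: (int ^ 'n) set)" unfolding zero_one_vectors_def by (rule finite_int_vec) simp
    moreover have "0 \<in> (zero_one_vectors :: (int ^ 'n) set)" unfolding zero_one_vectors_def by simp
    ultimately have "card (zero_one_vectors :: (int ^ 'n) set) > 0" by (auto simp: card_gt_0_iff)
    then show ?thesis unfolding \<kappa>_def by simp
  qed
  have V: "V \<ge> 1" unfolding V_def by simp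
  define A where "A = \<kappa> * (V * B) powr (1 / p)"
  have A: "A > 0" unfolding A_def using \<kappa> V B1 by simp
  have "lorentz_weak (weight_measure w) (ennreal p) (\<lambda>x. maximal_function f x / ennreal (v x))
        \<le> ennreal A * lorentz_1 (weight_measure u) p (\<lambda>x. ennreal \<bar>f x\<bar>)"
    if f: "f \<in> borel_measurable lebesgue" for f :: "real ^ 'n \<Rightarrow> real"
  proof -
    let ?I = "\<integral>\<^sup>+y\<in>{0<..}. distribution_fun (weight_measure u) (\<lambda>x. ennreal \<bar>f x\<bar>) y epowr (1 / p) \<partial>lborel"
    let ?M = "\<lambda>x. maximal_function f x / ennreal (v x)"
    have L1: "lorentz_1 (weight_measure u) p (\<lambda>x. ennreal \<bar>f x\<bar>) = ennreal p * ?I" unfolding lorentz_1_def ..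
    show ?thesis
    proof (cases ?I)
      case top
      then show ?thesis unfolding L1 using A p by (simp add: ennreal_mult_top)
    next
      case (real I)
      have bound: "ennreal y * distribution_fun (weight_measure w) ?M y epowr (1 / p) \<le> ennreal (A * I)" if y: "y > 0" for y
      proof -
        define g where "g Q = \<kappa> / y * enn2real (average Q f)" for Q
        define X where "X N = {x. \<exists>Q\<in>dyadic_family N. x \<in> tripled Q \<and> v x < g Q \<and> 2 powr (- int N) \<le> v x}" for N
        define S where "S = (\<kappa> / y) powr p * (B * I powr p)"
        have S0: "S \<ge> 0" unfolding S_def using B1 by simp
        have fam: "\<exists>c s m. s > 0 \<and> Q = grid_cell c s m" if "Q \<in> dyadic_family N" for Q :: "(real ^ 'n) set" and N
          using that unfolding dyadic_family_def dyadic_cell_def by (auto intro!: exI[of _ "2 powr _"])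
        have XN: "emeasure (weight_measure w) (X N) \<le> ennreal (V * S)" for N
        proof -
          have "emeasure (weight_measure w) (X N) \<le> ennreal (comparable_tree.weak_const p K \<delta> * S)"
            unfolding X_def
          proof (rule comparable_tree.truncated_weak_bound[OF tree])
            fix F :: "(real ^ 'n) set set" assume F: "F \<subseteq> dyadic_family N" "disjoint F"
            have finF: "finite F" using F(1) finite_dyadic_family finite_subset by blast
            have "(\<Sum>Q\<in>F. g Q powr p * measure (weight_measure u) Q)
                = (\<kappa> / y) powr p * (\<Sum>Q\<in>F. enn2real (average Q f) powr p * measure (weight_measure u) Q)"
            proof -
              have "g Q powr p = (\<kappa> / y) powr p * enn2real (average Q f) powr p" for Q
                unfolding g_def by (rule powr_mult)
              then show ?thesis by (simp add: sum_distrib_left mult.assoc)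
            qed
            also have "\<dots> \<le> S"
              unfolding S_def using F fam
              by (intro mult_left_mono disjoint_averages_bound(1)[OF u B p f finF F(2) _ real(2,1)]) auto
            finally show "(\<Sum>Q\<in>F. g Q powr p * measure (weight_measure u) Q) \<le> S" .
          qed
          also have "\<dots> \<le> ennreal (V * S)" using S0 unfolding V_def by (intro ennreal_leI mult_right_mono) auto
          finally show ?thesis .
        qed
        have Xs: "X N \<in> sets lebesgue" for N
        proof -
          have "X N = (\<Union>Q\<in>dyadic_family N. tripled Q \<inter> {x \<in> space lebesgue. v x < g Q \<and> 2 powr (- int N) \<le> v x})"
            unfolding X_def by auto
          moreover have "tripled Q \<in> sets lebesgue" if "Q \<in> dyadic_family N" for Q :: "(real ^ 'n) set"
            using fam[OF that] tripled_cell_cube(1) cube_borel by metis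
          moreover have "{x \<in> space lebesgue. v x < g Q \<and> 2 powr (- int N) \<le> v x} \<in> sets lebesgue" for Q
            using weight_borel[OF v] by measurable
          ultimately show ?thesis using finite_dyadic_family by (auto intro!: sets.finite_UN)
        qed
        have inc: "incseq X"
        proof (rule incseq_SucI)
          fix N
          have "(2::real) powr (- int (Suc N)) \<le> 2 powr (- int N)" by (intro powr_mono) auto
          then have "2 powr (- int (Suc N)) \<le> v x" if "2 powr (- int N) \<le> v x" for x
            using that by (rule order_trans)
          moreover have "dyadic_family N \<subseteq> (dyadic_family (Suc N) :: (real ^ 'n) set set)"
            by (rule dyadic_family_mono) simp
          ultimately show "X N \<subseteq> X (Suc N)" unfolding X_def by blast
        qed
        have cover: "{x \<in> space (weight_measure w). ?M x > ennreal y} \<subseteq> (\<Union>N. X N)"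
        proof
          fix x assume "x \<in> {x \<in> space (weight_measure w). ?M x > ennreal y}"
          then have Mx: "?M x > ennreal y" by simp
          have vx: "v x > 0" by (rule weight_pos[OF v])
          have "maximal_function f x > ennreal (y * v x)"
          proof (rule ccontr)
            assume "\<not> ?thesis"
            then have "?M x \<le> ennreal y"
              using vx y by (intro divide_le_posI_ennreal) (auto simp: not_less ennreal_mult mult.commute)
            then show False using Mx by simp
          qed
          moreover have "y * v x \<ge> 0" using y vx by simp
          ultimately obtain k m where km: "x \<in> tripled (dyadic_cell k m)"
              "average (dyadic_cell k m) f > ennreal (y * v x / \<kappa>)"
            unfolding \<kappa>_def using maximal_function_dyadic[OF f] by blast
          let ?Q = "dyadic_cell k m"
          have fin: "average ?Q f < top"
          proof (rule disjoint_averages_bound(2)[OF u B p f _ _ _ real(2,1), of "{?Q}"])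
            show "\<exists>c s m. s > 0 \<and> Q = grid_cell c s m" if "Q \<in> {?Q}" for Q
              using that unfolding dyadic_cell_def by (auto intro!: exI[of _ "2 powr _"])
          qed auto
          then have "ennreal (y * v x / \<kappa>) < ennreal (enn2real (average ?Q f))" using km(2) by simp
          then have "y * v x / \<kappa> < enn2real (average ?Q f)" using y vx \<kappa> by (subst (asm) ennreal_less_iff) auto
          then have gQ: "v x < g ?Q" unfolding g_def using y \<kappa> by (simp add: field_simps)
          obtain N1 where N1: "?Q \<in> dyadic_family N1" by (rule dyadic_family_exhausts)
          obtain N2 where N2: "(1 / 2) ^ N2 < v x" using real_arch_pow_inv[OF vx, of "1 / 2"] by auto
          define N where "N = max N1 N2"
          have "2 powr (- int N) \<le> 2 powr (- real N2)" unfolding N_def by (intro powr_mono) auto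
          also have "\<dots> = (1 / 2) ^ N2" by (simp add: powr_minus powr_realpow power_one_over inverse_eq_divide)
          finally have "2 powr (- int N) \<le> v x" using N2 by simp
          moreover have "?Q \<in> dyadic_family N" using N1 dyadic_family_mono[of N1 N] unfolding N_def by auto
          ultimately have "x \<in> X N" unfolding X_def using km(1) gQ by blast
          then show "x \<in> (\<Union>N. X N)" by blast
        qed
        have "distribution_fun (weight_measure w) ?M y \<le> emeasure (weight_measure w) (\<Union>N. X N)"
          unfolding distribution_fun_def using cover Xs by (intro emeasure_mono) auto
        also have "\<dots> = (SUP N. emeasure (weight_measure w) (X N))"
          using Xs inc by (intro SUP_emeasure_incseq[symmetric]) auto
        also have "\<dots> \<le> ennreal (V * S)" by (intro SUP_least XN)
        finally have d: "distribution_fun (weight_measure w) ?M y \<le> ennreal (V * S)" .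
        define e where "e = enn2real (distribution_fun (weight_measure w) ?M y)"
        have e: "distribution_fun (weight_measure w) ?M y = ennreal e" "e \<ge> 0"
          unfolding e_def using d by (auto simp: top_unique less_top[symmetric] intro!: ennreal_enn2real[symmetric] le_less_trans[OF d])
        have "e \<le> V * S" using d V S0 unfolding e(1) by (subst (asm) ennreal_le_iff) auto
        then have "y * e powr (1 / p) \<le> y * (V * S) powr (1 / p)"
          using e(2) y p by (intro mult_left_mono powr_mono2) auto
        also have "(V * S) powr (1 / p) = \<kappa> / y * (V * B) powr (1 / p) * I"
          unfolding S_def using V \<kappa> y B1 real(1) p by (simp add: powr_mult powr_powr powr_divide)
        also have "y * (\<kappa> / y * (V * B) powr (1 / p) * I) = A * I" unfolding A_def using y by simp
        finally have "ennreal (y * e powr (1 / p)) \<le> ennreal (A * I)" by (rule ennreal_leI)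
        then show ?thesis unfolding e(1) ennreal_powr_def using e(2) y by (simp add: ennreal_mult)
      qed
      have "lorentz_weak (weight_measure w) (ennreal p) ?M \<le> ennreal (A * I)"
        unfolding lorentz_weak_def using bound p by (auto intro!: SUP_least)
      also have "\<dots> \<le> ennreal (A * (p * I))"
        using A p real(1) mult_right_mono[of 1 p I] by (intro ennreal_leI mult_left_mono) auto
      also have "\<dots> = ennreal A * lorentz_1 (weight_measure u) p (\<lambda>x. ennreal \<bar>f x\<bar>)"
        unfolding L1 real(2) using A p real(1) by (simp add: ennreal_mult)
      finally show ?thesis .
    qed
  qed
  then show ?thesis using A unfolding w_def by blast
qed

end
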